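(* Let $N>1$ be an integer and let $Q:=\{\mathbf{q}_1,\dots,\mathbf{q}_N\}\subset\mathbb{E}^2$ be a uniform contraction of $P:=\{\mathbf{p}_1,\dots,\mathbf{p}_N\}\subset\mathbb{E}^2$ in $\mathbb{E}^2$. Then $\mathrm{V}_1(P^r)\leq \mathrm{V}_1(Q^r)$ holds for any $r>0$.
   Context: $\mathbb{E}^2$ is the Euclidean plane with origin $\mathbf{o}$ and Euclidean norm $|\cdot|$. For $\mathbf{p}\in\mathbb{E}^2$ and $r\ge 0$, $\mathbf{B}^2[\mathbf{p},r]:=\{\mathbf{q}\in\mathbb{E}^2 : |\mathbf{p}-\mathbf{q}|\leq r\}$. For a nonempty compact set $A\subset\mathbb{E}^2$, $A^r:=\bigcap\{\mathbf{B}^2[\mathbf{p},r] : \mathbf{p}\in A\}$; in particular $P^r=\bigcap_{i=1}^N\mathbf{B}^2[\mathbf{p}_i,r]$. For a compact convex set $A\subset\mathbb{E}^2$, $\mathrm{V}_1(A)$ denotes the first intrinsic volume, determined for nonempty $A$ by Steiner's formula $\mathrm{V}_2(A+\epsilon\mathbf{B}^2[\mathbf{o},1])=\mathrm{V}_2(A)+2\mathrm{V}_1(A)\epsilon+\pi\epsilon^2$ for all $\epsilon\geq 0$, where $\mathrm{V}_2$ is area (so $2\mathrm{V}_1(A)$ is the perimeter of $A$). Convention: $\mathrm{V}_1(\emptyset)=0$. A labeled point set $Q=\{\mathbf{q}_1,\dots,\mathbf{q}_N\}\subset\mathbb{E}^2$ is a uniform contraction of a labeled point set $P=\{\mathbf{p}_1,\dots,\mathbf{p}_N\}\subset\mathbb{E}^2$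 in $\mathbb{E}^2$ if there exists $\lambda>0$ such that $|\mathbf{q}_i-\mathbf{q}_j|\leq\lambda\leq|\mathbf{p}_i-\mathbf{p}_j|$ for all $1\leq i<j\leq N$. *)

theory Defs
  imports "HOL-Analysis.Analysis"
begin

definition ball_polytope :: "'a::metric_space set \<Rightarrow> real \<Rightarrow> 'a set" where
  "ball_polytope A r = (\<Inter>p\<in>A. cball p r)"

(* Labeled point sets of N points are functions restricted to the indices 1..N; they need not
   be injective, so that several q i may coincide. *)
definition uniform_contraction ::
    "nat \<Rightarrow> (nat \<Rightarrow> 'a::metric_space) \<Rightarrow> (nat \<Rightarrow> 'a) \<Rightarrow> bool" where
  "uniform_contraction N q p \<longleftrightarrow>
     (\<exists>lam>0. \<forall>i j. 1 \<le> i \<and> i < j \<and> j \<le> N \<longrightarrow>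
        dist (q i) (q j) \<le> lam \<and> lam \<le> dist (p i) (p j))"

abbreviation V2 :: "(real ^ 2) set \<Rightarrow> real" where
  "V2 A \<equiv> measure lebesgue A"

(* A + B is the Minkowski sum. The number v is the coefficient in Steiner's formula; it is unique
   (see V1_eqI), and it exists when A is nonempty, compact and convex. V1 is meaningful only for
   such A and for the empty set. *)
definition V1 :: "(real ^ 2) set \<Rightarrow> real" where
  "V1 A = (if A = {} then 0
     else (THE v. \<forall>\<epsilon>\<ge>0. V2 (A + (*\<^sub>R) \<epsilon> ` cball 0 1) = V2 A + 2 * v * \<epsilon> + pi * \<epsilon>\<^sup>2))"

lemma V1_eqI:
  assumes "A \<noteq> {}"
    and v: "\<And>\<epsilon>. \<epsilon> \<ge> 0 \<Longrightarrow> V2 (A + (*\<^sub>R) \<epsilon> ` cball 0 1) = V2 A + 2 * v * \<epsilon> + pi * \<epsilon>\<^sup>2"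
  shows "V1 A = v"
proof -
  have "(THE v. \<forall>\<epsilon>\<ge>0. V2 (A + (*\<^sub>R) \<epsilon> ` cball 0 1) = V2 A + 2 * v * \<epsilon> + pi * \<epsilon>\<^sup>2) = v"
  proof (rule the_equality)
    show "\<forall>\<epsilon>\<ge>0. V2 (A + (*\<^sub>R) \<epsilon> ` cball 0 1) = V2 A + 2 * v * \<epsilon> + pi * \<epsilon>\<^sup>2"
      using v by blast
  next
    fix w
    assume "\<forall>\<epsilon>\<ge>0. V2 (A + (*\<^sub>R) \<epsilon> ` cball 0 1) = V2 A + 2 * w * \<epsilon> + pi * \<epsilon>\<^sup>2"
    from this[rule_format, of 1] v[of 1] show "w = v" by simp
  qed
  then show ?thesis using assms(1) by (simp add: V1_def)
qed

end

theory Submission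
  imports Defs
begin

text \<open>Write \<open>F\<^sup>r\<close> for the intersection of the discs of radius \<open>r\<close> around the points of a finite set \<open>F\<close>.
The boundary of \<open>F\<^sup>r\<close> consists of arcs of radius \<open>r\<close> and of corners. Accordingly a direction \<open>u\<close> is
either smooth, which means that the support point of \<open>F\<^sup>r\<close> in direction \<open>u\<close> is \<open>p + r u\<close> for a
centre \<open>p\<close>, or it belongs to the normal cone of a corner. The directions that are smooth for \<open>p\<close> span a
sector \<open>K\<^sub>p\<close> of the unit disc. Sorting the points of an outer parallel set by their nearest points
yields Steiner's formula with \<open>V\<^sub>1(F\<^sup>r) = r \<Sum> area K\<^sub>p\<close> (\<open>steiner_ball_polytope\<close>), and the
comparison becomes one of total angles.

Both bounds on the total angle come from widening the sectors. If \<open>u\<close> is smooth for \<open>p\<close> and \<open>w\<close> is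
smooth for \<open>q\<close>, then \<open>r |u - w| \<ge> |p - q|\<close> (\<open>normal_separation\<close>). Hence the sectors stay disjoint
when they are widened on both sides by angles \<open>\<rho>\<^sub>p\<close> with \<open>\<rho>\<^sub>p + \<rho>\<^sub>q \<le> 2 arcsin(|p - q| / 2r)\<close>,
which bounds \<open>V\<^sub>1(P\<^sup>r)\<close> from above (\<open>V1_upper_bound\<close>). In the other direction, if all distances in
\<open>Q\<close> are at most \<open>\<lambda>\<close> and \<open>Q\<^sup>r\<close> has at least two points, then the sectors of \<open>Q\<close>, widened by
\<open>a = arcsin(\<lambda> / 2r)\<close>, cover the disc (\<open>V1_lower_bound\<close>).

For \<open>N \<le> 3\<close> this suffices: \<open>V\<^sub>1(P\<^sup>r) \<le> \<pi>r - N r a \<le> V\<^sub>1(Q\<^sup>r)\<close>. The only obstacle is a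
triangle \<open>P\<close> with a vertex that has no smooth direction; such a vertex lies so deep between the two
others that these alone give a stronger bound (\<open>arcsin_pair_of_inessential\<close>). If \<open>r\<close> is so small
that \<open>Q\<^sup>r\<close> might have fewer than two points, then \<open>N a \<ge> \<pi>\<close> and the bound for \<open>P\<close> is not positive.

For \<open>N \<ge> 4\<close> the set \<open>Q\<close> is treated by Jung's theorem: \<open>Q\<close> lies in a disc of radius \<open>\<lambda>/\<surd>3\<close>, so
\<open>Q\<^sup>r\<close> contains a disc of radius \<open>r - \<lambda>/\<surd>3\<close>. Of \<open>P\<close> only four points are kept. Because
\<open>V\<^sub>1(F\<^sup>R) \<ge> V\<^sub>1(F\<^sup>r) + \<pi>(R - r)\<close>, these may be studied for a large radius \<open>R\<close>, for which every point
outside the convex hull of the others has a smooth direction. Four points in convex position then lose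
at least \<open>2\<lambda>\<close> against \<open>\<pi>r\<close>; if one point is in the triangle of the others, it sees a side under an
angle of at least 120 degrees, this side has length at least \<open>\<surd>3 \<lambda>\<close>, and the triangle loses at
least \<open>(1 + \<surd>3/2) \<lambda>\<close> (\<open>V1_upper_four_points\<close>). The proof closes with \<open>\<pi>/\<surd>3 \<le> 1 + \<surd>3/2\<close>.\<close>

section \<open>Intersections of congruent discs\<close>

lemma mem_ball_polytope: "x \<in> ball_polytope F r \<longleftrightarrow> (\<forall>p\<in>F. norm (x - p) \<le> r)"
  for x :: "real ^ 2"
  by (auto simp: ball_polytope_def dist_norm norm_minus_commute)

lemma convex_ball_polytope: "convex (ball_polytope F r)" for F :: "(real ^ 2) set"
  unfolding ball_polytope_def by (intro convex_INT convex_cball)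

lemma closed_ball_polytope: "closed (ball_polytope F r)" for F :: "(real ^ 2) set"
  unfolding ball_polytope_def by (intro closed_INT ballI closed_cball)

lemma compact_ball_polytope: "F \<noteq> {} \<Longrightarrow> compact (ball_polytope F r)" for F :: "(real ^ 2) set"
  unfolding ball_polytope_def by (intro compact_Inter) auto

lemma ball_polytope_antimono: "F \<subseteq> G \<Longrightarrow> ball_polytope G r \<subseteq> ball_polytope F r"
  unfolding ball_polytope_def by blast

lemma norm_plus_scaled_sq:
  "(norm (x + t *\<^sub>R w))\<^sup>2 = (norm x)\<^sup>2 + 2 * t * (w \<bullet> x) + t\<^sup>2 * (norm w)\<^sup>2"
  for x w :: "'a::real_inner"
  unfolding power2_norm_eq_inner
  by (simp add: inner_add_left inner_add_right inner_commute algebra_simps power2_eq_square)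

text \<open>Only the discs whose boundary contains \<open>x\<close> restrict a short step from \<open>x\<close>, and a step into the
interior of each of them is possible. Such steps serve below to refute that a point is a support point.\<close>

lemma feasible_direction:
  fixes F :: "(real ^ 2) set"
  assumes "finite F" "x \<in> ball_polytope F r" "r > 0"
    and w: "\<And>p. p \<in> F \<Longrightarrow> norm (x - p) = r \<Longrightarrow> w \<bullet> (x - p) < 0"
  shows "\<exists>t>0. x + t *\<^sub>R w \<in> ball_polytope F r"
proof -
  have "\<forall>\<^sub>F t in at_right (0::real). norm (x + t *\<^sub>R w - p) \<le> r" if p: "p \<in> F" for p
  proof (cases "norm (x - p) = r")
    case False
    with assms(2) p have lt: "norm (x - p) < r" by (force simp: mem_ball_polytope)
    have "((\<lambda>t. norm (x + t *\<^sub>R w - p)) \<longlongrightarrow> norm (x + 0 *\<^sub>R w - p)) (at_right 0)"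
      by (intro tendsto_intros)
    then have "\<forall>\<^sub>F t in at_right (0::real). norm (x + t *\<^sub>R w - p) < r"
      using lt by (intro order_tendstoD(2)) auto
    then show ?thesis by (rule eventually_mono) simp
  next
    case True
    define g where "g = - (w \<bullet> (x - p))"
    have g: "g > 0" using w[OF p True] by (simp add: g_def)
    then have nw: "norm w > 0" by (auto simp: g_def)
    have "\<forall>\<^sub>F t in at_right (0::real). t \<in> {0<..<g / (norm w)\<^sup>2}"
      using g nw by (intro eventually_at_right_real) simp
    then show ?thesis
    proof eventually_elim
      case (elim t)
      then have "0 < t" "t * (norm w)\<^sup>2 < g" using nw by (simp_all add: pos_less_divide_eq)
      then have "t * (t * (norm w)\<^sup>2) \<le> t * (2 * g)" using g by (intro mult_left_mono) auto
      then have "(norm ((x - p) + t *\<^sub>R w))\<^sup>2 \<le> r\<^sup>2"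
        unfolding norm_plus_scaled_sq using True by (simp add: g_def power2_eq_square algebra_simps)
      then show ?case using \<open>r > 0\<close> power2_le_imp_le[of "norm ((x - p) + t *\<^sub>R w)" r]
        by (simp add: algebra_simps)
    qed
  qed
  then have "\<forall>\<^sub>F t in at_right (0::real). \<forall>p\<in>F. norm (x + t *\<^sub>R w - p) \<le> r"
    using \<open>finite F\<close> by (simp add: eventually_ball_finite_distrib)
  moreover have "\<forall>\<^sub>F t in at_right (0::real). t > 0" by (rule eventually_at_right_less)
  ultimately have "\<forall>\<^sub>F t in at_right (0::real). t > 0 \<and> x + t *\<^sub>R w \<in> ball_polytope F r"
    by eventually_elim (simp add: mem_ball_polytope)
  then show ?thesis
    using eventually_happens[of _ "at_right (0::real)"] by auto
qed

definition perp :: "real ^ 2 \<Rightarrow> real ^ 2" where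
  "perp d = vector [- d $ 2, d $ 1]"

lemma inner2: "x \<bullet> y = x $ 1 * y $ 1 + x $ 2 * y $ 2" for x y :: "real ^ 2"
  by (simp add: inner_vec_def sum_2)

lemma perp_simps [simp]: "perp d $ 1 = - d $ 2" "perp d $ 2 = d $ 1"
  by (simp_all add: perp_def)

lemma perp_inner [simp]: "perp d \<bullet> d = 0" "d \<bullet> perp d = 0"
  by (simp_all add: inner2)

lemma norm_perp [simp]: "norm (perp d) = norm d"
  by (simp add: norm_eq_sqrt_inner inner2 add.commute)

lemma perp_decomposition:
  "(norm d)\<^sup>2 *\<^sub>R v = (v \<bullet> d) *\<^sub>R d + (v \<bullet> perp d) *\<^sub>R perp d"
  by (simp add: vec_eq_iff forall_2 power2_norm_eq_inner inner2 algebra_simps)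

lemma norm_sq_perp:
  "(norm d)\<^sup>2 * (norm v)\<^sup>2 = (v \<bullet> d)\<^sup>2 + (v \<bullet> perp d)\<^sup>2"
  unfolding power2_norm_eq_inner by (simp add: inner2 power2_eq_square algebra_simps)

text \<open>Two circles with different centres meet only in points with a fixed component along the line of
centres and a component of fixed absolute value orthogonal to it.\<close>

lemma finite_circle_Int:
  fixes p q :: "real ^ 2"
  assumes "p \<noteq> q"
  shows "finite {x. norm (x - p) = r \<and> norm (x - q) = r}"
proof -
  define d where "d = q - p"
  have d: "norm d > 0" using assms by (simp add: d_def)
  define s where "s = sqrt ((norm d)\<^sup>2 * r\<^sup>2 - ((norm d)\<^sup>2 / 2)\<^sup>2)"
  define pt where "pt t = p + (1 / (norm d)\<^sup>2) *\<^sub>R (((norm d)\<^sup>2 / 2) *\<^sub>R d + t *\<^sub>R perp d)" for t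
  have "x \<in> {pt s, pt (- s)}" if x: "norm (x - p) = r" "norm (x - q) = r" for x
  proof -
    have "x - p - d = x - q" by (simp add: d_def)
    then have "(norm (x - p - d))\<^sup>2 = (norm (x - p))\<^sup>2" using x by (simp only:)
    moreover have "(norm (x - p - d))\<^sup>2 = (norm (x - p))\<^sup>2 - 2 * ((x - p) \<bullet> d) + (norm d)\<^sup>2"
      using norm_plus_scaled_sq[of "x - p" "-1" d] by (simp add: inner_commute)
    ultimately have xd: "(x - p) \<bullet> d = (norm d)\<^sup>2 / 2" by linarith
    define t where "t = (x - p) \<bullet> perp d"
    have "t\<^sup>2 = (norm d)\<^sup>2 * r\<^sup>2 - ((norm d)\<^sup>2 / 2)\<^sup>2"
      using norm_sq_perp[of d "x - p"] unfolding x(1) xd t_def[symmetric] by linarith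
    then have "\<bar>t\<bar> = s" unfolding s_def using real_sqrt_abs[of t] by simp
    then have "t = s \<or> t = - s" by linarith
    moreover have "x = pt t"
    proof -
      have "x - p = (1 / (norm d)\<^sup>2) *\<^sub>R ((norm d)\<^sup>2 *\<^sub>R (x - p))" using d by simp
      also have "\<dots> = (1 / (norm d)\<^sup>2) *\<^sub>R (((norm d)\<^sup>2 / 2) *\<^sub>R d + t *\<^sub>R perp d)"
        unfolding perp_decomposition[of d "x - p"] xd t_def ..
      finally show ?thesis unfolding pt_def by (metis add.commute diff_add_cancel)
    qed
    ultimately show ?thesis by blast
  qed
  then have "{x. norm (x - p) = r \<and> norm (x - q) = r} \<subseteq> {pt s, pt (- s)}" by blast
  then show ?thesis by (rule finite_subset) simp
qed

section \<open>Support points\<close>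

definition supports :: "(real ^ 2) set \<Rightarrow> real ^ 2 \<Rightarrow> real ^ 2 \<Rightarrow> bool" where
  "supports A y v \<longleftrightarrow> v \<in> A \<and> (\<forall>z\<in>A. y \<bullet> (z - v) \<le> 0)"

lemma supports_scale: "c > 0 \<Longrightarrow> supports A (c *\<^sub>R y) v \<longleftrightarrow> supports A y v"
  by (simp add: supports_def mult_le_0_iff)

lemma supports_smooth:
  fixes F :: "(real ^ 2) set"
  assumes "p \<in> F" "norm n = 1" "p + r *\<^sub>R n \<in> ball_polytope F r"
  shows "supports (ball_polytope F r) n (p + r *\<^sub>R n)"
  unfolding supports_def
proof (intro conjI ballI assms(3))
  fix z assume "z \<in> ball_polytope F r"
  then have "n \<bullet> (z - p) \<le> r"
    using assms(1,2) norm_cauchy_schwarz[of n "z - p"] by (fastforce simp: mem_ball_polytope)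
  moreover have "n \<bullet> (z - (p + r *\<^sub>R n)) = n \<bullet> (z - p) - r * (norm n)\<^sup>2"
    by (simp add: inner_diff_right inner_add_right power2_norm_eq_inner)
  ultimately show "n \<bullet> (z - (p + r *\<^sub>R n)) \<le> 0" using assms(2) by simp
qed

text \<open>The intersection of discs is strictly convex: the midpoint of two support points would lie in the
interior of every disc.\<close>

lemma supports_unique:
  fixes F :: "(real ^ 2) set"
  assumes "finite F" "r > 0" "supports (ball_polytope F r) n v"
    "supports (ball_polytope F r) n v'" "n \<noteq> 0"
  shows "v = v'"
proof (rule ccontr)
  assume ne: "v \<noteq> v'"
  let ?A = "ball_polytope F r" let ?m = "(1/2) *\<^sub>R (v + v')"
  have vA: "v \<in> ?A" "v' \<in> ?A" using assms by (auto simp: supports_def)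
  have lt: "norm (?m - p) < r" if "p \<in> F" for p
  proof -
    have "norm (v - p) \<le> r" "norm (v' - p) \<le> r" using vA that by (auto simp: mem_ball_polytope)
    then have sq: "(norm (v - p))\<^sup>2 \<le> r\<^sup>2" "(norm (v' - p))\<^sup>2 \<le> r\<^sup>2"
      by (auto intro!: power_mono)
    have "(norm (?m - p))\<^sup>2
        = ((norm (v - p))\<^sup>2 + (norm (v' - p))\<^sup>2) / 2 - (norm (v - v'))\<^sup>2 / 4"
      by (simp add: power2_norm_eq_inner inner_diff_left inner_diff_right inner_add_left
          inner_add_right inner_commute field_simps)
    also have "\<dots> < r\<^sup>2"
    proof -
      have "(norm (v - v'))\<^sup>2 > 0" using ne by simp
      with sq show ?thesis by argo
    qed
    finally show ?thesis using \<open>r > 0\<close> by (simp add: power_less_imp_less_base)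
  qed
  then have "?m \<in> ?A" by (force simp: mem_ball_polytope)
  then obtain t where t: "t > 0" "?m + t *\<^sub>R n \<in> ?A"
    using feasible_direction[OF assms(1) _ assms(2), of ?m n] lt by force
  have "n \<bullet> (?m + t *\<^sub>R n - v) \<le> 0" "n \<bullet> (?m + t *\<^sub>R n - v') \<le> 0"
    using assms t by (auto simp: supports_def)
  then have "t * (n \<bullet> n) \<le> 0"
    by (simp add: inner_diff_right inner_add_right inner_add_left field_simps)
  with t \<open>n \<noteq> 0\<close> show False by (metis inner_gt_zero_iff mult_pos_pos not_less)
qed

text \<open>At a point that lies on only one of the circles, the outer normal of this circle is the only direction
in which the point can be supporting; otherwise \<open>r n - (x - p)\<close> is a direction of ascent for \<open>n\<close>
that leads into the disc.\<close>

lemma supports_cases: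
  fixes F :: "(real ^ 2) set"
  assumes "finite F" "r > 0" "supports (ball_polytope F r) n x" "norm n = 1"
    and nov: "\<And>p q. p \<in> F \<Longrightarrow> q \<in> F \<Longrightarrow> norm (x - p) = r \<Longrightarrow> norm (x - q) = r \<Longrightarrow> p = q"
  shows "\<exists>p\<in>F. x = p + r *\<^sub>R n"
proof (rule ccontr)
  assume contra: "\<not> ?thesis"
  let ?A = "ball_polytope F r"
  have x: "x \<in> ?A" and sup: "\<And>z. z \<in> ?A \<Longrightarrow> n \<bullet> (z - x) \<le> 0"
    using assms by (auto simp: supports_def)
  have "\<exists>w. n \<bullet> w > 0 \<and> (\<forall>p\<in>F. norm (x - p) = r \<longrightarrow> w \<bullet> (x - p) < 0)"
  proof (cases "\<exists>p\<in>F. norm (x - p) = r")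
    case False
    then show ?thesis using assms(4) by (intro exI[of _ n]) (auto simp: norm_eq_1)
  next
    case True
    then obtain p where p: "p \<in> F" "norm (x - p) = r" by blast
    have "x - p \<noteq> r *\<^sub>R n" using contra p by (auto simp: algebra_simps)
    then have "(norm (x - p - r *\<^sub>R n))\<^sup>2 > 0" by simp
    moreover have "(norm (x - p - r *\<^sub>R n))\<^sup>2 = 2 * r * (r - n \<bullet> (x - p))"
      using norm_plus_scaled_sq[of "x - p" "-r" n] p assms(4)
      by (simp add: power2_eq_square algebra_simps)
    ultimately have lt: "n \<bullet> (x - p) < r" using assms(2) by (simp add: zero_less_mult_iff)
    have xx: "(x - p) \<bullet> (x - p) = r * r" using p by (simp add: dot_square_norm power2_eq_square)
    have nn: "n \<bullet> n = 1" using assms by (simp add: norm_eq_1)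
    let ?w = "r *\<^sub>R n - (x - p)"
    have "n \<bullet> ?w > 0" using lt nn unfolding inner_diff_right[of n "r *\<^sub>R n"] by simp
    moreover have "?w \<bullet> (x - p) < 0"
      using lt xx assms(2) unfolding inner_diff_left[of "r *\<^sub>R n"] by simp
    ultimately show ?thesis using nov p by metis
  qed
  then obtain w where w: "n \<bullet> w > 0" "\<And>p. p \<in> F \<Longrightarrow> norm (x - p) = r \<Longrightarrow> w \<bullet> (x - p) < 0"
    by blast
  obtain t where "t > 0" "x + t *\<^sub>R w \<in> ?A"
    using feasible_direction[OF assms(1) x assms(2) w(2)] by blast
  with sup[of "x + t *\<^sub>R w"] w(1) show False by (simp add: mult_le_0_iff)
qed

lemma supports_exists:
  fixes F :: "(real ^ 2) set"
  assumes "F \<noteq> {}" "ball_polytope F r \<noteq> {}"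
  shows "\<exists>v. supports (ball_polytope F r) n v"
proof -
  have "\<exists>v\<in>ball_polytope F r. \<forall>z\<in>ball_polytope F r. n \<bullet> z \<le> n \<bullet> v"
    using compact_ball_polytope[OF assms(1)] assms(2)
    by (intro continuous_attains_sup) (auto intro!: continuous_intros)
  then show ?thesis unfolding supports_def by (force simp: inner_diff_right)
qed

section \<open>Steiner's formula for intersections of congruent discs\<close>

text \<open>The part of the unit disc that is spanned by the smooth directions of \<open>p\<close>. Twice its area is the
angle of the boundary arc of the intersection that \<open>p\<close> contributes; area is used as the measure of
angle because it is what Steiner's formula asks for.\<close>
definition smooth_cone :: "(real ^ 2) set \<Rightarrow> real \<Rightarrow> real ^ 2 \<Rightarrow> (real ^ 2) set" where
  "smooth_cone F r p = {y. y \<noteq> 0 \<and> norm y \<le> 1 \<and> p + (r / norm y) *\<^sub>R y \<in> ball_polytope F r}"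

definition vertex_cone :: "(real ^ 2) set \<Rightarrow> real \<Rightarrow> real ^ 2 \<Rightarrow> (real ^ 2) set" where
  "vertex_cone F r v =
     {y. y \<noteq> 0 \<and> norm y \<le> 1 \<and> supports (ball_polytope F r) y v} - (\<Union>p\<in>F. smooth_cone F r p)"

text \<open>Points of pairwise intersection of the circles, whether or not they belong to the intersection of the
discs; for a point outside of it the vertex cone is empty.\<close>
definition vertices :: "(real ^ 2) set \<Rightarrow> real \<Rightarrow> (real ^ 2) set" where
  "vertices F r = {x. \<exists>p\<in>F. \<exists>q\<in>F. p \<noteq> q \<and> norm (x - p) = r \<and> norm (x - q) = r}"

lemma finite_vertices: "finite F \<Longrightarrow> finite (vertices F r)"
proof -
  assume "finite F"
  moreover have "vertices F r = (\<Union>p\<in>F. \<Union>q\<in>F - {p}. {x. norm (x - p) = r \<and> norm (x - q) = r})"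
    by (auto simp: vertices_def)
  ultimately show ?thesis by (auto intro!: finite_UN_I finite_circle_Int)
qed

text \<open>Multiplication with \<open>norm y\<close> turns the condition on the normalized vector into one that is visibly
closed in \<open>y\<close>.\<close>

lemma smooth_cone_ball_iff:
  assumes "y \<noteq> 0" "r > 0"
  shows "norm (p + (r / norm y) *\<^sub>R y - q) \<le> r \<longleftrightarrow> norm y * (norm (p - q))\<^sup>2 + 2 * r * (y \<bullet> (p - q)) \<le> 0"
proof -
  have "norm (p + (r / norm y) *\<^sub>R y - q) \<le> r \<longleftrightarrow> (norm ((p - q) + (r / norm y) *\<^sub>R y))\<^sup>2 \<le> r\<^sup>2"
    using \<open>r > 0\<close> by (simp add: algebra_simps abs_le_square_iff[symmetric])
  also have "\<dots> \<longleftrightarrow> (norm (p - q))\<^sup>2 + 2 * (r / norm y) * (y \<bullet> (p - q)) \<le> 0"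
    unfolding norm_plus_scaled_sq using assms by (simp add: power_divide)
  also have "\<dots> \<longleftrightarrow> norm y * ((norm (p - q))\<^sup>2 + 2 * (r / norm y) * (y \<bullet> (p - q))) \<le> norm y * 0"
    using assms by (subst mult_le_cancel_left_pos) auto
  also have "norm y * ((norm (p - q))\<^sup>2 + 2 * (r / norm y) * (y \<bullet> (p - q)))
      = norm y * (norm (p - q))\<^sup>2 + 2 * r * (y \<bullet> (p - q))"
    using assms by (simp add: field_simps)
  finally show ?thesis by simp
qed

lemma smooth_cone_eq:
  assumes "r > 0"
  shows "smooth_cone F r p = (cball 0 1 \<inter>
    (\<Inter>q\<in>F. {y. norm y * (norm (p - q))\<^sup>2 + 2 * r * (y \<bullet> (p - q)) \<le> 0})) - {0}"
  using smooth_cone_ball_iff[OF _ assms]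
  by (auto simp: smooth_cone_def mem_ball_polytope)

lemma lmeasurable_closed_Int_cball_minus:
  "closed S \<Longrightarrow> (cball 0 1 \<inter> S) - {0} \<in> lmeasurable" for S :: "(real ^ 2) set"
  by (intro fmeasurable.Diff lmeasurable_compact compact_Int_closed compact_cball) auto

lemma lmeasurable_smooth_cone: "r > 0 \<Longrightarrow> smooth_cone F r p \<in> lmeasurable"
  unfolding smooth_cone_eq
  by (intro lmeasurable_closed_Int_cball_minus closed_INT ballI closed_Collect_le continuous_intros)

lemma lmeasurable_vertex_cone:
  assumes "finite F" "r > 0"
  shows "vertex_cone F r v \<in> lmeasurable"
proof -
  let ?A = "ball_polytope F r"
  have "{y. y \<noteq> 0 \<and> norm y \<le> 1 \<and> supports ?A y v} \<in> lmeasurable"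
  proof (cases "v \<in> ?A")
    case True
    then have "{y. y \<noteq> 0 \<and> norm y \<le> 1 \<and> supports ?A y v}
        = (cball 0 1 \<inter> (\<Inter>z\<in>?A. {y. y \<bullet> (z - v) \<le> 0})) - {0}"
      by (auto simp: supports_def)
    then show ?thesis
      by (simp only:) (intro lmeasurable_closed_Int_cball_minus closed_INT ballI closed_Collect_le continuous_intros)
  qed (simp add: supports_def)
  then show ?thesis unfolding vertex_cone_def
    by (intro fmeasurable.Diff fmeasurable.finite_UN lmeasurable_smooth_cone assms)
qed

lemma supports_smooth_cone:
  fixes F :: "(real ^ 2) set"
  assumes "y \<in> smooth_cone F r p" "p \<in> F"
  shows "supports (ball_polytope F r) y (p + (r / norm y) *\<^sub>R y)"
proof -
  have "supports (ball_polytope F r) (inverse (norm y) *\<^sub>R y) (p + r *\<^sub>R (inverse (norm y) *\<^sub>R y))"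
    using assms by (intro supports_smooth) (auto simp: smooth_cone_def divide_inverse)
  then show ?thesis using assms(1) by (simp add: supports_scale smooth_cone_def divide_inverse)
qed

lemma smooth_cone_disjoint:
  fixes F :: "(real ^ 2) set"
  assumes "finite F" "r > 0" "p \<in> F" "q \<in> F" "p \<noteq> q"
  shows "smooth_cone F r p \<inter> smooth_cone F r q = {}"
proof (rule ccontr)
  assume "\<not> ?thesis"
  then obtain y where y: "y \<in> smooth_cone F r p" "y \<in> smooth_cone F r q" by blast
  then have "p + (r / norm y) *\<^sub>R y = q + (r / norm y) *\<^sub>R y"
    using assms by (intro supports_unique[OF assms(1,2), of y] supports_smooth_cone) (auto simp: smooth_cone_def)
  with assms show False by simp
qed

lemma vertex_cone_disjoint:
  fixes F :: "(real ^ 2) set"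
  assumes "finite F" "r > 0" "v \<noteq> v'"
  shows "vertex_cone F r v \<inter> vertex_cone F r v' = {}"
  using supports_unique[OF assms(1,2)] assms(3) by (auto simp: vertex_cone_def)

text \<open>Each direction has a support point, which is a vertex or lies on a single circle; in the second case
the direction is smooth.\<close>

lemma cones_cover:
  fixes F :: "(real ^ 2) set"
  assumes "finite F" "F \<noteq> {}" "r > 0" "ball_polytope F r \<noteq> {}"
  shows "(\<Union>p\<in>F. smooth_cone F r p) \<union> (\<Union>v\<in>vertices F r. vertex_cone F r v) = cball 0 1 - {0}"
proof
  show "(\<Union>p\<in>F. smooth_cone F r p) \<union> (\<Union>v\<in>vertices F r. vertex_cone F r v) \<subseteq> cball 0 1 - {0}"
    by (auto simp: smooth_cone_def vertex_cone_def)
  show "cball 0 1 - {0} \<subseteq> (\<Union>p\<in>F. smooth_cone F r p) \<union> (\<Union>v\<in>vertices F r. vertex_cone F r v)"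
  proof
    fix y :: "real ^ 2" assume y: "y \<in> cball 0 1 - {0}"
    obtain v where v: "supports (ball_polytope F r) y v"
      using supports_exists[OF assms(2,4)] by blast
    let ?n = "inverse (norm y) *\<^sub>R y"
    have vn: "supports (ball_polytope F r) ?n v" using v y by (simp add: supports_scale)
    show "y \<in> (\<Union>p\<in>F. smooth_cone F r p) \<union> (\<Union>v\<in>vertices F r. vertex_cone F r v)"
    proof (cases "v \<in> vertices F r")
      case True
      then show ?thesis using v y by (auto simp: vertex_cone_def)
    next
      case False
      have "\<exists>p\<in>F. v = p + r *\<^sub>R ?n"
      proof (rule supports_cases[OF assms(1,3) vn])
        show "norm ?n = 1" using y by simp
      qed (use False in \<open>auto simp: vertices_def\<close>)
      then obtain p where "p \<in> F" "v = p + r *\<^sub>R ?n" by blast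
      then show ?thesis using v y
        by (auto simp: smooth_cone_def supports_def divide_inverse)
    qed
  qed
qed

lemma measure_unit_disc: "measure lebesgue (cball (0::real ^ 2) 1) = pi"
  by (simp add: measure_completion content_cball unit_ball_vol_2)

lemma measure_cones:
  fixes F :: "(real ^ 2) set"
  assumes "finite F" "F \<noteq> {}" "r > 0" "ball_polytope F r \<noteq> {}"
  shows "(\<Sum>p\<in>F. measure lebesgue (smooth_cone F r p))
      + (\<Sum>v\<in>vertices F r. measure lebesgue (vertex_cone F r v)) = pi"
proof -
  let ?S = "\<Union>p\<in>F. smooth_cone F r p" and ?T = "\<Union>v\<in>vertices F r. vertex_cone F r v"
  have "measure lebesgue ?S = (\<Sum>p\<in>F. measure lebesgue (smooth_cone F r p))"
    using assms smooth_cone_disjoint[OF assms(1,3)]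
    by (intro measure_UNION') (auto simp: lmeasurable_smooth_cone pairwise_def disjnt_def)
  moreover have "measure lebesgue ?T = (\<Sum>v\<in>vertices F r. measure lebesgue (vertex_cone F r v))"
    using assms vertex_cone_disjoint[OF assms(1,3)]
    by (intro measure_UNION') (auto simp: lmeasurable_vertex_cone finite_vertices pairwise_def disjnt_def)
  moreover have "measure lebesgue (?S \<union> ?T) = measure lebesgue ?S + measure lebesgue ?T"
  proof (rule measure_Un_AE)
    have "?S \<inter> ?T = {}" by (auto simp: vertex_cone_def)
    then show "AE x in lebesgue. x \<notin> ?S \<or> x \<notin> ?T" by (intro always_eventually) blast
    show "?S \<in> lmeasurable" using assms by (intro fmeasurable.finite_UN lmeasurable_smooth_cone)
    show "?T \<in> lmeasurable"
      using assms by (intro fmeasurable.finite_UN lmeasurable_vertex_cone finite_vertices)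
  qed
  moreover have "measure lebesgue (?S \<union> ?T) = pi"
    unfolding cones_cover[OF assms]
    by (subst measure_Diff) (auto simp: measure_unit_disc emeasure_cball)
  ultimately show ?thesis by simp
qed

lemma mem_parallel_set:
  fixes A :: "(real ^ 2) set"
  assumes "closed A" "A \<noteq> {}" "\<epsilon> \<ge> 0"
  shows "x \<in> A + (*\<^sub>R) \<epsilon> ` cball 0 1 \<longleftrightarrow> norm (x - closest_point A x) \<le> \<epsilon>"
proof
  assume "x \<in> A + (*\<^sub>R) \<epsilon> ` cball 0 1"
  then obtain a b where ab: "a \<in> A" "norm b \<le> 1" "x = a + \<epsilon> *\<^sub>R b" by (auto simp: set_plus_def)
  have "dist x (closest_point A x) \<le> dist x a" using assms ab by (intro closest_point_le)
  also have "\<dots> \<le> \<epsilon>" using ab assms(3) by (simp add: dist_norm mult_left_le)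
  finally show "norm (x - closest_point A x) \<le> \<epsilon>" by (simp add: dist_norm)
next
  assume le: "norm (x - closest_point A x) \<le> \<epsilon>"
  define b where "b = inverse \<epsilon> *\<^sub>R (x - closest_point A x)"
  have "x = closest_point A x + \<epsilon> *\<^sub>R b"
    using le by (cases "\<epsilon> = 0") (simp_all add: b_def)
  moreover have "norm b \<le> 1"
  proof (cases "\<epsilon> = 0")
    case False
    then show ?thesis using le assms(3) by (simp add: b_def pos_divide_le_eq flip: divide_inverse_commute)
  qed (simp add: b_def)
  moreover have "closest_point A x + \<epsilon> *\<^sub>R b \<in> A + (*\<^sub>R) \<epsilon> ` cball 0 1" if "norm b \<le> 1"
    using that closest_point_in_set[OF assms(1,2)] by (intro set_plus_intro) auto
  ultimately show "x \<in> A + (*\<^sub>R) \<epsilon> ` cball 0 1" by metis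
qed

lemma closest_point_supports:
  fixes A :: "(real ^ 2) set"
  assumes "closed A" "convex A" "A \<noteq> {}"
  shows "closest_point A x = v \<longleftrightarrow> supports A (x - v) v"
proof
  assume "closest_point A x = v"
  then show "supports A (x - v) v"
    using closest_point_in_set[OF assms(1,3)] closest_point_dot[OF assms(2,1)]
    by (auto simp: supports_def)
next
  assume v: "supports A (x - v) v"
  have "dist x v \<le> dist x z" if "z \<in> A" for z
  proof -
    have "(x - v) \<bullet> (z - v) \<le> 0" using v that by (auto simp: supports_def)
    moreover have "(norm (x - z))\<^sup>2 = (norm (x - v))\<^sup>2 - 2 * ((x - v) \<bullet> (z - v)) + (norm (z - v))\<^sup>2"
      using norm_plus_scaled_sq[of "x - v" "-1" "z - v"] by (simp add: inner_commute)
    ultimately have "(norm (x - v))\<^sup>2 \<le> (norm (x - z))\<^sup>2" using zero_le_power2[of "norm (z - v)"] by linarith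
    then show ?thesis by (simp add: dist_norm)
  qed
  then show "closest_point A x = v"
    using closest_point_unique[OF assms(2,1), of v x] v by (auto simp: supports_def)
qed

lemma mem_affine_image_iff:
  fixes x :: "'a::real_vector"
  assumes "c \<noteq> 0"
  shows "x \<in> (\<lambda>y. c *\<^sub>R y + a) ` S \<longleftrightarrow> inverse c *\<^sub>R (x - a) \<in> S"
proof
  assume "inverse c *\<^sub>R (x - a) \<in> S"
  moreover have "x = c *\<^sub>R (inverse c *\<^sub>R (x - a)) + a" using assms by simp
  ultimately show "x \<in> (\<lambda>y. c *\<^sub>R y + a) ` S" by blast
qed (use assms in auto)

lemma lmeasurable_affine_image:
  fixes S :: "(real ^ 2) set"
  assumes "S \<in> lmeasurable"
  shows "(\<lambda>y. c *\<^sub>R y + a) ` S \<in> lmeasurable"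
proof -
  have "(+) a ` ((*\<^sub>R) c ` S) \<in> lmeasurable"
    using assms by (intro measurable_translation measurable_linear_image) auto
  then show ?thesis by (simp add: image_image add.commute)
qed

lemma scaled_smooth_cone_iff:
  assumes "s > 0"
  shows "inverse s *\<^sub>R z \<in> smooth_cone F r p \<longleftrightarrow>
    z \<noteq> 0 \<and> norm z \<le> s \<and> p + (r / norm z) *\<^sub>R z \<in> ball_polytope F r"
proof -
  have "(r / norm (inverse s *\<^sub>R z)) *\<^sub>R (inverse s *\<^sub>R z) = (r / norm z) *\<^sub>R z"
    using assms by simp
  moreover have "norm (inverse s *\<^sub>R z) \<le> 1 \<longleftrightarrow> norm z \<le> s"
    using assms by (simp add: pos_divide_le_eq flip: divide_inverse_commute)
  ultimately show ?thesis using assms unfolding smooth_cone_def by simp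
qed

lemma mem_affine_smooth_cone:
  assumes "s > 0"
  shows "x \<in> (\<lambda>y. s *\<^sub>R y + p) ` smooth_cone F r p \<longleftrightarrow>
    x \<noteq> p \<and> norm (x - p) \<le> s \<and> p + (r / norm (x - p)) *\<^sub>R (x - p) \<in> ball_polytope F r"
  using assms scaled_smooth_cone_iff[OF assms, of "x - p"] by (simp add: mem_affine_image_iff)

text \<open>Each point \<open>x\<close> of the outer parallel set is sorted by its nearest point \<open>cl x\<close> and by the point
\<open>foot x\<close> at distance \<open>r\<close> behind it on the normal line. If \<open>foot x\<close> is a centre \<open>p\<close>, then \<open>x\<close> is in
the annular sector that arises from scaling the smooth cone of \<open>p\<close> by \<open>r + \<epsilon>\<close> and by \<open>r\<close>; otherwise
\<open>cl x\<close> is a vertex and \<open>x\<close> is in a translate of its vertex cone scaled by \<open>\<epsilon>\<close>. The areas are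
quadratic in \<open>\<epsilon>\<close>, and all cones together fill the unit disc.\<close>

theorem steiner_ball_polytope:
  fixes F :: "(real ^ 2) set"
  assumes F: "finite F" "F \<noteq> {}" and r: "r > 0" and ne: "ball_polytope F r \<noteq> {}" and "\<epsilon> \<ge> 0"
  shows "V2 (ball_polytope F r + (*\<^sub>R) \<epsilon> ` cball 0 1) = V2 (ball_polytope F r)
    + 2 * (r * (\<Sum>p\<in>F. measure lebesgue (smooth_cone F r p))) * \<epsilon> + pi * \<epsilon>\<^sup>2"
proof -
  define A where "A = ball_polytope F r"
  define cl where "cl = closest_point A"
  define foot where "foot x = cl x - (r / norm (x - cl x)) *\<^sub>R (x - cl x)" for x
  have clA: "closed A" "convex A" "A \<noteq> {}"
    using ne by (auto simp: A_def closed_ball_polytope convex_ball_polytope)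
  note cl_iff = closest_point_supports[OF clA, folded cl_def]
  have cl_in: "cl x \<in> A" for x using closest_point_in_set[OF clA(1,3)] by (simp add: cl_def)
  have cl_self: "x \<in> A \<Longrightarrow> cl x = x" for x by (simp add: cl_def closest_point_self)
  have sup: "supports A (x - cl x) (cl x)" for x using cl_iff by blast
  have mem: "x \<in> A + (*\<^sub>R) \<epsilon> ` cball 0 1 \<longleftrightarrow> norm (x - cl x) \<le> \<epsilon>" for x
    using mem_parallel_set[OF clA(1,3) \<open>\<epsilon> \<ge> 0\<close>] by (simp add: cl_def)
  show ?thesis
  proof (cases "\<epsilon> = 0")
    case True
    then have "A + (*\<^sub>R) \<epsilon> ` cball 0 1 = A" using mem cl_in cl_self by (auto simp: set_eq_iff) metis
    then show ?thesis using True by (simp add: A_def)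
  next
    case False
    with \<open>\<epsilon> \<ge> 0\<close> have \<epsilon>: "\<epsilon> > 0" by simp
    define Ann where "Ann p = (\<lambda>y. (r + \<epsilon>) *\<^sub>R y + p) ` smooth_cone F r p
        - (\<lambda>y. r *\<^sub>R y + p) ` smooth_cone F r p" for p
    define Ver where "Ver v = (\<lambda>y. \<epsilon> *\<^sub>R y + v) ` vertex_cone F r v" for v
    have Ann_mem: "x \<in> Ann p \<longleftrightarrow>
        r < norm (x - p) \<and> norm (x - p) \<le> r + \<epsilon> \<and> p + (r / norm (x - p)) *\<^sub>R (x - p) \<in> A" for x p
      using r \<epsilon> unfolding Ann_def A_def by (auto simp: mem_affine_smooth_cone)
    have Ann: "x \<in> Ann p \<longleftrightarrow> x \<notin> A \<and> norm (x - cl x) \<le> \<epsilon> \<and> foot x = p" if p: "p \<in> F" for x p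
    proof
      assume x: "x \<in> Ann p"
      define s a where "s = norm (x - p)" and "a = p + (r / s) *\<^sub>R (x - p)"
      have s: "r < s" "s \<le> r + \<epsilon>" "a \<in> A" using x by (auto simp: Ann_mem s_def a_def)
      have xa: "x - a = (1 - r / s) *\<^sub>R (x - p)" by (simp add: a_def algebra_simps)
      have pos: "1 - r / s > 0" "s > 0" using s r by auto
      have "supports A (inverse s *\<^sub>R (x - p)) (p + r *\<^sub>R (inverse s *\<^sub>R (x - p)))"
        unfolding A_def using s pos p
        by (intro supports_smooth) (auto simp: s_def[symmetric] a_def A_def divide_inverse)
      then have "supports A (x - a) a"
        unfolding xa using pos by (simp add: supports_scale a_def divide_inverse)
      then have cl: "cl x = a" using cl_iff by blast
      have nxa: "norm (x - a) = s - r" 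
        using pos s(1) unfolding xa norm_scaleR s_def[symmetric] by (simp add: field_simps)
      have "x \<notin> A" using s(1) p by (auto simp: A_def mem_ball_polytope s_def not_le)
      moreover have "foot x = p"
      proof -
        have "(r / (s - r)) * (1 - r / s) = r / s" using s(1) pos by (simp add: field_simps)
        then show ?thesis unfolding foot_def cl nxa unfolding xa by (simp add: a_def)
      qed
      ultimately show "x \<notin> A \<and> norm (x - cl x) \<le> \<epsilon> \<and> foot x = p" using cl nxa s by simp
    next
      assume x: "x \<notin> A \<and> norm (x - cl x) \<le> \<epsilon> \<and> foot x = p"
      define y where "y = x - cl x"
      have y: "norm y > 0" using x cl_in[of x] by (auto simp: y_def)
      have cl: "cl x = p + (r / norm y) *\<^sub>R y" using x by (auto simp: foot_def y_def)
      have xp: "x - p = ((r + norm y) / norm y) *\<^sub>R y"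
      proof -
        have "x - p = (r / norm y) *\<^sub>R y + y" using cl by (simp add: y_def algebra_simps)
        then show ?thesis using y by (simp add: add_divide_distrib scaleR_add_left)
      qed
      then have n: "norm (x - p) = r + norm y" using y r by simp
      have "r + norm y \<noteq> 0" using y r by linarith
      then have "(r / (r + norm y)) * ((r + norm y) / norm y) = r / norm y" by simp
      then have "p + (r / norm (x - p)) *\<^sub>R (x - p) = cl x" unfolding n unfolding xp cl by simp
      then show "x \<in> Ann p" unfolding Ann_mem using cl_in[of x] n y x by (simp add: y_def)
    qed
    have Ver: "x \<in> Ver v \<longleftrightarrow> x \<notin> A \<and> norm (x - cl x) \<le> \<epsilon> \<and> cl x = v \<and> foot x \<notin> F" for x v
    proof -
      have "x \<in> Ver v \<longleftrightarrow> x \<noteq> v \<and> norm (x - v) \<le> \<epsilon> \<and> supports A (x - v) v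
          \<and> (\<forall>p\<in>F. inverse \<epsilon> *\<^sub>R (x - v) \<notin> smooth_cone F r p)"
        using \<epsilon> unfolding Ver_def
        by (auto simp: mem_affine_image_iff vertex_cone_def A_def supports_scale pos_divide_le_eq
            simp flip: divide_inverse_commute)
      also have "\<dots> \<longleftrightarrow> x \<notin> A \<and> norm (x - cl x) \<le> \<epsilon> \<and> cl x = v
          \<and> (\<forall>p\<in>F. inverse \<epsilon> *\<^sub>R (x - cl x) \<notin> smooth_cone F r p)"
        using cl_iff[of x v] cl_self[of x] cl_in[of x] by auto
      also have "\<dots> \<longleftrightarrow> x \<notin> A \<and> norm (x - cl x) \<le> \<epsilon> \<and> cl x = v \<and> foot x \<notin> F"
      proof -
        have "inverse \<epsilon> *\<^sub>R (x - cl x) \<in> smooth_cone F r p \<longleftrightarrow> foot x = p"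
          if x: "x \<notin> A" "norm (x - cl x) \<le> \<epsilon>" and p: "p \<in> F" for p
        proof -
          define y where "y = x - cl x"
          have y: "y \<noteq> 0" using x cl_in[of x] by (auto simp: y_def)
          have "inverse \<epsilon> *\<^sub>R y \<in> smooth_cone F r p \<longleftrightarrow> p + (r / norm y) *\<^sub>R y \<in> A"
            using \<epsilon> x y by (simp add: scaled_smooth_cone_iff A_def y_def)
          also have "\<dots> \<longleftrightarrow> p + (r / norm y) *\<^sub>R y = cl x"
          proof
            assume a: "p + (r / norm y) *\<^sub>R y \<in> A"
            have "supports A (inverse (norm y) *\<^sub>R y) (p + r *\<^sub>R (inverse (norm y) *\<^sub>R y))"
              unfolding A_def using a y p by (intro supports_smooth) (auto simp: A_def divide_inverse)
            then have "supports A y (p + (r / norm y) *\<^sub>R y)"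
              using y by (simp add: supports_scale divide_inverse)
            then show "p + (r / norm y) *\<^sub>R y = cl x"
              using supports_unique[OF F(1) r, folded A_def] sup[of x] y by (auto simp: y_def)
          qed (use cl_in in metis)
          also have "\<dots> \<longleftrightarrow> foot x = p"
            unfolding foot_def y_def by (metis add_diff_cancel diff_add_cancel)
          finally show ?thesis by (simp add: y_def)
        qed
        then show ?thesis by auto
      qed
      finally show ?thesis .
    qed
    have vert: "cl x \<in> vertices F r" if x: "x \<notin> A" "foot x \<notin> F" for x
    proof (rule ccontr)
      assume nv: "cl x \<notin> vertices F r"
      define y where "y = x - cl x"
      have y: "y \<noteq> 0" using x cl_in[of x] by (auto simp: y_def)
      have "supports A (inverse (norm y) *\<^sub>R y) (cl x)"
        using sup[of x] y by (simp add: supports_scale y_def)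
      then have "\<exists>p\<in>F. cl x = p + r *\<^sub>R (inverse (norm y) *\<^sub>R y)"
        unfolding A_def
      proof (rule supports_cases[OF F(1) r])
        show "norm (inverse (norm y) *\<^sub>R y) = 1" using y by simp
      qed (use nv in \<open>auto simp: vertices_def\<close>)
      then show False using x(2) by (auto simp: foot_def y_def[symmetric] divide_inverse)
    qed
    let ?U = "(\<Union>p\<in>F. Ann p)" and ?W = "(\<Union>v\<in>vertices F r. Ver v)"
    have AnnL: "Ann p \<in> lmeasurable" for p
      unfolding Ann_def
      by (intro fmeasurable.Diff lmeasurable_affine_image lmeasurable_smooth_cone r)
    have VerL: "Ver v \<in> lmeasurable" for v
      unfolding Ver_def by (intro lmeasurable_affine_image lmeasurable_vertex_cone F r)
    have AL: "A \<in> lmeasurable" unfolding A_def by (intro lmeasurable_compact compact_ball_polytope F)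
    have UL: "?U \<in> lmeasurable" "?W \<in> lmeasurable"
      using AnnL VerL F finite_vertices by (auto intro!: fmeasurable.finite_UN)
    have "A + (*\<^sub>R) \<epsilon> ` cball 0 1 = A \<union> (?U \<union> ?W)"
    proof (rule set_eqI)
      fix x
      show "x \<in> A + (*\<^sub>R) \<epsilon> ` cball 0 1 \<longleftrightarrow> x \<in> A \<union> (?U \<union> ?W)"
      proof (cases "x \<in> A")
        case True
        then show ?thesis using mem[of x] cl_self[of x] \<epsilon> by simp
      next
        case False
        then show ?thesis using mem[of x] Ann[of _ x] Ver[of x] vert[of x] by auto
      qed
    qed
    moreover have "measure lebesgue (A \<union> (?U \<union> ?W)) = measure lebesgue A + measure lebesgue (?U \<union> ?W)"
      using UL AL Ann Ver
      by (intro measure_Un_AE always_eventually fmeasurable.Un) auto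
    moreover have "measure lebesgue (?U \<union> ?W) = measure lebesgue ?U + measure lebesgue ?W"
      using UL Ann Ver by (intro measure_Un_AE always_eventually) auto
    moreover have "measure lebesgue ?U = (\<Sum>p\<in>F. ((r + \<epsilon>)\<^sup>2 - r\<^sup>2) * measure lebesgue (smooth_cone F r p))"
    proof -
      have "measure lebesgue ?U = (\<Sum>p\<in>F. measure lebesgue (Ann p))"
        using AnnL F(1) Ann by (intro measure_UNION') (auto simp: pairwise_def disjnt_def)
      also have "\<dots> = (\<Sum>p\<in>F. ((r + \<epsilon>)\<^sup>2 - r\<^sup>2) * measure lebesgue (smooth_cone F r p))"
      proof (intro sum.cong refl)
        fix p assume "p \<in> F"
        have "measure lebesgue (Ann p) = measure lebesgue ((\<lambda>y. (r + \<epsilon>) *\<^sub>R y + p) ` smooth_cone F r p)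
            - measure lebesgue ((\<lambda>y. r *\<^sub>R y + p) ` smooth_cone F r p)"
          unfolding Ann_def
        proof (rule measurable_measure_Diff)
          show "(\<lambda>y. (r + \<epsilon>) *\<^sub>R y + p) ` smooth_cone F r p \<in> lmeasurable"
            by (intro lmeasurable_affine_image lmeasurable_smooth_cone r)
          show "(\<lambda>y. r *\<^sub>R y + p) ` smooth_cone F r p \<in> sets lebesgue"
            by (intro fmeasurableD lmeasurable_affine_image lmeasurable_smooth_cone r)
          show "(\<lambda>y. r *\<^sub>R y + p) ` smooth_cone F r p \<subseteq> (\<lambda>y. (r + \<epsilon>) *\<^sub>R y + p) ` smooth_cone F r p"
          proof
            fix x assume "x \<in> (\<lambda>y. r *\<^sub>R y + p) ` smooth_cone F r p"
            then show "x \<in> (\<lambda>y. (r + \<epsilon>) *\<^sub>R y + p) ` smooth_cone F r p"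
              using r \<epsilon> mem_affine_smooth_cone[OF r, of x p F r]
                mem_affine_smooth_cone[of "r + \<epsilon>" x p F r] by linarith
          qed
        qed
        also have "\<dots> = ((r + \<epsilon>)\<^sup>2 - r\<^sup>2) * measure lebesgue (smooth_cone F r p)"
          unfolding measure_lebesgue_affine using r \<epsilon> by (simp add: left_diff_distrib)
        finally show "measure lebesgue (Ann p) = \<dots>" .
      qed
      finally show ?thesis .
    qed
    moreover have "measure lebesgue ?W = (\<Sum>v\<in>vertices F r. \<epsilon>\<^sup>2 * measure lebesgue (vertex_cone F r v))"
    proof -
      have "measure lebesgue ?W = (\<Sum>v\<in>vertices F r. measure lebesgue (Ver v))"
        using VerL finite_vertices[OF F(1)] Ver
        by (intro measure_UNION') (auto simp: pairwise_def disjnt_def)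
      then show ?thesis by (simp add: Ver_def measure_lebesgue_affine)
    qed
    moreover have "(\<Sum>v\<in>vertices F r. measure lebesgue (vertex_cone F r v))
        = pi - (\<Sum>p\<in>F. measure lebesgue (smooth_cone F r p))"
      using measure_cones[OF F r ne] by linarith
    ultimately show ?thesis
      unfolding sum_distrib_left[symmetric] A_def by (simp add: power2_eq_square algebra_simps)
  qed
qed

corollary V1_ball_polytope:
  fixes F :: "(real ^ 2) set"
  assumes "finite F" "F \<noteq> {}" "r > 0" "ball_polytope F r \<noteq> {}"
  shows "V1 (ball_polytope F r) = r * (\<Sum>p\<in>F. measure lebesgue (smooth_cone F r p))"
  using steiner_ball_polytope[OF assms] assms(4) by (intro V1_eqI) auto

section \<open>Monotonicity of the first intrinsic volume\<close>

lemma compact_parallel_set: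
  fixes A :: "(real ^ 2) set"
  assumes "compact A"
  shows "compact (A + (*\<^sub>R) \<epsilon> ` cball 0 1)"
proof -
  have eq: "A + (*\<^sub>R) \<epsilon> ` cball 0 1 = {x + y |x y. x \<in> A \<and> y \<in> (*\<^sub>R) \<epsilon> ` cball 0 1}"
    by (auto simp: set_plus_def)
  show ?thesis unfolding eq by (rule compact_sums[OF assms compact_scaling[OF compact_cball]])
qed

text \<open>The Steiner polynomial of the larger set at \<open>\<epsilon>\<close> dominates that of the smaller set at \<open>\<delta> + \<epsilon>\<close>.
The quadratic terms in \<open>\<epsilon>\<close> cancel, and the comparison of the linear ones for \<open>\<epsilon> \<rightarrow> \<infinity>\<close> is
the claim. Monotonicity in the set and in the radius are special cases.\<close>

lemma V1_parallel_mono: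
  fixes F G :: "(real ^ 2) set"
  assumes F: "finite F" "F \<noteq> {}" "r > 0" "ball_polytope F r \<noteq> {}"
    and G: "finite G" "G \<noteq> {}" "s > 0" and "\<delta> \<ge> 0"
    and sub: "\<And>a. a \<in> ball_polytope F r \<Longrightarrow> cball a \<delta> \<subseteq> ball_polytope G s"
  shows "V1 (ball_polytope F r) + pi * \<delta> \<le> V1 (ball_polytope G s)"
proof -
  define A A' where "A = ball_polytope F r" and "A' = ball_polytope G s"
  obtain a where "a \<in> A" using F(4) by (auto simp: A_def)
  then have ne: "ball_polytope G s \<noteq> {}" using sub[of a] \<open>\<delta> \<ge> 0\<close> by (auto simp: A_def)
  have st: "V2 (A + (*\<^sub>R) \<epsilon> ` cball 0 1) = V2 A + 2 * V1 A * \<epsilon> + pi * \<epsilon>\<^sup>2" if "\<epsilon> \<ge> 0" for \<epsilon>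
    using steiner_ball_polytope[OF F that] V1_ball_polytope[OF F] by (simp add: A_def)
  have st': "V2 (A' + (*\<^sub>R) \<epsilon> ` cball 0 1) = V2 A' + 2 * V1 A' * \<epsilon> + pi * \<epsilon>\<^sup>2" if "\<epsilon> \<ge> 0" for \<epsilon>
    using steiner_ball_polytope[OF G ne that] V1_ball_polytope[OF G ne] by (simp add: A'_def)
  have cA: "compact A" "compact A'" using F G by (auto simp: A_def A'_def compact_ball_polytope)
  have le: "V2 (A + (*\<^sub>R) (\<delta> + \<epsilon>) ` cball 0 1) \<le> V2 (A' + (*\<^sub>R) \<epsilon> ` cball 0 1)" if \<epsilon>: "\<epsilon> \<ge> 0" for \<epsilon>
  proof (rule measure_mono_fmeasurable)
    show "A + (*\<^sub>R) (\<delta> + \<epsilon>) ` cball 0 1 \<subseteq> A' + (*\<^sub>R) \<epsilon> ` cball 0 1"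
    proof
      fix x assume "x \<in> A + (*\<^sub>R) (\<delta> + \<epsilon>) ` cball 0 1"
      then obtain a b where ab: "a \<in> A" "norm b \<le> 1" "x = a + (\<delta> + \<epsilon>) *\<^sub>R b" by (auto simp: set_plus_def)
      have "a + \<delta> *\<^sub>R b \<in> A'"
        using sub[of a] ab \<open>\<delta> \<ge> 0\<close> by (auto simp: A_def A'_def dist_norm mult_left_le intro!: subsetD[OF sub])
      moreover have "x = (a + \<delta> *\<^sub>R b) + \<epsilon> *\<^sub>R b" using ab by (simp add: scaleR_add_left)
      ultimately show "x \<in> A' + (*\<^sub>R) \<epsilon> ` cball 0 1" using ab(2) by (auto intro!: set_plus_intro)
    qed
  qed (auto intro!: fmeasurableD lmeasurable_compact compact_parallel_set cA)
  have lin: "2 * (V1 A + pi * \<delta> - V1 A') * \<epsilon> \<le> V2 A' - V2 A - 2 * V1 A * \<delta> - pi * \<delta>\<^sup>2" if "\<epsilon> \<ge> 0" for \<epsilon>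
    using le[OF that] st[of "\<delta> + \<epsilon>"] st'[OF that] that \<open>\<delta> \<ge> 0\<close>
    by (simp add: power2_eq_square algebra_simps)
  have "V1 A + pi * \<delta> - V1 A' \<le> 0"
  proof (rule ccontr)
    assume neg: "\<not> ?thesis"
    define c K where "c = 2 * (V1 A + pi * \<delta> - V1 A')" and "K = V2 A' - V2 A - 2 * V1 A * \<delta> - pi * \<delta>\<^sup>2"
    have "c > 0" using neg by (simp add: c_def)
    then have "c * ((\<bar>K\<bar> + 1) / c) \<le> K" using lin[of "(\<bar>K\<bar> + 1) / c"] by (simp add: c_def K_def)
    then show False using \<open>c > 0\<close> by simp
  qed
  then show ?thesis by (simp add: A_def A'_def)
qed

lemma V1_ball_polytope_antimono:
  fixes F G :: "(real ^ 2) set"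
  assumes "finite G" "F \<subseteq> G" "F \<noteq> {}" "r > 0" "ball_polytope G r \<noteq> {}"
  shows "V1 (ball_polytope G r) \<le> V1 (ball_polytope F r)"
  using V1_parallel_mono[of G r F r 0] assms ball_polytope_antimono[OF assms(2)] finite_subset
  by fastforce

lemma V1_ball_polytope_radius:
  fixes F :: "(real ^ 2) set"
  assumes "finite F" "F \<noteq> {}" "r > 0" "ball_polytope F r \<noteq> {}" "r \<le> R"
  shows "V1 (ball_polytope F r) + pi * (R - r) \<le> V1 (ball_polytope F R)"
proof (rule V1_parallel_mono)
  fix a assume a: "a \<in> ball_polytope F r"
  show "cball a (R - r) \<subseteq> ball_polytope F R"
  proof
    fix x assume x: "x \<in> cball a (R - r)"
    show "x \<in> ball_polytope F R" unfolding mem_ball_polytope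
    proof
      fix p assume "p \<in> F"
      then have "norm (a - p) \<le> r" using a by (simp add: mem_ball_polytope)
      moreover have "norm (x - a) \<le> R - r" using x by (simp add: dist_norm norm_minus_commute)
      ultimately show "norm (x - p) \<le> R" using norm_triangle_ineq[of "x - a" "a - p"] by simp
    qed
  qed
qed (use assms in auto)

lemma V1_nonneg:
  fixes F :: "(real ^ 2) set"
  assumes "finite F" "F \<noteq> {}" "r > 0"
  shows "V1 (ball_polytope F r) \<ge> 0"
proof (cases "ball_polytope F r = {}")
  case False
  then show ?thesis using V1_ball_polytope[OF assms False] assms by (simp add: sum_nonneg)
qed (simp add: V1_def)

lemma V1_ball:
  fixes c :: "real ^ 2"
  assumes "\<rho> > 0"
  shows "V1 (ball_polytope {c} \<rho>) = pi * \<rho>"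
proof -
  have "smooth_cone {c} \<rho> c = cball 0 1 - {0}"
    using assms by (auto simp: smooth_cone_def mem_ball_polytope)
  moreover have "measure lebesgue (cball 0 1 - {0} :: (real ^ 2) set) = pi"
    by (subst measure_Diff) (auto simp: measure_unit_disc emeasure_cball)
  moreover have "c \<in> ball_polytope {c} \<rho>" using assms by (simp add: mem_ball_polytope)
  ultimately show ?thesis using V1_ball_polytope[of "{c}" \<rho>] assms by fastforce
qed

lemma V1_ge_inball:
  fixes F :: "(real ^ 2) set"
  assumes "finite F" "F \<noteq> {}" "r > 0" "\<rho> > 0" "cball c \<rho> \<subseteq> ball_polytope F r"
  shows "pi * \<rho> \<le> V1 (ball_polytope F r)"
proof -
  have eq: "ball_polytope {c} \<rho> = cball c \<rho>" by (simp add: ball_polytope_def)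
  have "c \<in> cball c \<rho>" using \<open>\<rho> > 0\<close> by simp
  then have ne: "ball_polytope {c} \<rho> \<noteq> {}" unfolding eq by blast
  have "V1 (ball_polytope {c} \<rho>) + pi * 0 \<le> V1 (ball_polytope F r)"
    using assms ne eq by (intro V1_parallel_mono) auto
  then show ?thesis using V1_ball[OF \<open>\<rho> > 0\<close>, of c] by simp
qed

section \<open>Sectors of the unit disc\<close>

definition dir :: "real \<Rightarrow> real ^ 2" where
  "dir t = vector [cos t, sin t]"

text \<open>The centre of the disc is left out, so that sectors with disjoint directions are disjoint.\<close>
definition sector :: "real \<Rightarrow> real \<Rightarrow> (real ^ 2) set" where
  "sector \<alpha> \<beta> = {s *\<^sub>R dir t | s t. 0 < s \<and> s \<le> 1 \<and> \<alpha> \<le> t \<and> t \<le> \<beta>}"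

lemma dir_nth [simp]: "dir t $ 1 = cos t" "dir t $ 2 = sin t"
  by (simp_all add: dir_def)

lemma dir_inner: "dir t \<bullet> dir u = cos (t - u)"
  by (simp add: inner2 cos_diff)

lemma norm_dir [simp]: "norm (dir t) = 1"
  by (simp add: norm_eq_1 dir_inner)

lemma dir_nonzero [simp]: "dir t \<noteq> 0"
  by (metis norm_dir norm_zero zero_neq_one)

lemma norm_dir_diff_sq: "(norm (dir t - dir u))\<^sup>2 = 4 * (sin ((t - u) / 2))\<^sup>2"
proof -
  have "(norm (dir t - dir u))\<^sup>2 = 2 - 2 * cos (t - u)"
    by (simp add: power2_norm_eq_inner inner_diff_left inner_diff_right dir_inner cos_diff mult.commute)
  also have "cos (t - u) = 1 - 2 * (sin ((t - u) / 2))\<^sup>2"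
    using cos_double_sin[of "(t - u) / 2"] by (simp only: mult_2 field_sum_of_halves)
  finally show ?thesis by simp
qed

lemma norm_dir_diff: "norm (dir t - dir u) = 2 * \<bar>sin ((t - u) / 2)\<bar>"
proof -
  have "(norm (dir t - dir u))\<^sup>2 = (2 * \<bar>sin ((t - u) / 2)\<bar>)\<^sup>2"
    by (simp add: norm_dir_diff_sq power_mult_distrib)
  then show ?thesis by (metis norm_ge_zero abs_ge_zero mult_nonneg_nonneg zero_le_numeral power2_eq_imp_eq)
qed

lemma dir_eq_iff: "dir t = dir u \<longleftrightarrow> (\<exists>k::int. t = u + 2 * pi * of_int k)"
proof -
  have "dir t = dir u \<longleftrightarrow> sin t = sin u \<and> cos t = cos u"
    by (auto simp: vec_eq_iff forall_2)
  also have "\<dots> \<longleftrightarrow> (\<exists>n::int. t = u + 2 * pi * n)" by (rule sin_cos_eq_iff)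
  finally show ?thesis .
qed

lemma unit_vector_eq_dir:
  assumes "norm v = 1"
  obtains t where "v = dir t" "c \<le> t" "t < c + 2 * pi"
proof -
  have "(v $ 1)\<^sup>2 + (v $ 2)\<^sup>2 = 1" using assms by (simp add: norm_eq_1 inner2 power2_eq_square)
  then obtain u where u: "v $ 1 = cos u" "v $ 2 = sin u" using sincos_total_2pi by metis
  define k where "k = \<lfloor>(u - c) / (2 * pi)\<rfloor>"
  have "of_int k \<le> (u - c) / (2 * pi)" "(u - c) / (2 * pi) < of_int k + 1" by (auto simp: k_def)
  then have "of_int k * (2 * pi) \<le> u - c" "u - c < (of_int k + 1) * (2 * pi)"
    by (simp_all add: pos_le_divide_eq pos_divide_less_eq)
  moreover have "dir (u - 2 * pi * of_int k) = dir u" unfolding dir_eq_iff by (intro exI[of _ "-k"]) simp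
  moreover have "dir u = v" using u by (simp add: vec_eq_iff forall_2)
  ultimately show ?thesis by (intro that[of "u - 2 * pi * of_int k"]) (auto simp: algebra_simps)
qed

lemma mem_sector: "y \<in> sector \<alpha> \<beta> \<longleftrightarrow> y \<noteq> 0 \<and> norm y \<le> 1 \<and> (\<exists>t. \<alpha> \<le> t \<and> t \<le> \<beta> \<and> y = norm y *\<^sub>R dir t)"
proof
  assume "y \<in> sector \<alpha> \<beta>"
  then show "y \<noteq> 0 \<and> norm y \<le> 1 \<and> (\<exists>t. \<alpha> \<le> t \<and> t \<le> \<beta> \<and> y = norm y *\<^sub>R dir t)"
    by (auto simp: sector_def)
next
  assume y: "y \<noteq> 0 \<and> norm y \<le> 1 \<and> (\<exists>t. \<alpha> \<le> t \<and> t \<le> \<beta> \<and> y = norm y *\<^sub>R dir t)"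
  then obtain t where "\<alpha> \<le> t" "t \<le> \<beta>" "y = norm y *\<^sub>R dir t" by blast
  then show "y \<in> sector \<alpha> \<beta>" using y unfolding sector_def
    by (intro CollectI exI[of _ "norm y"] exI[of _ t]) auto
qed

lemma continuous_dir: "continuous_on S dir"
proof -
  have eq: "dir = (\<lambda>t. cos t *\<^sub>R axis 1 1 + sin t *\<^sub>R axis 2 1)"
    by (auto simp: fun_eq_iff vec_eq_iff forall_2 axis_def)
  show ?thesis unfolding eq by (intro continuous_intros)
qed

lemma lmeasurable_sector: "sector \<alpha> \<beta> \<in> lmeasurable"
proof -
  have eq: "sector \<alpha> \<beta> = (\<lambda>(s, t). s *\<^sub>R dir t) ` ({0..1} \<times> {\<alpha>..\<beta>}) - {0}"
    by (auto simp: sector_def image_iff) force+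
  have "compact ((\<lambda>(s, t). s *\<^sub>R dir t) ` ({0..1} \<times> {\<alpha>..\<beta>}))"
    unfolding case_prod_unfold
    by (intro compact_continuous_image compact_Times continuous_intros
      continuous_on_compose2[OF continuous_dir[of UNIV]]) auto
  then show ?thesis unfolding eq by (intro fmeasurable.Diff lmeasurable_compact) auto
qed

lemma sector_full: "sector \<alpha> (\<alpha> + 2 * pi) = cball 0 1 - {0}"
proof (rule set_eqI)
  fix y :: "real ^ 2"
  have "\<exists>t\<ge>\<alpha>. t \<le> \<alpha> + 2 * pi \<and> y = norm y *\<^sub>R dir t" if y: "y \<noteq> 0"
  proof -
    have "norm (inverse (norm y) *\<^sub>R y) = 1" using y by simp
    then obtain t where t: "inverse (norm y) *\<^sub>R y = dir t" "\<alpha> \<le> t" "t < \<alpha> + 2 * pi"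
      using unit_vector_eq_dir[of _ \<alpha>] by metis
    have "y = norm y *\<^sub>R (inverse (norm y) *\<^sub>R y)" using y by simp
    then show ?thesis using t by (intro exI[of _ t]) auto
  qed
  then show "y \<in> sector \<alpha> (\<alpha> + 2 * pi) \<longleftrightarrow> y \<in> cball 0 1 - {0}"
    unfolding mem_sector by auto
qed

lemma measure_sector_full: "measure lebesgue (sector \<alpha> (\<alpha> + 2 * pi)) = pi"
  unfolding sector_full by (subst measure_Diff) (auto simp: measure_unit_disc emeasure_cball)

definition rot :: "real \<Rightarrow> real ^ 2 \<Rightarrow> real ^ 2" where
  "rot c v = cos c *\<^sub>R v + sin c *\<^sub>R perp v"

lemma rot_dir: "rot c (dir t) = dir (t + c)"
  by (simp add: rot_def vec_eq_iff forall_2 cos_add sin_add algebra_simps)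

lemma orthogonal_rot: "orthogonal_transformation (rot c)"
proof -
  have lin: "linear (rot c)"
    by (rule linearI) (auto simp: rot_def vec_eq_iff forall_2 algebra_simps)
  have "(rot c v) \<bullet> (rot c w) = ((cos c)\<^sup>2 + (sin c)\<^sup>2) * (v \<bullet> w)" for v w
    unfolding rot_def inner2 vector_add_component vector_scaleR_component perp_simps real_scaleR_def
    by algebra
  then show ?thesis unfolding orthogonal_transformation_def using lin by simp
qed

lemma rot_sector: "rot c ` sector \<alpha> \<beta> = sector (\<alpha> + c) (\<beta> + c)"
proof -
  have lin: "rot c (s *\<^sub>R v) = s *\<^sub>R rot c v" for s v
    using orthogonal_rot by (simp add: orthogonal_transformation_def linear_cmul)
  show ?thesis
  proof (intro equalityI subsetI)
    fix y assume "y \<in> rot c ` sector \<alpha> \<beta>"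
    then obtain s t where "y = s *\<^sub>R dir (t + c)" "0 < s" "s \<le> 1" "\<alpha> \<le> t" "t \<le> \<beta>"
      by (auto simp: sector_def lin rot_dir)
    then show "y \<in> sector (\<alpha> + c) (\<beta> + c)" unfolding sector_def by force
  next
    fix y assume "y \<in> sector (\<alpha> + c) (\<beta> + c)"
    then obtain s t where "y = s *\<^sub>R dir t" "0 < s" "s \<le> 1" "\<alpha> + c \<le> t" "t \<le> \<beta> + c"
      by (auto simp: sector_def)
    then have "y = rot c (s *\<^sub>R dir (t - c))" by (simp add: lin rot_dir)
    moreover have "s *\<^sub>R dir (t - c) \<in> sector \<alpha> \<beta>"
      unfolding sector_def
      by (rule CollectI, rule exI[of _ s], rule exI[of _ "t - c"])
        (use \<open>0 < s\<close> \<open>s \<le> 1\<close> \<open>\<alpha> + c \<le> t\<close> \<open>t \<le> \<beta> + c\<close> in auto)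
    ultimately show "y \<in> rot c ` sector \<alpha> \<beta>" by blast
  qed
qed

lemma measure_sector_shift: "measure lebesgue (sector (\<alpha> + c) (\<beta> + c)) = measure lebesgue (sector \<alpha> \<beta>)"
  unfolding rot_sector[symmetric] by (intro measure_orthogonal_image orthogonal_rot lmeasurable_sector)

lemma negligible_sector_Int:
  assumes "\<alpha> \<le> \<beta>" "\<beta> \<le> \<gamma>" "\<gamma> \<le> \<alpha> + 2 * pi"
  shows "negligible (sector \<alpha> \<beta> \<inter> sector \<beta> \<gamma>)"
proof -
  have "sector \<alpha> \<beta> \<inter> sector \<beta> \<gamma> \<subseteq> span {dir \<alpha>} \<union> span {dir \<beta>}"
  proof
    fix y assume y: "y \<in> sector \<alpha> \<beta> \<inter> sector \<beta> \<gamma>"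
    then obtain t u where tu: "\<alpha> \<le> t" "t \<le> \<beta>" "y = norm y *\<^sub>R dir t" "\<beta> \<le> u" "u \<le> \<gamma>" "y = norm y *\<^sub>R dir u"
      "y \<noteq> 0" unfolding Int_iff mem_sector by blast
    have "dir u = dir t" using tu(3,6,7) by (metis norm_eq_zero scaleR_cancel_left)
    then obtain k :: int where k: "u = t + 2 * pi * of_int k" unfolding dir_eq_iff by blast
    have "t = \<alpha> \<or> t = \<beta>"
    proof (cases "k \<le> 0")
      case True
      then have "2 * pi * of_int k \<le> 0" by (simp add: mult_le_0_iff)
      then show ?thesis using k tu by linarith
    next
      case False
      then have "2 * pi * 1 \<le> 2 * pi * of_int k" by (intro mult_left_mono) auto
      then show ?thesis using k tu assms by linarith
    qed
    then show "y \<in> span {dir \<alpha>} \<union> span {dir \<beta>}"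
      using tu(3) by (metis UnI1 UnI2 insertI1 span_base span_scale)
  qed
  moreover have "negligible (span {dir t})" for t
    by (intro negligible_lowdim) (simp add: dim_span)
  ultimately show ?thesis by (meson negligible_Un negligible_subset)
qed

lemma sector_Un:
  assumes "\<alpha> \<le> \<beta>" "\<beta> \<le> \<gamma>"
  shows "sector \<alpha> \<gamma> = sector \<alpha> \<beta> \<union> sector \<beta> \<gamma>"
  using assms by (auto simp: mem_sector) (meson linorder_le_cases order_trans)+

lemma measure_sector_add:
  assumes "\<alpha> \<le> \<beta>" "\<beta> \<le> \<gamma>" "\<gamma> \<le> \<alpha> + 2 * pi"
  shows "measure lebesgue (sector \<alpha> \<gamma>) = measure lebesgue (sector \<alpha> \<beta>) + measure lebesgue (sector \<beta> \<gamma>)"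
  unfolding sector_Un[OF assms(1,2)]
proof (intro measure_Un_AE lmeasurable_sector)
  have "sector \<alpha> \<beta> \<inter> sector \<beta> \<gamma> \<in> null_sets lebesgue"
    using negligible_sector_Int[OF assms] by (simp add: negligible_iff_null_sets)
  then have "AE x in lebesgue. x \<notin> sector \<alpha> \<beta> \<inter> sector \<beta> \<gamma>" by (rule AE_not_in)
  then show "AE x in lebesgue. x \<notin> sector \<alpha> \<beta> \<or> x \<notin> sector \<beta> \<gamma>" by simp
qed

text \<open>The area of a sector depends only on its angle, additively and monotonically, and is \<open>\<pi>\<close> for the full
angle. This determines it for rational parts of the full angle and then, by monotonicity, for all angles.\<close>

lemma measure_sector:
  assumes "\<alpha> \<le> \<beta>" "\<beta> \<le> \<alpha> + 2 * pi"
  shows "measure lebesgue (sector \<alpha> \<beta>) = (\<beta> - \<alpha>) / 2"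
proof -
  define m where "m l = measure lebesgue (sector 0 l)" for l
  have add: "m (a + b) = m a + m b" if "a \<ge> 0" "b \<ge> 0" "a + b \<le> 2 * pi" for a b
    using measure_sector_add[of 0 a "a + b"] measure_sector_shift[of 0 a b] that
    by (simp add: m_def add.commute)
  have m0: "m 0 = 0" using add[of 0 0] by simp
  have mono: "m a \<le> m b" if "0 \<le> a" "a \<le> b" "b \<le> 2 * pi" for a b
    using add[of a "b - a"] that by (simp add: m_def)
  have full: "m (2 * pi) = pi" using measure_sector_full[of 0] by (simp add: m_def)
  have mult: "m (real k * h) = real k * m h" if "h \<ge> 0" "real k * h \<le> 2 * pi" for k h
    using that
  proof (induction k)
    case (Suc k)
    then have "m (real k * h + h) = m (real k * h) + m h" by (intro add) (auto simp: algebra_simps)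
    with Suc show ?case by (auto simp: algebra_simps)
  qed (simp add: m0)
  have frac: "m (real k * (2 * pi / real n)) = real k * (pi / real n)" if "k \<le> n" "n > 0" for k n
  proof -
    have "m (2 * pi) = real n * m (2 * pi / real n)" using mult[of "2 * pi / real n" n] that by simp
    then have "m (2 * pi / real n) = pi / real n" using full that by (simp add: field_simps)
    moreover have "real k * (2 * pi / real n) \<le> 2 * pi" using that by (simp add: field_simps)
    ultimately show ?thesis using mult[of "2 * pi / real n" k] that by simp
  qed
  have m_eq: "m l = l / 2" if l: "0 \<le> l" "l < 2 * pi" for l
  proof -
    have close: "\<bar>m l - l / 2\<bar> \<le> pi / real n" if n: "n > 0" for n :: nat
    proof -
      define k where "k = nat \<lfloor>l / (2 * pi / real n)\<rfloor>"
      have h: "2 * pi / real n > 0" using n by simp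
      have k: "real k = of_int \<lfloor>l / (2 * pi / real n)\<rfloor>" using l h by (simp add: k_def)
      have "real k \<le> l / (2 * pi / real n)" "l / (2 * pi / real n) < real k + 1" unfolding k by linarith+
      then have b: "real k * (2 * pi / real n) \<le> l" "l < (real k + 1) * (2 * pi / real n)"
        using h by (simp_all only: pos_le_divide_eq pos_divide_less_eq)
      then have "real k * (2 * pi / real n) < 2 * pi" using l by linarith
      then have "k < n" using n by (simp add: field_simps)
      then have "m (real k * (2 * pi / real n)) = real k * (pi / real n)"
        "m (real (Suc k) * (2 * pi / real n)) = real (Suc k) * (pi / real n)"
        using frac[of k n] frac[of "Suc k" n] by auto
      moreover have "m (real k * (2 * pi / real n)) \<le> m l" using b l h by (intro mono) auto
      moreover have "m l \<le> m (real (Suc k) * (2 * pi / real n))"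
      proof (intro mono)
        have "real (Suc k) * (2 * pi / real n) \<le> real n * (2 * pi / real n)"
          using \<open>k < n\<close> by (intro mult_right_mono) auto
        then show "real (Suc k) * (2 * pi / real n) \<le> 2 * pi" using n by simp
        show "l \<le> real (Suc k) * (2 * pi / real n)" using b by (simp add: add.commute)
      qed (use l in auto)
      moreover have "real k * (pi / real n) \<le> l / 2" "l / 2 \<le> (real k + 1) * (pi / real n)"
        using b by (simp_all add: field_simps)
      moreover have "real (Suc k) * (pi / real n) = real k * (pi / real n) + pi / real n"
        "(real k + 1) * (pi / real n) = real k * (pi / real n) + pi / real n"
        by (simp_all add: distrib_right add_divide_distrib)
      ultimately have "real k * (pi / real n) \<le> m l" "m l \<le> real k * (pi / real n) + pi / real n"
        "real k * (pi / real n) \<le> l / 2" "l / 2 \<le> real k * (pi / real n) + pi / real n" by metis+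
      then show ?thesis by (simp only: abs_le_iff minus_diff_eq) linarith
    qed
    have "\<bar>m l - l / 2\<bar> \<le> 0"
    proof (rule tendsto_le[OF sequentially_bot])
      show "(\<lambda>n. pi / real n) \<longlonglongrightarrow> 0" by (rule lim_const_over_n)
      show "\<forall>\<^sub>F n in sequentially. \<bar>m l - l / 2\<bar> \<le> pi / real n"
        using eventually_gt_at_top[of 0] by eventually_elim (rule close)
    qed simp
    then show ?thesis by simp
  qed
  have "measure lebesgue (sector \<alpha> \<beta>) = m (\<beta> - \<alpha>)"
    using measure_sector_shift[of 0 \<alpha> "\<beta> - \<alpha>"] by (simp add: m_def)
  also have "m (\<beta> - \<alpha>) = (\<beta> - \<alpha>) / 2"
    using assms full m_eq[of "\<beta> - \<alpha>"] by (cases "\<beta> - \<alpha> = 2 * pi") auto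
  finally show ?thesis .
qed

lemma measure_sector_le: "\<alpha> \<le> \<beta> \<Longrightarrow> measure lebesgue (sector \<alpha> \<beta>) \<le> (\<beta> - \<alpha>) / 2"
proof (cases "\<beta> \<le> \<alpha> + 2 * pi")
  case False
  have "measure lebesgue (sector \<alpha> \<beta>) \<le> measure lebesgue (cball (0::real ^ 2) 1)"
    by (intro measure_mono_fmeasurable) (auto simp: mem_sector fmeasurableD lmeasurable_sector)
  then show ?thesis using False by (simp add: measure_unit_disc)
qed (simp add: measure_sector)

section \<open>The smooth directions of a centre form an arc\<close>

lemma normal_dir_iff:
  assumes "r > 0"
  shows "p + r *\<^sub>R dir t \<in> ball_polytope F r \<longleftrightarrow>
    (\<forall>q\<in>F. (norm (p - q))\<^sup>2 + 2 * r * (dir t \<bullet> (p - q)) \<le> 0)"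
  using smooth_cone_ball_iff[OF dir_nonzero assms, of p t] by (simp add: mem_ball_polytope)

lemma dir_between:
  "sin (v - t) *\<^sub>R dir u + sin (t - u) *\<^sub>R dir v = sin (v - u) *\<^sub>R dir t"
  unfolding vec_eq_iff forall_2 vector_add_component vector_scaleR_component dir_nth real_scaleR_def sin_diff
  by (simp add: algebra_simps)

text \<open>Smoothness of a direction for \<open>p\<close> means inequalities \<open>D + 2 r (u \<bullet> (p - q)) \<le> 0\<close> with \<open>D \<ge> 0\<close>.
A unit vector between two others at angle less than \<open>\<pi>\<close> is a combination of them whose coefficients
add up to at least 1, so these inequalities pass to it.\<close>

lemma normal_dir_convex:
  assumes r: "r > 0" and uv: "u \<le> t" "t \<le> v" "v - u < pi"
    and N: "p + r *\<^sub>R dir u \<in> ball_polytope F r" "p + r *\<^sub>R dir v \<in> ball_polytope F r"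
  shows "p + r *\<^sub>R dir t \<in> ball_polytope F r"
proof (cases "u = v")
  case True
  then show ?thesis using assms by simp
next
  case False
  define c a b where "c = sin (v - u)" and "a = sin (v - t)" and "b = sin (t - u)"
  have pos: "c > 0" "a \<ge> 0" "b \<ge> 0"
    unfolding a_def b_def c_def using uv False by (auto intro!: sin_gt_zero sin_ge_zero)
  have eq: "a *\<^sub>R dir u + b *\<^sub>R dir v = c *\<^sub>R dir t"
    unfolding a_def b_def c_def by (rule dir_between)
  have "c = norm (c *\<^sub>R dir t)" using pos by simp
  also have "\<dots> \<le> norm (a *\<^sub>R dir u) + norm (b *\<^sub>R dir v)"
    unfolding eq[symmetric] by (rule norm_triangle_ineq)
  finally have cab: "c \<le> a + b" using pos by simp
  show ?thesis unfolding normal_dir_iff[OF r]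
  proof
    fix q assume q: "q \<in> F"
    define D where "D = (norm (p - q))\<^sup>2"
    have D: "D \<ge> 0" "D + 2 * r * (dir u \<bullet> (p - q)) \<le> 0" "D + 2 * r * (dir v \<bullet> (p - q)) \<le> 0"
      using N q unfolding normal_dir_iff[OF r] by (auto simp: D_def)
    have "c * (dir t \<bullet> (p - q)) = a * (dir u \<bullet> (p - q)) + b * (dir v \<bullet> (p - q))"
      using arg_cong[OF eq, of "\<lambda>w. w \<bullet> (p - q)"] by (simp add: inner_add_left)
    then have "c * (D + 2 * r * (dir t \<bullet> (p - q)))
        = (c - a - b) * D + a * (D + 2 * r * (dir u \<bullet> (p - q))) + b * (D + 2 * r * (dir v \<bullet> (p - q)))"
      by (simp add: algebra_simps) algebra
    also have "\<dots> \<le> 0"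
    proof -
      have "(c - a - b) * D \<le> 0" using D(1) cab by (intro mult_nonpos_nonneg) auto
      moreover have "a * (D + 2 * r * (dir u \<bullet> (p - q))) \<le> 0" using D(2) pos by (intro mult_nonneg_nonpos)
      moreover have "b * (D + 2 * r * (dir v \<bullet> (p - q))) \<le> 0" using D(3) pos by (intro mult_nonneg_nonpos)
      ultimately show ?thesis by linarith
    qed
    finally show "D + 2 * r * (dir t \<bullet> (p - q)) \<le> 0" using pos by (simp add: mult_le_0_iff)
  qed
qed

lemma cos_pos_imp_abs_less:
  assumes "cos x > 0" "\<bar>x\<bar> \<le> pi"
  shows "\<bar>x\<bar> < pi / 2"
proof (rule ccontr)
  assume "\<not> ?thesis"
  then have "cos \<bar>x\<bar> \<le> cos (pi / 2)" using assms by (intro cos_monotone_0_pi_le) auto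
  then show False using assms by simp
qed

text \<open>A second centre \<open>q\<close> confines the smooth directions of \<open>p\<close> to the open half-plane of directions that
point towards \<open>q\<close>; inside a half-plane they form an interval by \<open>normal_dir_convex\<close>.\<close>

lemma smooth_cone_arc:
  fixes F :: "(real ^ 2) set"
  assumes r: "r > 0" and q: "q \<in> F" "q \<noteq> p" and t0: "p + r *\<^sub>R dir t0 \<in> ball_polytope F r"
  obtains \<alpha> \<beta> where "\<alpha> \<le> \<beta>" "\<beta> - \<alpha> \<le> pi" "smooth_cone F r p = sector \<alpha> \<beta>"
    "\<And>t. \<alpha> \<le> t \<Longrightarrow> t \<le> \<beta> \<Longrightarrow> p + r *\<^sub>R dir t \<in> ball_polytope F r"
    "\<And>t. p + r *\<^sub>R dir t \<in> ball_polytope F r \<Longrightarrow> \<exists>u. \<alpha> \<le> u \<and> u \<le> \<beta> \<and> dir t = dir u"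
proof -
  let ?N = "\<lambda>t. p + r *\<^sub>R dir t \<in> ball_polytope F r"
  define d where "d = norm (q - p)"
  have d: "d > 0" using q by (simp add: d_def)
  have "norm (inverse d *\<^sub>R (q - p)) = 1" using d by (simp add: d_def)
  then obtain \<phi> where "inverse d *\<^sub>R (q - p) = dir \<phi>" using unit_vector_eq_dir[of _ 0] by metis
  then have qp: "q - p = d *\<^sub>R dir \<phi>" using d by (metis divideR_right less_irrefl)
  have N_cos: "cos (t - \<phi>) > 0" if "?N t" for t
  proof -
    have "(norm (p - q))\<^sup>2 + 2 * r * (dir t \<bullet> (p - q)) \<le> 0" using that q(1) unfolding normal_dir_iff[OF r] by blast
    moreover have "p - q = - (d *\<^sub>R dir \<phi>)" using qp by (metis minus_diff_eq)
    ultimately have "d\<^sup>2 \<le> 2 * r * (d * cos (t - \<phi>))" using d by (simp add: dir_inner)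
    then have "0 < 2 * r * (d * cos (t - \<phi>))" using d by (smt (verit) zero_less_power)
    then show ?thesis using r d by (simp add: zero_less_mult_iff)
  qed
  define T where "T = {t \<in> {\<phi> - pi .. \<phi> + pi}. ?N t}"
  have T_half: "\<bar>t - \<phi>\<bar> < pi / 2" if "t \<in> T" for t
    using that N_cos[of t] by (intro cos_pos_imp_abs_less) (auto simp: T_def)
  have T_rep: "\<exists>u\<in>T. dir t = dir u" if "?N t" for t
  proof -
    obtain u where "dir t = dir u" "\<phi> - pi \<le> u" "u < (\<phi> - pi) + 2 * pi"
      by (rule unit_vector_eq_dir[where v = "dir t" and c = "\<phi> - pi", OF norm_dir])
    moreover from this have "u \<in> T" using that unfolding T_def by simp
    ultimately show ?thesis by blast
  qed
  have "compact T"
  proof -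
    have "T = {\<phi> - pi .. \<phi> + pi} \<inter> (\<Inter>q\<in>F. {t. (norm (p - q))\<^sup>2 + 2 * r * (dir t \<bullet> (p - q)) \<le> 0})"
      unfolding T_def normal_dir_iff[OF r] by auto
    moreover have "closed (\<Inter>q\<in>F. {t. (norm (p - q))\<^sup>2 + 2 * r * (dir t \<bullet> (p - q)) \<le> 0})"
      by (intro closed_INT ballI closed_Collect_le continuous_intros continuous_dir)
    ultimately show ?thesis by (simp add: compact_Int_closed)
  qed
  moreover have "T \<noteq> {}" using T_rep[OF t0] by blast
  ultimately have "\<exists>\<alpha>\<in>T. \<forall>t\<in>T. \<alpha> \<le> t" "\<exists>\<beta>\<in>T. \<forall>t\<in>T. t \<le> \<beta>"
    by (rule compact_attains_inf, rule compact_attains_sup)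
  then obtain \<alpha> \<beta> where ab: "\<alpha> \<in> T" "\<beta> \<in> T" "\<And>t. t \<in> T \<Longrightarrow> \<alpha> \<le> t" "\<And>t. t \<in> T \<Longrightarrow> t \<le> \<beta>"
    by blast
  have len: "\<beta> - \<alpha> < pi" using T_half[OF ab(1)] T_half[OF ab(2)] by linarith
  have le: "\<alpha> \<le> \<beta>" using ab by blast
  have in_N: "?N t" if "\<alpha> \<le> t" "t \<le> \<beta>" for t
    using normal_dir_convex[OF r that len] ab(1,2) by (auto simp: T_def)
  have rep: "\<exists>u. \<alpha> \<le> u \<and> u \<le> \<beta> \<and> dir t = dir u" if "?N t" for t
    using T_rep[OF that] ab by blast
  have "smooth_cone F r p = sector \<alpha> \<beta>"
  proof (rule set_eqI)
    fix y :: "real ^ 2"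
    show "y \<in> smooth_cone F r p \<longleftrightarrow> y \<in> sector \<alpha> \<beta>"
    proof (cases "y = 0")
      case False
      have "norm (inverse (norm y) *\<^sub>R y) = 1" using False by simp
      then obtain t where t: "inverse (norm y) *\<^sub>R y = dir t" using unit_vector_eq_dir[of _ 0] by metis
      then have y: "y = norm y *\<^sub>R dir t" using False by (metis divideR_right norm_eq_zero)
      have "(r / norm y) *\<^sub>R y = r *\<^sub>R dir t" using t by (metis divide_inverse scaleR_scaleR)
      then have "y \<in> smooth_cone F r p \<longleftrightarrow> norm y \<le> 1 \<and> ?N t"
        using False by (simp add: smooth_cone_def)
      also have "\<dots> \<longleftrightarrow> norm y \<le> 1 \<and> (\<exists>u. \<alpha> \<le> u \<and> u \<le> \<beta> \<and> dir t = dir u)"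
      proof -
        have "?N t \<longleftrightarrow> (\<exists>u. \<alpha> \<le> u \<and> u \<le> \<beta> \<and> dir t = dir u)"
        proof
          assume "\<exists>u. \<alpha> \<le> u \<and> u \<le> \<beta> \<and> dir t = dir u"
          then obtain u where "\<alpha> \<le> u" "u \<le> \<beta>" and e: "dir t = dir u" by blast
          then show "?N t" unfolding e by (intro in_N)
        qed (rule rep)
        then show ?thesis by blast
      qed
      also have "\<dots> \<longleftrightarrow> y \<in> sector \<alpha> \<beta>"
      proof -
        have "dir t = dir u \<longleftrightarrow> y = norm y *\<^sub>R dir u" for u
        proof
          assume "y = norm y *\<^sub>R dir u"
          with y[symmetric] have "norm y *\<^sub>R dir t = norm y *\<^sub>R dir u" by (rule trans)
          then show "dir t = dir u" using False by simp
        next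
          assume "dir t = dir u"
          with y show "y = norm y *\<^sub>R dir u" by (rule subst[rotated])
        qed
        then show ?thesis using False unfolding mem_sector by blast
      qed
      finally show ?thesis .
    qed (simp add: smooth_cone_def mem_sector)
  qed
  then show ?thesis using le len in_N rep that[of \<alpha> \<beta>] by simp
qed

section \<open>An upper bound from disjoint sectors\<close>

text \<open>The boundary points \<open>p + r u\<close> and \<open>q + r w\<close> lie in each other's discs. For their difference \<open>d\<close> this
says \<open>|d|\<^sup>2 \<le> 2 r (u \<bullet> d)\<close> and \<open>|d|\<^sup>2 \<le> - 2 r (w \<bullet> d)\<close>, and expanding
\<open>p - q = d - r (u - w)\<close> gives \<open>|p - q|\<^sup>2 \<le> r\<^sup>2 |u - w|\<^sup>2 - |d|\<^sup>2\<close>.\<close>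

lemma normal_separation:
  fixes F :: "(real ^ 2) set"
  assumes F: "p \<in> F" "q \<in> F" and r: "r > 0" and n: "norm u = 1" "norm w = 1"
    and A: "p + r *\<^sub>R u \<in> ball_polytope F r" "q + r *\<^sub>R w \<in> ball_polytope F r"
  shows "norm (p - q) \<le> r * norm (u - w)"
proof -
  define d where "d = (p + r *\<^sub>R u) - (q + r *\<^sub>R w)"
  have "norm (p + r *\<^sub>R u - q) \<le> r" "norm (q + r *\<^sub>R w - p) \<le> r"
    using A F by (auto simp: mem_ball_polytope)
  then have "(norm (p + r *\<^sub>R u - q))\<^sup>2 \<le> r\<^sup>2" "(norm (q + r *\<^sub>R w - p))\<^sup>2 \<le> r\<^sup>2"
    by (auto intro!: power_mono)
  moreover have "p + r *\<^sub>R u - q = d + r *\<^sub>R w" "q + r *\<^sub>R w - p = -d + r *\<^sub>R u"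
    by (simp_all add: d_def)
  ultimately have 1: "(norm d)\<^sup>2 + 2 * r * (w \<bullet> d) \<le> 0" "(norm d)\<^sup>2 - 2 * r * (u \<bullet> d) \<le> 0"
    using norm_plus_scaled_sq[of d r w] norm_plus_scaled_sq[of "- d" r u] n by simp_all
  have "p - q = d + (- r) *\<^sub>R (u - w)" by (simp add: d_def scaleR_diff_right)
  then have "(norm (p - q))\<^sup>2 = (norm (d + (- r) *\<^sub>R (u - w)))\<^sup>2" by (rule arg_cong)
  also have "\<dots> = (norm d)\<^sup>2 + 2 * (- r) * ((u - w) \<bullet> d) + (- r)\<^sup>2 * (norm (u - w))\<^sup>2"
    by (rule norm_plus_scaled_sq)
  also have "\<dots> = (norm d)\<^sup>2 + 2 * r * (w \<bullet> d) - 2 * r * (u \<bullet> d) + (r * norm (u - w))\<^sup>2"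
    by (simp add: inner_diff_left power_mult_distrib right_diff_distrib)
  also have "\<dots> \<le> (r * norm (u - w))\<^sup>2" using 1 zero_le_power2[of "norm d"] by linarith
  finally have "(norm (p - q))\<^sup>2 \<le> (r * norm (u - w))\<^sup>2" .
  then show ?thesis by (rule power2_le_imp_le) (use r in simp)
qed

text \<open>By \<open>normal_separation\<close>, smooth directions of \<open>p\<close> and of \<open>q\<close> differ by an angle of at least
\<open>2 arcsin(|p - q| / 2r)\<close>. Therefore the arcs of smooth directions can be widened by \<open>\<rho>\<close> on both
sides without overlap, and the widened sectors fit into the unit disc.\<close>

lemma V1_upper_bound:
  fixes F :: "(real ^ 2) set"
  assumes F: "finite F" "card F \<ge> 2" and r: "r > 0"
    and ess: "\<And>p. p \<in> F \<Longrightarrow> \<exists>t. p + r *\<^sub>R dir t \<in> ball_polytope F r"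
    and \<rho>: "\<And>p. p \<in> F \<Longrightarrow> 0 \<le> \<rho> p" "\<And>p. p \<in> F \<Longrightarrow> \<rho> p \<le> pi / 2"
    and \<rho>2: "\<And>p q. p \<in> F \<Longrightarrow> q \<in> F \<Longrightarrow> p \<noteq> q \<Longrightarrow> \<rho> p + \<rho> q \<le> 2 * arcsin (norm (p - q) / (2 * r))"
  shows "V1 (ball_polytope F r) \<le> pi * r - r * (\<Sum>p\<in>F. \<rho> p)"
proof -
  let ?A = "ball_polytope F r"
  have other: "\<exists>q\<in>F. q \<noteq> p" for p
  proof (rule ccontr)
    assume "\<not> ?thesis"
    then have "F \<subseteq> {p}" by blast
    then have "card F \<le> card {p}" by (intro card_mono) auto
    with F(2) show False by simp
  qed
  then have neF: "F \<noteq> {}" by blast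
  then have ne: "?A \<noteq> {}" using ess by blast
  have "\<forall>p\<in>F. \<exists>\<alpha> \<beta>. \<alpha> \<le> \<beta> \<and> \<beta> - \<alpha> \<le> pi \<and> smooth_cone F r p = sector \<alpha> \<beta>
      \<and> (\<forall>t. \<alpha> \<le> t \<longrightarrow> t \<le> \<beta> \<longrightarrow> p + r *\<^sub>R dir t \<in> ?A)"
  proof
    fix p assume "p \<in> F"
    obtain t q where "p + r *\<^sub>R dir t \<in> ?A" "q \<in> F" "q \<noteq> p" using ess[OF \<open>p \<in> F\<close>] other by blast
    then show "\<exists>\<alpha> \<beta>. \<alpha> \<le> \<beta> \<and> \<beta> - \<alpha> \<le> pi \<and> smooth_cone F r p = sector \<alpha> \<beta>
      \<and> (\<forall>t. \<alpha> \<le> t \<longrightarrow> t \<le> \<beta> \<longrightarrow> p + r *\<^sub>R dir t \<in> ?A)"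
      using smooth_cone_arc[OF r] by metis
  qed
  then obtain \<alpha> \<beta> where ab: "\<And>p. p \<in> F \<Longrightarrow> \<alpha> p \<le> \<beta> p" "\<And>p. p \<in> F \<Longrightarrow> \<beta> p - \<alpha> p \<le> pi"
    "\<And>p. p \<in> F \<Longrightarrow> smooth_cone F r p = sector (\<alpha> p) (\<beta> p)"
    "\<And>p t. p \<in> F \<Longrightarrow> \<alpha> p \<le> t \<Longrightarrow> t \<le> \<beta> p \<Longrightarrow> p + r *\<^sub>R dir t \<in> ?A"
    by metis
  have d2r: "norm (p - q) \<le> 2 * r" if "p \<in> F" "q \<in> F" for p q
  proof -
    obtain x where "x \<in> ?A" using ne by blast
    then have "norm (x - p) \<le> r" "norm (x - q) \<le> r" using that by (auto simp: mem_ball_polytope)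
    then show ?thesis using norm_triangle_ineq4[of "x - q" "x - p"] by simp
  qed
  \<comment> \<open>the closed arcs could touch for the full widening, hence the factor \<open>\<tau> < 1\<close>\<close>
  have bound: "(\<Sum>p\<in>F. measure lebesgue (smooth_cone F r p)) + \<tau> * (\<Sum>p\<in>F. \<rho> p) \<le> pi"
    if \<tau>: "0 < \<tau>" "\<tau> < 1" for \<tau>
  proof -
    define S where "S p = sector (\<alpha> p - \<tau> * \<rho> p) (\<beta> p + \<tau> * \<rho> p)" for p
    have \<tau>\<rho>: "0 \<le> \<tau> * \<rho> p" "\<tau> * \<rho> p \<le> pi / 2" if "p \<in> F" for p
    proof -
      show "0 \<le> \<tau> * \<rho> p" using \<tau> \<rho>(1)[OF that] by simp
      have "\<tau> * \<rho> p \<le> 1 * \<rho> p" using \<tau> \<rho>(1)[OF that] by (intro mult_right_mono) auto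
      then show "\<tau> * \<rho> p \<le> pi / 2" using \<rho>(2)[OF that] by simp
    qed
    have mS: "measure lebesgue (S p) = measure lebesgue (smooth_cone F r p) + \<tau> * \<rho> p" if "p \<in> F" for p
      using ab(1-3)[OF that] \<tau>\<rho>[OF that] by (simp add: S_def measure_sector field_simps)
    have disj: "S p \<inter> S q = {}" if pq: "p \<in> F" "q \<in> F" "p \<noteq> q" for p q
    proof (rule ccontr)
      assume "\<not> ?thesis"
      then obtain y t1 t2 where y: "y \<noteq> 0" "y = norm y *\<^sub>R dir t1" "y = norm y *\<^sub>R dir t2"
        and t1: "\<alpha> p - \<tau> * \<rho> p \<le> t1" "t1 \<le> \<beta> p + \<tau> * \<rho> p"
        and t2: "\<alpha> q - \<tau> * \<rho> q \<le> t2" "t2 \<le> \<beta> q + \<tau> * \<rho> q"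
        by (auto simp: S_def mem_sector)
      have "dir t1 = dir t2" using y by (metis norm_eq_zero scaleR_cancel_left)
      then obtain k :: int where k: "t1 = t2 + 2 * pi * of_int k" unfolding dir_eq_iff by blast
      define u1 where "u1 = max (\<alpha> p) (min (\<beta> p) t1)"
      define u2 where "u2 = max (\<alpha> q) (min (\<beta> q) t2)"
      have u1: "\<alpha> p \<le> u1" "u1 \<le> \<beta> p" "\<bar>u1 - t1\<bar> \<le> \<tau> * \<rho> p"
        using t1 ab(1)[OF pq(1)] \<tau>\<rho>[OF pq(1)] by (auto simp: u1_def)
      have u2: "\<alpha> q \<le> u2" "u2 \<le> \<beta> q" "\<bar>u2 - t2\<bar> \<le> \<tau> * \<rho> q"
        using t2 ab(1)[OF pq(2)] \<tau>\<rho>[OF pq(2)] by (auto simp: u2_def)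
      \<comment> \<open>\<open>w\<close> represents the direction \<open>u2\<close> near \<open>u1\<close>, as \<open>t1\<close> and \<open>t2\<close> differ by a multiple of the full angle\<close>
      define w where "w = u2 + (t1 - t2)"
      have "dir w = dir u2" unfolding dir_eq_iff w_def k by (intro exI[of _ k]) simp
      then have "norm (p - q) \<le> r * norm (dir u1 - dir w)"
        using normal_separation[OF pq(1,2) r norm_dir norm_dir] ab(4)[OF pq(1) u1(1,2)] ab(4)[OF pq(2) u2(1,2)]
        by simp
      then have le: "norm (p - q) / (2 * r) \<le> \<bar>sin ((u1 - w) / 2)\<bar>"
        using r by (simp add: norm_dir_diff field_simps)
      define a where "a = arcsin (norm (p - q) / (2 * r))"
      have dd: "0 < norm (p - q) / (2 * r)" "norm (p - q) / (2 * r) \<le> 1"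
        using pq r d2r[OF pq(1,2)] by auto
      then have a: "0 < a" "a \<le> pi / 2" "sin a = norm (p - q) / (2 * r)"
        using arcsin_less_arcsin[of 0 "norm (p - q) / (2 * r)"] arcsin_ubound[of "norm (p - q) / (2 * r)"]
        by (auto simp: a_def)
      have "\<bar>u1 - w\<bar> \<le> \<tau> * (\<rho> p + \<rho> q)" using u1(3) u2(3) by (simp add: w_def algebra_simps)
      also have "\<dots> \<le> \<tau> * (2 * a)" using \<rho>2[OF pq] \<tau> by (intro mult_left_mono) (auto simp: a_def)
      also have "\<dots> < 2 * a" using \<tau> a by simp
      finally have lt: "\<bar>u1 - w\<bar> / 2 < a" by simp
      then have "sin (\<bar>u1 - w\<bar> / 2) < sin a" using a by (intro sin_monotone_2pi) auto
      moreover have "\<bar>sin ((u1 - w) / 2)\<bar> = sin (\<bar>u1 - w\<bar> / 2)"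
      proof -
        have "sin (\<bar>u1 - w\<bar> / 2) \<ge> 0" using lt a by (intro sin_ge_zero) auto
        moreover have "\<bar>sin ((u1 - w) / 2)\<bar> = \<bar>sin (\<bar>u1 - w\<bar> / 2)\<bar>"
        proof -
          have "\<bar>u1 - w\<bar> / 2 = (u1 - w) / 2 \<or> \<bar>u1 - w\<bar> / 2 = - ((u1 - w) / 2)" by linarith
          then show ?thesis
          proof
            assume eq: "\<bar>u1 - w\<bar> / 2 = - ((u1 - w) / 2)"
            show ?thesis unfolding eq sin_minus by simp
          qed (simp only:)
        qed
        ultimately show ?thesis by simp
      qed
      ultimately show False using le a(3) by simp
    qed
    have "(\<Sum>p\<in>F. measure lebesgue (S p)) = measure lebesgue (\<Union>p\<in>F. S p)"
      using F(1) disj by (intro measure_UNION'[symmetric]) (auto simp: S_def lmeasurable_sector pairwise_def disjnt_def)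
    also have "\<dots> \<le> measure lebesgue (cball (0::real ^ 2) 1)"
    proof (rule measure_mono_fmeasurable)
      show "(\<Union>p\<in>F. S p) \<in> sets lebesgue"
        using F(1) by (auto simp: S_def intro!: sets.finite_UN fmeasurableD[OF lmeasurable_sector])
    qed (auto simp: S_def mem_sector)
    also have "\<dots> = pi" by (rule measure_unit_disc)
    finally show ?thesis by (simp add: mS sum.distrib sum_distrib_left)
  qed
  define s where "s = (\<Sum>p\<in>F. measure lebesgue (smooth_cone F r p))"
  have "s + (\<Sum>p\<in>F. \<rho> p) \<le> pi"
  proof (rule tendsto_upperbound)
    have "((\<lambda>\<tau>. s + \<tau> * (\<Sum>p\<in>F. \<rho> p)) \<longlongrightarrow> s + 1 * (\<Sum>p\<in>F. \<rho> p)) (at_left 1)"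
      by (intro tendsto_intros)
    then show "((\<lambda>\<tau>. s + \<tau> * (\<Sum>p\<in>F. \<rho> p)) \<longlongrightarrow> s + (\<Sum>p\<in>F. \<rho> p)) (at_left 1)" by simp
    have "\<forall>\<^sub>F \<tau> in at_left (1::real). \<tau> \<in> {0<..<1}" by (rule eventually_at_left_real) simp
    then show "\<forall>\<^sub>F \<tau> in at_left 1. s + \<tau> * (\<Sum>p\<in>F. \<rho> p) \<le> pi"
      by eventually_elim (use bound in \<open>auto simp: s_def\<close>)
  qed simp
  then have "r * (s + (\<Sum>p\<in>F. \<rho> p)) \<le> r * pi" using r by (intro mult_left_mono) auto
  then show ?thesis using V1_ball_polytope[OF F(1) neF r ne] by (simp add: s_def algebra_simps)
qed

section \<open>A lower bound from a covering by sectors\<close>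

lemma sin_nonpos_of_half_chord:
  fixes x a :: real
  assumes x: "2 * a < x" "x \<le> 2 * pi" and a: "0 \<le> a" "a \<le> pi / 2" and s: "\<bar>sin (x / 2)\<bar> \<le> sin a"
  shows "sin x \<le> 0"
proof (cases "x \<le> pi")
  case True
  have "sin a < sin (x / 2)" using x(1) a True by (intro sin_monotone_2pi) auto
  then show ?thesis using s by simp
next
  case False
  then have "sin (x - pi) \<ge> 0" using x(2) by (intro sin_ge_zero) auto
  then show ?thesis using sin_periodic_pi[of "x - pi"] by simp
qed

text \<open>Consider the support point \<open>x\<close> in direction \<open>\<theta>\<close>. The outer normals at \<open>x\<close> of the circles through
\<open>x\<close> are smooth directions, and any two of them have distance at most \<open>lam / r\<close>. If all of them were
farther than \<open>a = arcsin(lam / 2r)\<close> from \<open>\<theta>\<close>, then, with \<open>p\<close> the closest one, the component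
\<open>w0\<close> of \<open>dir \<theta>\<close> orthogonal to the normal of \<open>p\<close> would point out of none of the discs: a normal
on the other side of \<open>\<theta>\<close> has an angle of more than \<open>2 a\<close> to that of \<open>p\<close>, hence must be close to it
on the way round the back. So \<open>x\<close> could be moved further in direction \<open>\<theta>\<close>. A small step towards
another point of the intersection makes the inequalities strict, which is why two points are assumed.\<close>

lemma normal_within_angle:
  fixes F :: "(real ^ 2) set"
  assumes F: "finite F" "F \<noteq> {}" and r: "r > 0" and c: "c \<in> ball_polytope F r" "c' \<in> ball_polytope F r" "c \<noteq> c'"
    and lam: "0 \<le> lam" "lam \<le> 2 * r" "\<And>p q. p \<in> F \<Longrightarrow> q \<in> F \<Longrightarrow> norm (p - q) \<le> lam"
  shows "\<exists>p\<in>F. \<exists>t. p + r *\<^sub>R dir t \<in> ball_polytope F r \<and> \<bar>t - \<theta>\<bar> \<le> arcsin (lam / (2 * r))"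
proof (rule ccontr)
  assume far: "\<not> ?thesis"
  let ?A = "ball_polytope F r"
  define a where "a = arcsin (lam / (2 * r))"
  have lr: "0 \<le> lam / (2 * r)" "lam / (2 * r) \<le> 1" using lam r by auto
  have a: "0 \<le> a" "a \<le> pi / 2" "sin a = lam / (2 * r)"
    using lr arcsin_le_arcsin[of 0 "lam / (2 * r)"] arcsin_ubound[of "lam / (2 * r)"] by (auto simp: a_def)
  obtain x where x: "supports ?A (dir \<theta>) x" using supports_exists[OF F(2)] c(1) by blast
  then have xA: "x \<in> ?A" and xmax: "\<And>z. z \<in> ?A \<Longrightarrow> dir \<theta> \<bullet> (z - x) \<le> 0" by (auto simp: supports_def)
  have no_feasible: False if w: "dir \<theta> \<bullet> w > 0" "\<And>p. p \<in> F \<Longrightarrow> norm (x - p) = r \<Longrightarrow> w \<bullet> (x - p) < 0" for w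
  proof -
    obtain s where "s > 0" "x + s *\<^sub>R w \<in> ?A" using feasible_direction[OF F(1) xA r w(2)] by blast
    with xmax[of "x + s *\<^sub>R w"] w(1) show False by (simp add: mult_le_0_iff)
  qed
  define Act where "Act = {p \<in> F. norm (x - p) = r}"
  have "finite Act" using F by (simp add: Act_def)
  have "\<forall>p\<in>Act. \<exists>\<psi>. x - p = r *\<^sub>R dir (\<theta> + \<psi>) \<and> \<bar>\<psi>\<bar> \<le> pi"
  proof
    fix p assume "p \<in> Act"
    then have "norm (inverse r *\<^sub>R (x - p)) = 1" using r by (simp add: Act_def)
    then obtain t where t: "inverse r *\<^sub>R (x - p) = dir t" "\<theta> - pi \<le> t" "t < (\<theta> - pi) + 2 * pi"
      by (rule unit_vector_eq_dir)
    have "x - p = r *\<^sub>R (inverse r *\<^sub>R (x - p))" using r by simp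
    then have "x - p = r *\<^sub>R dir t" unfolding t(1) .
    then show "\<exists>\<psi>. x - p = r *\<^sub>R dir (\<theta> + \<psi>) \<and> \<bar>\<psi>\<bar> \<le> pi"
      using t by (intro exI[of _ "t - \<theta>"]) auto
  qed
  then obtain \<psi> where \<psi>: "\<And>p. p \<in> Act \<Longrightarrow> x - p = r *\<^sub>R dir (\<theta> + \<psi> p)" "\<And>p. p \<in> Act \<Longrightarrow> \<bar>\<psi> p\<bar> \<le> pi"
    by metis
  have \<psi>a: "a < \<bar>\<psi> p\<bar>" if "p \<in> Act" for p
  proof (rule ccontr)
    assume "\<not> a < \<bar>\<psi> p\<bar>"
    moreover have "p + r *\<^sub>R dir (\<theta> + \<psi> p) \<in> ?A" using \<psi>(1)[OF that, symmetric] xA by simp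
    ultimately show False using far that by (force simp: a_def Act_def)
  qed
  have "Act \<noteq> {}"
  proof
    assume "Act = {}"
    then show False using no_feasible[of "dir \<theta>"] by (auto simp: Act_def dir_inner)
  qed
  define mn where "mn = Min ((\<lambda>p. \<bar>\<psi> p\<bar>) ` Act)"
  have "mn \<in> (\<lambda>p. \<bar>\<psi> p\<bar>) ` Act" unfolding mn_def using \<open>finite Act\<close> \<open>Act \<noteq> {}\<close> by (intro Min_in) auto
  then obtain p where p: "p \<in> Act" "mn = \<bar>\<psi> p\<bar>" by blast
  have pmin: "\<bar>\<psi> p\<bar> \<le> \<bar>\<psi> q\<bar>" if "q \<in> Act" for q
    using that \<open>finite Act\<close> unfolding p(2)[symmetric] mn_def by (intro Min_le) auto
  \<comment> \<open>a reflection in the line of direction \<open>\<theta>\<close> makes the angle of \<open>p\<close> positive\<close>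
  obtain \<sigma> :: real where \<sigma>: "\<sigma> = 1 \<or> \<sigma> = -1" "\<psi> p = \<sigma> * \<bar>\<psi> p\<bar>"
    by (metis abs_if mult_1 mult_minus1 minus_minus)
  define \<phi> where "\<phi> = \<bar>\<psi> p\<bar>"
  have \<phi>: "a < \<phi>" "\<phi> \<le> pi" using \<psi>a[OF p(1)] \<psi>(2)[OF p(1)] by (auto simp: \<phi>_def)
  \<comment> \<open>the component of \<open>dir \<theta>\<close> orthogonal to the closest normal\<close>
  define w0 where "w0 = dir \<theta> - cos \<phi> *\<^sub>R dir (\<theta> + \<psi> p)"
  have w0_neg: "w0 \<bullet> dir (\<theta> + \<psi> q) \<le> 0" if q: "q \<in> Act" for q
  proof -
    define \<omega> where "\<omega> = \<sigma> * \<psi> q"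
    have \<omega>: "\<phi> \<le> \<bar>\<omega>\<bar>" "\<bar>\<omega>\<bar> \<le> pi" using pmin[OF q] \<psi>(2)[OF q] \<sigma>(1) by (auto simp: \<omega>_def \<phi>_def)
    have "w0 \<bullet> dir (\<theta> + \<psi> q) = cos (\<psi> q) - cos \<phi> * cos (\<psi> q - \<psi> p)"
      by (simp add: w0_def inner_diff_left dir_inner cos_diff cos_add algebra_simps)
    also have "cos (\<psi> q) = cos \<omega>" using \<sigma>(1) by (auto simp: \<omega>_def)
    also have "cos (\<psi> q - \<psi> p) = cos (\<omega> - \<phi>)"
    proof -
      have "\<psi> q - \<psi> p = \<omega> - \<phi> \<or> \<psi> q - \<psi> p = - (\<omega> - \<phi>)" using \<sigma> by (auto simp: \<omega>_def \<phi>_def)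
      then show ?thesis by (metis cos_minus)
    qed
    also have "cos \<omega> - cos \<phi> * cos (\<omega> - \<phi>) = - (sin (\<omega> - \<phi>) * sin \<phi>)"
      using cos_add[of "\<omega> - \<phi>" \<phi>] by simp
    also have "\<dots> \<le> 0"
    proof -
      have "sin \<phi> \<ge> 0" using \<phi> a by (intro sin_ge_zero) auto
      moreover have "sin (\<omega> - \<phi>) \<ge> 0"
      proof (cases "\<omega> \<ge> 0")
        case True
        then show ?thesis using \<omega> \<phi> a by (intro sin_ge_zero) auto
      next
        case False
        have "norm (p - q) = r * norm (dir (\<theta> + \<psi> q) - dir (\<theta> + \<psi> p))"
        proof -
          have "p - q = r *\<^sub>R (dir (\<theta> + \<psi> q) - dir (\<theta> + \<psi> p))"
            unfolding scaleR_diff_right \<psi>(1)[OF p(1), symmetric] \<psi>(1)[OF q, symmetric] by simp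
          then show ?thesis using r by (metis abs_of_pos norm_scaleR)
        qed
        also have "\<dots> = 2 * r * \<bar>sin ((\<psi> q - \<psi> p) / 2)\<bar>" by (simp add: norm_dir_diff)
        finally have "\<bar>sin ((\<psi> q - \<psi> p) / 2)\<bar> \<le> sin a"
          using lam(3)[of p q] p(1) q r unfolding a(3) by (simp add: Act_def field_simps)
        moreover have "\<bar>sin ((\<psi> q - \<psi> p) / 2)\<bar> = \<bar>sin ((\<phi> - \<omega>) / 2)\<bar>"
        proof -
          have "\<psi> q - \<psi> p = \<phi> - \<omega> \<or> \<psi> q - \<psi> p = - (\<phi> - \<omega>)"
            using \<sigma> by (auto simp: \<omega>_def \<phi>_def)
          then show ?thesis
          proof
            assume eq: "\<psi> q - \<psi> p = - (\<phi> - \<omega>)"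
            have half: "- (\<phi> - \<omega>) / 2 = - ((\<phi> - \<omega>) / 2)"
              by (rule minus_divide_left[symmetric])
            show ?thesis unfolding eq half sin_minus by simp
          qed (simp only:)
        qed
        ultimately have "sin (\<phi> - \<omega>) \<le> 0"
          using False \<omega> \<phi> a by (intro sin_nonpos_of_half_chord[of a]) auto
        then show ?thesis using sin_minus[of "\<phi> - \<omega>"] by simp
      qed
      ultimately show ?thesis by simp
    qed
    finally show ?thesis .
  qed
  \<comment> \<open>if even the closest normal is opposite to \<open>\<theta>\<close>, then \<open>w0\<close> vanishes and \<open>dir \<theta>\<close> itself is feasible\<close>
  show False
  proof (cases "\<phi> = pi")
    case True
    have "dir \<theta> \<bullet> (x - q) < 0" if "q \<in> F" "norm (x - q) = r" for q
    proof -
      have q: "q \<in> Act" using that by (simp add: Act_def)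
      then have "\<bar>\<psi> q\<bar> = pi" using pmin[OF q] \<psi>(2)[OF q] True by (simp add: \<phi>_def)
      then have "cos (\<psi> q) = -1" by (metis cos_abs_real cos_pi)
      then show ?thesis unfolding \<psi>(1)[OF q] using r by (simp add: dir_inner)
    qed
    then show False using no_feasible[of "dir \<theta>"] by (simp add: dir_inner)
  next
    case False
    then have "sin \<phi> > 0" using \<phi> a by (intro sin_gt_zero) auto
    have w0_pos: "dir \<theta> \<bullet> w0 = (sin \<phi>)\<^sup>2"
    proof -
      have "cos (\<psi> p) = cos \<phi>" by (simp add: \<phi>_def)
      then have "dir \<theta> \<bullet> w0 = 1 - (cos \<phi>)\<^sup>2"
        by (simp add: w0_def inner_diff_right dir_inner power2_eq_square)
      then show ?thesis by (simp only: sin_squared_eq)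
    qed
    obtain z0 where z0: "z0 \<in> ?A" "z0 \<noteq> x" using c by metis
    define z where "z = z0 - x"
    have z_neg: "z \<bullet> (x - q) < 0" if "q \<in> F" "norm (x - q) = r" for q
    proof -
      have "norm ((x - q) + 1 *\<^sub>R z) \<le> r" using z0(1) that(1) by (simp add: z_def mem_ball_polytope)
      then have "(norm ((x - q) + 1 *\<^sub>R z))\<^sup>2 \<le> r\<^sup>2" by (intro power_mono) auto
      then have "2 * (z \<bullet> (x - q)) + (norm z)\<^sup>2 \<le> 0" unfolding norm_plus_scaled_sq using that by simp
      moreover have "(norm z)\<^sup>2 > 0" using z0 by (simp add: z_def)
      ultimately show ?thesis by linarith
    qed
    \<comment> \<open>small enough to keep the gain in direction \<open>\<theta>\<close> positive\<close>
    define \<eta> where "\<eta> = (sin \<phi>)\<^sup>2 / (2 * (\<bar>dir \<theta> \<bullet> z\<bar> + 1))"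
    have \<eta>: "\<eta> > 0" using \<open>sin \<phi> > 0\<close> by (simp add: \<eta>_def)
    have "\<eta> * \<bar>dir \<theta> \<bullet> z\<bar> < (sin \<phi>)\<^sup>2"
    proof -
      have "\<eta> * \<bar>dir \<theta> \<bullet> z\<bar> \<le> \<eta> * (\<bar>dir \<theta> \<bullet> z\<bar> + 1)" using \<eta> by (intro mult_left_mono) auto
      also have "\<dots> = (sin \<phi>)\<^sup>2 / 2" by (simp add: \<eta>_def field_simps)
      finally show ?thesis using \<open>sin \<phi> > 0\<close> by (smt (verit) field_sum_of_halves zero_less_power)
    qed
    then have "- (\<eta> * (dir \<theta> \<bullet> z)) < (sin \<phi>)\<^sup>2"
      using \<eta> by (smt (verit) mult_left_mono mult_minus_right)
    then have "dir \<theta> \<bullet> (w0 + \<eta> *\<^sub>R z) > 0" by (simp add: inner_add_right w0_pos)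
    moreover have "(w0 + \<eta> *\<^sub>R z) \<bullet> (x - q) < 0" if "q \<in> F" "norm (x - q) = r" for q
    proof -
      have q: "q \<in> Act" using that by (simp add: Act_def)
      have "w0 \<bullet> (x - q) \<le> 0" unfolding \<psi>(1)[OF q] using w0_neg[OF q] r by (simp add: mult_nonneg_nonpos)
      moreover have "\<eta> * (z \<bullet> (x - q)) < 0" using z_neg[OF that] \<eta> by (simp add: mult_pos_neg)
      ultimately show ?thesis by (simp add: inner_add_left)
    qed
    ultimately show False by (rule no_feasible)
  qed
qed

lemma V1_lower_bound:
  fixes F :: "(real ^ 2) set"
  assumes F: "finite F" "card F \<ge> 2" and r: "r > 0"
    and c: "c \<in> ball_polytope F r" "c' \<in> ball_polytope F r" "c \<noteq> c'"
    and lam: "0 \<le> lam" "lam \<le> 2 * r" "\<And>p q. p \<in> F \<Longrightarrow> q \<in> F \<Longrightarrow> norm (p - q) \<le> lam"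
  shows "pi * r - r * real (card F) * arcsin (lam / (2 * r)) \<le> V1 (ball_polytope F r)"
proof -
  let ?A = "ball_polytope F r"
  define a where "a = arcsin (lam / (2 * r))"
  have a: "0 \<le> a"
    using lam r arcsin_le_arcsin[of 0 "lam / (2 * r)"] by (auto simp: a_def)
  have other: "\<exists>q\<in>F. q \<noteq> p" for p
  proof (rule ccontr)
    assume "\<not> ?thesis"
    then have "F \<subseteq> {p}" by blast
    then have "card F \<le> card {p}" by (intro card_mono) auto
    with F(2) show False by simp
  qed
  then have neF: "F \<noteq> {}" by blast
  define E where "E = {p \<in> F. \<exists>t. p + r *\<^sub>R dir t \<in> ?A}"
  have "E \<subseteq> F" "finite E" using F by (auto simp: E_def)
  have "\<forall>p\<in>E. \<exists>\<alpha> \<beta>. \<alpha> \<le> \<beta> \<and> \<beta> - \<alpha> \<le> pi \<and> smooth_cone F r p = sector \<alpha> \<beta>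
      \<and> (\<forall>t. p + r *\<^sub>R dir t \<in> ?A \<longrightarrow> (\<exists>u. \<alpha> \<le> u \<and> u \<le> \<beta> \<and> dir t = dir u))"
  proof
    fix p assume "p \<in> E"
    then obtain t q where "p + r *\<^sub>R dir t \<in> ?A" "q \<in> F" "q \<noteq> p" using other E_def by blast
    then show "\<exists>\<alpha> \<beta>. \<alpha> \<le> \<beta> \<and> \<beta> - \<alpha> \<le> pi \<and> smooth_cone F r p = sector \<alpha> \<beta>
      \<and> (\<forall>t. p + r *\<^sub>R dir t \<in> ?A \<longrightarrow> (\<exists>u. \<alpha> \<le> u \<and> u \<le> \<beta> \<and> dir t = dir u))"
      using smooth_cone_arc[OF r] by metis
  qed
  then obtain \<alpha> \<beta> where ab: "\<And>p. p \<in> E \<Longrightarrow> \<alpha> p \<le> \<beta> p" "\<And>p. p \<in> E \<Longrightarrow> \<beta> p - \<alpha> p \<le> pi"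
    "\<And>p. p \<in> E \<Longrightarrow> smooth_cone F r p = sector (\<alpha> p) (\<beta> p)"
    "\<And>p t. p \<in> E \<Longrightarrow> p + r *\<^sub>R dir t \<in> ?A \<Longrightarrow> \<exists>u. \<alpha> p \<le> u \<and> u \<le> \<beta> p \<and> dir t = dir u"
    by metis
  have cover: "cball 0 1 - {0} \<subseteq> (\<Union>p\<in>E. sector (\<alpha> p - a) (\<beta> p + a))"
  proof
    fix y :: "real ^ 2" assume y: "y \<in> cball 0 1 - {0}"
    then have "norm (inverse (norm y) *\<^sub>R y) = 1" by simp
    then obtain \<theta> where \<theta>: "inverse (norm y) *\<^sub>R y = dir \<theta>" by (rule unit_vector_eq_dir[where c = 0])
    have "y = norm y *\<^sub>R (inverse (norm y) *\<^sub>R y)" using y by simp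
    then have ydir: "y = norm y *\<^sub>R dir \<theta>" unfolding \<theta> .
    obtain p t where p: "p \<in> F" "p + r *\<^sub>R dir t \<in> ?A" "\<bar>t - \<theta>\<bar> \<le> a"
      using normal_within_angle[OF F(1) neF r c lam] unfolding a_def by blast
    then have pE: "p \<in> E" by (auto simp: E_def)
    obtain u where u: "\<alpha> p \<le> u" "u \<le> \<beta> p" "dir u = dir t" using ab(4)[OF pE p(2)] by metis
    obtain k :: int where k: "u = t + 2 * pi * of_int k" using u(3) unfolding dir_eq_iff by blast
    have "dir (\<theta> + 2 * pi * of_int k) = dir \<theta>" unfolding dir_eq_iff by blast
    then have "y = norm y *\<^sub>R dir (\<theta> + 2 * pi * of_int k)" using ydir by (simp only:)
    moreover have "\<alpha> p - a \<le> \<theta> + 2 * pi * of_int k" "\<theta> + 2 * pi * of_int k \<le> \<beta> p + a"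
      using u p(3) k by linarith+
    ultimately have "y \<in> sector (\<alpha> p - a) (\<beta> p + a)" using y unfolding mem_sector by auto
    then show "y \<in> (\<Union>p\<in>E. sector (\<alpha> p - a) (\<beta> p + a))" using pE by blast
  qed
  have "pi = measure lebesgue (sector 0 (0 + 2 * pi))" by (rule measure_sector_full[symmetric])
  also have "\<dots> \<le> measure lebesgue (\<Union>p\<in>E. sector (\<alpha> p - a) (\<beta> p + a))"
  proof (rule measure_mono_fmeasurable)
    show "sector 0 (0 + 2 * pi) \<subseteq> (\<Union>p\<in>E. sector (\<alpha> p - a) (\<beta> p + a))"
      using cover unfolding sector_full .
  qed (auto intro!: fmeasurable.finite_UN fmeasurableD lmeasurable_sector \<open>finite E\<close>)
  also have "\<dots> \<le> (\<Sum>p\<in>E. measure lebesgue (sector (\<alpha> p - a) (\<beta> p + a)))"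
    by (intro measure_UNION_le \<open>finite E\<close> fmeasurableD lmeasurable_sector)
  also have "\<dots> \<le> (\<Sum>p\<in>E. measure lebesgue (smooth_cone F r p) + a)"
  proof (rule sum_mono)
    fix p assume p: "p \<in> E"
    have "measure lebesgue (sector (\<alpha> p - a) (\<beta> p + a)) \<le> ((\<beta> p + a) - (\<alpha> p - a)) / 2"
      using ab(1)[OF p] a by (intro measure_sector_le) auto
    moreover have "measure lebesgue (smooth_cone F r p) = (\<beta> p - \<alpha> p) / 2"
      using ab(1-3)[OF p] by (simp add: measure_sector)
    ultimately show "measure lebesgue (sector (\<alpha> p - a) (\<beta> p + a)) \<le> measure lebesgue (smooth_cone F r p) + a"
      by (simp add: field_simps)
  qed
  also have "\<dots> = (\<Sum>p\<in>E. measure lebesgue (smooth_cone F r p)) + real (card E) * a"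
    by (simp add: sum.distrib)
  also have "\<dots> \<le> (\<Sum>p\<in>F. measure lebesgue (smooth_cone F r p)) + real (card F) * a"
    using \<open>E \<subseteq> F\<close> F a by (intro add_mono sum_mono2 mult_right_mono) (auto simp: card_mono)
  finally have "r * pi \<le> r * ((\<Sum>p\<in>F. measure lebesgue (smooth_cone F r p)) + real (card F) * a)"
    using r by (intro mult_left_mono) auto
  moreover have "?A \<noteq> {}" using c by blast
  ultimately show ?thesis
    using V1_ball_polytope[OF F(1) neF r] by (simp add: a_def algebra_simps)
qed

section \<open>Jung's theorem in the plane\<close>

lemma norm_sq_unit_frame:
  assumes "norm d = 1"
  shows "(norm v)\<^sup>2 = (v \<bullet> d)\<^sup>2 + (v \<bullet> perp d)\<^sup>2"
  using norm_sq_perp[of d v] assms by simp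

lemma unit_frame_inner:
  assumes "norm d = 1"
  shows "d \<bullet> d = 1" "perp d \<bullet> perp d = 1"
  using assms by (auto simp: dot_square_norm)

lemma segment_frame:
  fixes p q :: "real ^ 2"
  assumes "p \<noteq> q"
  obtains m d e where "norm d = 1" "e > 0" "p = m - e *\<^sub>R d" "q = m + e *\<^sub>R d" "norm (p - q) = 2 * e"
proof -
  define e where "e = norm (p - q) / 2"
  define m where "m = (1/2) *\<^sub>R (p + q)"
  define d where "d = (1 / (2 * e)) *\<^sub>R (q - p)"
  have e: "e > 0" using assms by (simp add: e_def)
  have "e *\<^sub>R d = (1/2) *\<^sub>R (q - p)" using e by (simp add: d_def)
  then have pq: "p = m - e *\<^sub>R d" "q = m + e *\<^sub>R d"
    by (simp_all add: m_def vec_eq_iff field_simps)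
  have "norm d = 1" using e by (simp add: d_def e_def norm_minus_commute)
  moreover have "norm (p - q) = 2 * e" by (simp add: e_def)
  ultimately show ?thesis using e pq that by blast
qed

text \<open>The case of a triangle with longest side from \<open>(-e, 0)\<close> to \<open>(e, 0)\<close> and third vertex \<open>(s, t)\<close>: the
centroid \<open>(0, e/\<surd>3)\<close> of the equilateral triangle on that side is close enough to all vertices. The
third vertex is either inside the equilateral triangle or beyond its lateral sides, where the bound
on its distance to the farther endpoint decides.\<close>

lemma Jung_inequality:
  fixes s t e :: real
  assumes "0 \<le> t" "0 \<le> e" "(s + e)\<^sup>2 + t\<^sup>2 \<le> 4 * e\<^sup>2" "(s - e)\<^sup>2 + t\<^sup>2 \<le> 4 * e\<^sup>2"
  shows "s\<^sup>2 + (t - e / sqrt 3)\<^sup>2 \<le> 4 * e\<^sup>2 / 3"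
proof -
  define k where "k = 1 / sqrt (3::real)"
  have k: "3 * k\<^sup>2 = 1" "k > 0" by (auto simp: k_def power_divide)
  define S where "S = \<bar>s\<bar>"
  have S: "S \<ge> 0" "S\<^sup>2 = s\<^sup>2" by (auto simp: S_def)
  have st: "S\<^sup>2 + t\<^sup>2 \<le> 3 * e\<^sup>2 - 2 * e * S"
    using assms(3,4) by (cases "s \<ge> 0") (auto simp: S_def power2_eq_square algebra_simps)
  have "S\<^sup>2 + t\<^sup>2 - 2 * t * e * k \<le> e\<^sup>2"
  proof (cases "S + t * k \<ge> e")
    case True
    have "2 * e * (S + t * k) \<ge> 2 * e * e" using True assms(2) by (intro mult_left_mono) auto
    then show ?thesis using st by (simp add: power2_eq_square algebra_simps)
  next
    case False
    then have "S\<^sup>2 \<le> (e - t * k)\<^sup>2" using S by (intro power_mono) auto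
    moreover have "0 \<le> t * k * (e - t * k)" using False S assms k by (intro mult_nonneg_nonneg) auto
    moreover have "t\<^sup>2 = 3 * (t * k)\<^sup>2" using k by (simp add: power_mult_distrib)
    moreover have "(e - t * k)\<^sup>2 = e\<^sup>2 - 2 * t * e * k + (t * k)\<^sup>2"
      and "t * k * (e - t * k) = t * e * k - (t * k)\<^sup>2"
      by (simp_all add: power2_eq_square algebra_simps)
    ultimately show ?thesis by linarith
  qed
  moreover have "(t - e / sqrt 3)\<^sup>2 = t\<^sup>2 - 2 * t * e * k + e\<^sup>2 / 3"
  proof -
    have "(t - e * k)\<^sup>2 = t\<^sup>2 - 2 * t * e * k + e\<^sup>2 * k\<^sup>2" by (simp add: power2_eq_square algebra_simps)
    moreover have "k\<^sup>2 = 1 / 3" using k by simp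
    ultimately show ?thesis by (simp add: k_def)
  qed
  ultimately show ?thesis using S by simp
qed

lemma Jung_triangle_longest:
  fixes x y z :: "real ^ 2"
  assumes "norm (x - z) \<le> norm (x - y)" "norm (y - z) \<le> norm (x - y)"
  shows "\<exists>c. norm (x - c) \<le> norm (x - y) / sqrt 3 \<and> norm (y - c) \<le> norm (x - y) / sqrt 3
    \<and> norm (z - c) \<le> norm (x - y) / sqrt 3"
proof (cases "x = y")
  case True
  then show ?thesis using assms by (intro exI[of _ x]) auto
next
  case False
  obtain m d0 e where d0: "norm d0 = 1" and e: "e > 0" and xm: "x = m - e *\<^sub>R d0" "y = m + e *\<^sub>R d0"
    and e2: "norm (x - y) = 2 * e"
    by (rule segment_frame[OF False])
  define \<sigma> :: real where "\<sigma> = (if (z - m) \<bullet> perp d0 \<ge> 0 then 1 else -1)"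
  define s where "s = (z - m) \<bullet> d0"
  define t where "t = \<sigma> * ((z - m) \<bullet> perp d0)"
  have \<sigma>2: "\<sigma> * \<sigma> = 1" "\<sigma>\<^sup>2 = 1" by (auto simp: \<sigma>_def)
  have t: "t \<ge> 0" by (auto simp: t_def \<sigma>_def)
  have t2: "((z - m) \<bullet> perp d0)\<^sup>2 = t\<^sup>2" by (simp add: t_def power_mult_distrib \<sigma>2)
  have sq: "(norm (x - y))\<^sup>2 = 4 * e\<^sup>2" by (simp add: e2 power_mult_distrib)
  note fr = unit_frame_inner[OF d0]
  have zx: "(norm (x - z))\<^sup>2 = (s + e)\<^sup>2 + t\<^sup>2"
  proof -
    have "x - z = - ((z - m) + e *\<^sub>R d0)" by (simp add: xm)
    then have "(norm (x - z))\<^sup>2 = (norm ((z - m) + e *\<^sub>R d0))\<^sup>2" by (metis norm_minus_cancel)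
    then show ?thesis by (simp add: norm_sq_unit_frame[OF d0] inner_add_left fr s_def t2)
  qed
  have zy: "(norm (y - z))\<^sup>2 = (s - e)\<^sup>2 + t\<^sup>2"
  proof -
    have "y - z = - ((z - m) - e *\<^sub>R d0)" by (simp add: xm)
    then have "(norm (y - z))\<^sup>2 = (norm ((z - m) - e *\<^sub>R d0))\<^sup>2" by (metis norm_minus_cancel)
    moreover have "((z - m) - e *\<^sub>R d0) \<bullet> d0 = s - e"
      and "((z - m) - e *\<^sub>R d0) \<bullet> perp d0 = (z - m) \<bullet> perp d0"
      by (simp_all add: inner_diff_left fr s_def)
    ultimately show ?thesis by (simp only: norm_sq_unit_frame[OF d0] t2)
  qed
  have le: "(s + e)\<^sup>2 + t\<^sup>2 \<le> 4 * e\<^sup>2" "(s - e)\<^sup>2 + t\<^sup>2 \<le> 4 * e\<^sup>2"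
    using assms power_mono[of "norm (x - z)" "norm (x - y)" 2] power_mono[of "norm (y - z)" "norm (x - y)" 2]
    unfolding zx zy sq by auto
  define c where "c = m + (\<sigma> * (e / sqrt 3)) *\<^sub>R perp d0"
  have R2: "(norm (x - y) / sqrt 3)\<^sup>2 = 4 * e\<^sup>2 / 3" by (simp add: power_divide sq)
  have "(norm (x - c))\<^sup>2 = 4 * e\<^sup>2 / 3"
    by (simp add: norm_sq_unit_frame[OF d0] c_def xm inner_diff_left inner_add_left fr power_mult_distrib
        power_divide \<sigma>2)
  moreover have "(norm (y - c))\<^sup>2 = 4 * e\<^sup>2 / 3"
    by (simp add: norm_sq_unit_frame[OF d0] c_def xm inner_diff_left inner_add_left fr power_mult_distrib
        power_divide \<sigma>2)
  moreover have "(norm (z - c))\<^sup>2 \<le> 4 * e\<^sup>2 / 3"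
  proof -
    have zc: "z - c = (z - m) - (\<sigma> * (e / sqrt 3)) *\<^sub>R perp d0" by (simp add: c_def)
    have "(z - c) \<bullet> perp d0 = \<sigma> * (t - e / sqrt 3)"
      unfolding zc by (simp add: inner_diff_left fr t_def right_diff_distrib \<sigma>2 flip: mult.assoc)
    then have "((z - c) \<bullet> perp d0)\<^sup>2 = (t - e / sqrt 3)\<^sup>2" by (simp add: power_mult_distrib \<sigma>2)
    moreover have "(z - c) \<bullet> d0 = s" unfolding zc by (simp add: inner_diff_left s_def)
    ultimately show ?thesis
      using Jung_inequality[OF t _ le] e by (simp add: norm_sq_unit_frame[OF d0])
  qed
  ultimately show ?thesis unfolding R2[symmetric] by (intro exI[of _ c]) (auto intro: power2_le_imp_le)
qed

lemma Jung_triangle: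
  fixes x y z :: "real ^ 2"
  assumes "norm (x - y) \<le> L" "norm (x - z) \<le> L" "norm (y - z) \<le> L"
  shows "\<exists>c. norm (x - c) \<le> L / sqrt 3 \<and> norm (y - c) \<le> L / sqrt 3 \<and> norm (z - c) \<le> L / sqrt 3"
proof -
  have mono: "a \<le> M / sqrt 3 \<Longrightarrow> M \<le> L \<Longrightarrow> a \<le> L / sqrt 3" for a M :: real
    by (meson divide_right_mono order_trans real_sqrt_ge_zero zero_le_numeral)
  consider "norm (x - z) \<le> norm (x - y)" "norm (y - z) \<le> norm (x - y)"
    | "norm (x - y) \<le> norm (x - z)" "norm (z - y) \<le> norm (x - z)"
    | "norm (y - x) \<le> norm (y - z)" "norm (z - x) \<le> norm (y - z)"
    using norm_minus_commute[of x y] norm_minus_commute[of x z] norm_minus_commute[of y z] by linarith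
  then show ?thesis
  proof cases
    case 1
    from Jung_triangle_longest[OF this] show ?thesis using assms mono by blast
  next
    case 2
    from Jung_triangle_longest[OF this] show ?thesis using assms mono by blast
  next
    case 3
    from Jung_triangle_longest[OF this] show ?thesis using assms mono by blast
  qed
qed

text \<open>By Helly's theorem the discs of radius \<open>L/\<surd>3\<close> around the points have a common point as soon as
any three of them do.\<close>

lemma Jung_plane:
  fixes F :: "(real ^ 2) set"
  assumes F: "finite F" "F \<noteq> {}" and L: "\<And>p q. p \<in> F \<Longrightarrow> q \<in> F \<Longrightarrow> norm (p - q) \<le> L"
  shows "\<exists>c. \<forall>p\<in>F. norm (p - c) \<le> L / sqrt 3"
proof -
  define B where "B p = cball p (L / sqrt 3)" for p :: "real ^ 2"
  have three: "\<Inter>{B x, B y, B z} \<noteq> {}" if xyz: "x \<in> F" "y \<in> F" "z \<in> F" for x y z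
  proof -
    obtain c where "norm (x - c) \<le> L / sqrt 3" "norm (y - c) \<le> L / sqrt 3" "norm (z - c) \<le> L / sqrt 3"
      using Jung_triangle[OF L L L] xyz by metis
    then have "c \<in> \<Inter>{B x, B y, B z}" by (auto simp: B_def dist_norm)
    then show ?thesis by blast
  qed
  have sub: "\<Inter>T \<noteq> {}" if T: "T \<subseteq> B ` F" "T \<noteq> {}" "card T \<le> 3" for T
  proof -
    have "finite T" using T(1) F(1) finite_subset by blast
    then have "card T \<noteq> 0" using T(2) by simp
    then consider "card T = 1" | "card T = 2" | "card T = 3" using T(3) by linarith
    then obtain S1 S2 S3 where S: "T = {S1, S2, S3}"
      by cases (auto simp: card_1_singleton_iff card_2_iff card_3_iff)
    then obtain x y z where "x \<in> F" "y \<in> F" "z \<in> F" "S1 = B x" "S2 = B y" "S3 = B z" using T(1) by auto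
    then show ?thesis using three S by blast
  qed
  have "\<Inter>(B ` F) \<noteq> {}"
  proof (cases "card (B ` F) \<le> 3")
    case True
    then show ?thesis using F(2) by (intro sub) auto
  next
    case False
    show ?thesis
    proof (rule Helly)
      show "\<Inter>T \<noteq> {}" if "T \<subseteq> B ` F" "card T = DIM(real ^ 2) + 1" for T
        using that by (intro sub) auto
    qed (use False in \<open>auto simp: B_def\<close>)
  qed
  then obtain c where "\<And>p. p \<in> F \<Longrightarrow> c \<in> B p" by blast
  then show ?thesis by (auto simp: B_def dist_norm)
qed

section \<open>Two and three separated centres\<close>

lemma sphere_eq_dir:
  fixes x p :: "real ^ 2"
  assumes "norm (x - p) = r" "r > 0"
  shows "\<exists>t. x = p + r *\<^sub>R dir t"
proof -
  have "norm (inverse r *\<^sub>R (x - p)) = 1" using assms by simp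
  then obtain t where t: "inverse r *\<^sub>R (x - p) = dir t" by (rule unit_vector_eq_dir[where c = 0])
  have "x = p + r *\<^sub>R (inverse r *\<^sub>R (x - p))" using assms by simp
  then show ?thesis unfolding t by blast
qed

lemma norm_diff_le_of_ball_polytope:
  fixes F :: "(real ^ 2) set"
  assumes "ball_polytope F r \<noteq> {}" "p \<in> F" "q \<in> F"
  shows "norm (p - q) \<le> 2 * r"
proof -
  obtain x where "x \<in> ball_polytope F r" using assms by blast
  then have "norm (x - p) \<le> r" "norm (x - q) \<le> r" using assms by (auto simp: mem_ball_polytope)
  then show ?thesis using norm_triangle_ineq4[of "x - q" "x - p"] by simp
qed

lemma arcsin_ge_self:
  fixes x :: real
  assumes "0 \<le> x" "x \<le> 1"
  shows "x \<le> arcsin x"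
proof -
  have "0 \<le> arcsin x" using assms arcsin_le_arcsin[of 0 x] by simp
  then show ?thesis using sin_x_le_x[of "arcsin x"] assms by simp
qed

text \<open>All arcs are widened by the same angle.\<close>

lemma V1_upper_separated:
  fixes F :: "(real ^ 2) set"
  assumes F: "finite F" "card F \<ge> 2" and r: "r > 0"
    and ess: "\<And>p. p \<in> F \<Longrightarrow> \<exists>t. p + r *\<^sub>R dir t \<in> ball_polytope F r"
    and lam: "0 \<le> lam" "\<And>p q. p \<in> F \<Longrightarrow> q \<in> F \<Longrightarrow> p \<noteq> q \<Longrightarrow> lam \<le> norm (p - q)"
  shows "V1 (ball_polytope F r) \<le> pi * r - r * (real (card F) * arcsin (lam / (2 * r)))"
proof -
  have "\<not> card F \<le> Suc 0" using F by simp
  then obtain p0 q0 where pq: "p0 \<in> F" "q0 \<in> F" "p0 \<noteq> q0"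
    unfolding card_le_Suc0_iff_eq[OF F(1)] by blast
  have ne: "ball_polytope F r \<noteq> {}" using ess[OF pq(1)] by blast
  have le1: "norm (p - q) / (2 * r) \<le> 1" if "p \<in> F" "q \<in> F" for p q
    using norm_diff_le_of_ball_polytope[OF ne that] r by simp
  have l1: "0 \<le> lam / (2 * r)" "lam / (2 * r) \<le> 1"
    using lam(1) lam(2)[OF pq] norm_diff_le_of_ball_polytope[OF ne pq(1,2)] r by auto
  define a where "a = arcsin (lam / (2 * r))"
  have a0: "0 \<le> a" using l1 arcsin_le_arcsin[of 0 "lam / (2 * r)"] by (simp add: a_def)
  have a1: "a \<le> pi / 2" unfolding a_def using l1 by (intro arcsin_ubound) auto
  have a2: "a + a \<le> 2 * arcsin (norm (p - q) / (2 * r))" if "p \<in> F" "q \<in> F" "p \<noteq> q" for p q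
  proof -
    have "lam / (2 * r) \<le> norm (p - q) / (2 * r)"
      using lam(2)[OF that] r by (intro divide_right_mono) auto
    then have "a \<le> arcsin (norm (p - q) / (2 * r))"
      unfolding a_def using le1[OF that(1,2)] l1 by (intro arcsin_le_arcsin) auto
    then show ?thesis by simp
  qed
  have "V1 (ball_polytope F r) \<le> pi * r - r * (\<Sum>p\<in>F. a)"
    by (rule V1_upper_bound[OF F r ess a0 a1 a2])
  then show ?thesis by (simp add: a_def)
qed

text \<open>Both centres have a smooth direction, towards an apex of the lens.\<close>

lemma V1_upper_pair:
  fixes p q :: "real ^ 2"
  assumes "p \<noteq> q" "r > 0" "norm (p - q) \<le> 2 * r"
  shows "V1 (ball_polytope {p, q} r) \<le> pi * r - 2 * r * arcsin (norm (p - q) / (2 * r))"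
proof -
  obtain m d e where f: "norm d = 1" "e > 0" "p = m - e *\<^sub>R d" "q = m + e *\<^sub>R d" "norm (p - q) = 2 * e"
    by (rule segment_frame[OF assms(1)])
  note fr = unit_frame_inner[OF f(1)]
  define h where "h = sqrt (r\<^sup>2 - e\<^sup>2)"
  have "e \<le> r" using f assms by simp
  then have h: "h\<^sup>2 = r\<^sup>2 - e\<^sup>2" using f by (simp add: h_def power_mono)
  define b where "b = m + h *\<^sub>R perp d"
  have "b - p = e *\<^sub>R d + h *\<^sub>R perp d" "b - q = (- e) *\<^sub>R d + h *\<^sub>R perp d"
    by (simp_all add: b_def f)
  then have "(norm (b - p))\<^sup>2 = r\<^sup>2" "(norm (b - q))\<^sup>2 = r\<^sup>2"
    by (simp_all only: norm_sq_unit_frame[OF f(1)] inner_add_left inner_scaleR_left fr perp_inner) (simp_all add: h)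
  then have b: "norm (b - p) = r" "norm (b - q) = r" using assms(2) by (auto simp: power2_eq_iff_nonneg)
  then have "b \<in> ball_polytope {p, q} r" by (simp add: mem_ball_polytope)
  then have "\<exists>t. x + r *\<^sub>R dir t \<in> ball_polytope {p, q} r" if "x \<in> {p, q}" for x
    using that sphere_eq_dir[OF b(1) assms(2)] sphere_eq_dir[OF b(2) assms(2)] by auto
  then have "V1 (ball_polytope {p, q} r)
      \<le> pi * r - r * (real (card {p, q}) * arcsin (norm (p - q) / (2 * r)))"
    using assms by (intro V1_upper_separated) (auto simp: norm_minus_commute)
  then show ?thesis using assms(1) by simp
qed

lemma V1_upper_of_pair:
  fixes F :: "(real ^ 2) set"
  assumes "finite F" "r > 0" "ball_polytope F r \<noteq> {}" "p \<in> F" "q \<in> F" "p \<noteq> q"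
  shows "V1 (ball_polytope F r) \<le> pi * r - 2 * r * arcsin (norm (p - q) / (2 * r))"
    and "V1 (ball_polytope F r) \<le> pi * r - norm (p - q)"
proof -
  have d: "norm (p - q) \<le> 2 * r" by (rule norm_diff_le_of_ball_polytope[OF assms(3-5)])
  have "V1 (ball_polytope F r) \<le> V1 (ball_polytope {p, q} r)"
    using assms by (intro V1_ball_polytope_antimono) auto
  also have "\<dots> \<le> pi * r - 2 * r * arcsin (norm (p - q) / (2 * r))"
    by (rule V1_upper_pair[OF assms(6,2) d])
  finally show 1: "V1 (ball_polytope F r) \<le> pi * r - 2 * r * arcsin (norm (p - q) / (2 * r))" .
  have "norm (p - q) / (2 * r) \<le> arcsin (norm (p - q) / (2 * r))"
    using d assms(2) by (intro arcsin_ge_self) auto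
  then have "2 * r * (norm (p - q) / (2 * r)) \<le> 2 * r * arcsin (norm (p - q) / (2 * r))"
    using assms(2) by (intro mult_left_mono) auto
  then show "V1 (ball_polytope F r) \<le> pi * r - norm (p - q)" using 1 assms(2) by simp
qed

text \<open>If \<open>z\<close> has no smooth direction, then by connectedness the lens of \<open>p\<close> and \<open>q\<close> is inside the open
disc around \<open>z\<close>; in particular both apexes of the lens are. In coordinates with \<open>p\<close>, \<open>q\<close> at
\<open>(-e, 0)\<close>, \<open>(e, 0)\<close> and apexes \<open>(0, -h)\<close>, \<open>(0, h)\<close> this confines \<open>z = (s, t)\<close> to \<open>|s| \<le> e\<close>,
\<open>|t| < r - h\<close>, so its distance to the nearer one of \<open>p\<close>, \<open>q\<close> is at most that of \<open>(0, r - h)\<close>.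
The segment from \<open>p\<close> to \<open>(0, r - h)\<close> is seen from the apex \<open>(0, -h)\<close> under half of the angle under
which \<open>p q\<close> is seen.\<close>

lemma arcsin_pair_of_inessential:
  fixes p q z :: "real ^ 2"
  assumes r: "r > 0" and pq: "p \<noteq> q" and lam: "0 \<le> lam" "lam \<le> norm (z - p)" "lam \<le> norm (z - q)"
    and c: "c \<in> ball_polytope {p, q, z} r"
    and iness: "\<not> (\<exists>t. z + r *\<^sub>R dir t \<in> ball_polytope {p, q, z} r)"
  shows "2 * arcsin (lam / (2 * r)) \<le> arcsin (norm (p - q) / (2 * r))"
proof -
  let ?L = "ball_polytope {p, q} r"
  have inside: "norm (b - z) < r" if b: "b \<in> ?L" for b
  proof (rule ccontr)
    assume "\<not> ?thesis"
    then have ge: "r \<le> norm (b - z)" by simp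
    have cL: "c \<in> ?L" "norm (c - z) \<le> r" using c by (auto simp: mem_ball_polytope)
    have "connected ((\<lambda>x. norm (x - z)) ` ?L)"
      by (intro connected_continuous_image continuous_intros convex_connected convex_ball_polytope)
    then have "r \<in> (\<lambda>x. norm (x - z)) ` ?L"
      by (rule connectedD_interval[of _ "norm (c - z)" "norm (b - z)"]) (use cL b ge in auto)
    then obtain x where x: "x \<in> ?L" "norm (x - z) = r" by auto
    then have "x \<in> ball_polytope {p, q, z} r" by (auto simp: mem_ball_polytope)
    then show False using iness sphere_eq_dir[OF x(2) r] by auto
  qed
  obtain m d e where f: "norm d = 1" "e > 0" "p = m - e *\<^sub>R d" "q = m + e *\<^sub>R d" "norm (p - q) = 2 * e"
    by (rule segment_frame[OF pq])
  note fr = unit_frame_inner[OF f(1)]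
  have "norm (p - q) \<le> 2 * r" using c by (intro norm_diff_le_of_ball_polytope[of "{p, q, z}"]) auto
  then have er: "e \<le> r" using f by simp
  define h where "h = sqrt (r\<^sup>2 - e\<^sup>2)"
  have h: "h\<^sup>2 = r\<^sup>2 - e\<^sup>2" "h \<ge> 0" using er f by (auto simp: h_def power_mono)
  \<comment> \<open>coordinates of \<open>z\<close> with respect to the midpoint of \<open>p\<close> and \<open>q\<close>\<close>
  define s t where "s = (z - m) \<bullet> d" and "t = (z - m) \<bullet> perp d"
  have apex: "s\<^sup>2 + (t - k)\<^sup>2 < r\<^sup>2" if k: "k\<^sup>2 = h\<^sup>2" for k
  proof -
    define b where "b = m + k *\<^sub>R perp d"
    have "b - p = e *\<^sub>R d + k *\<^sub>R perp d" "b - q = (- e) *\<^sub>R d + k *\<^sub>R perp d"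
      by (simp_all add: b_def f)
    then have "(norm (b - p))\<^sup>2 = r\<^sup>2" "(norm (b - q))\<^sup>2 = r\<^sup>2"
      by (simp_all only: norm_sq_unit_frame[OF f(1)] inner_add_left inner_scaleR_left fr perp_inner)
        (simp_all add: k h)
    then have "norm (b - p) = r" "norm (b - q) = r" using r by (auto simp: power2_eq_iff_nonneg)
    then have "norm (b - z) < r" by (intro inside) (simp add: mem_ball_polytope)
    then have "(norm (z - b))\<^sup>2 < r\<^sup>2" by (simp add: norm_minus_commute power_strict_mono)
    moreover have "(z - b) \<bullet> d = s" "(z - b) \<bullet> perp d = t - k"
      by (simp_all add: b_def s_def t_def inner_diff_left inner_add_left fr)
    ultimately show ?thesis by (simp add: norm_sq_unit_frame[OF f(1)])
  qed
  define T S where "T = \<bar>t\<bar>" and "S = \<bar>s\<bar>"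
  have TS: "T \<ge> 0" "S \<ge> 0" "T\<^sup>2 = t\<^sup>2" "S\<^sup>2 = s\<^sup>2" by (auto simp: T_def S_def)
  have "S\<^sup>2 + (T + h)\<^sup>2 < r\<^sup>2"
  proof (cases "t \<ge> 0")
    case True
    then show ?thesis using apex[of "- h"] by (simp add: T_def S_def)
  next
    case False
    have "(t - h)\<^sup>2 = (T + h)\<^sup>2" using False by (simp add: T_def power2_eq_square algebra_simps)
    then show ?thesis using apex[of h] TS by simp
  qed
  moreover have "T\<^sup>2 + h\<^sup>2 \<le> (T + h)\<^sup>2" "h\<^sup>2 \<le> (T + h)\<^sup>2"
    using TS h by (auto simp: power2_eq_square algebra_simps)
  ultimately have Se: "S\<^sup>2 \<le> e\<^sup>2" and "(T + h)\<^sup>2 < r\<^sup>2" using h zero_le_power2[of S] by linarith+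
  then have "S \<le> e" "T + h < r"
    using f(2) r power2_le_imp_le[of S e] power2_less_imp_less[of "T + h" r] by auto
  then have "(e - S)\<^sup>2 \<le> e\<^sup>2" "T\<^sup>2 \<le> (r - h)\<^sup>2"
    using TS(1,2) by (auto intro!: power_mono)
  moreover have "lam\<^sup>2 \<le> (e - S)\<^sup>2 + T\<^sup>2"
  proof -
    have zp: "(z - p) \<bullet> d = s + e" "(z - p) \<bullet> perp d = t" and zq: "(z - q) \<bullet> d = s - e" "(z - q) \<bullet> perp d = t"
      by (simp_all add: f(3,4) s_def t_def inner_diff_left inner_add_left fr)
    have "lam\<^sup>2 \<le> (norm (z - p))\<^sup>2" "lam\<^sup>2 \<le> (norm (z - q))\<^sup>2" using lam by (auto intro!: power_mono)
    then have "lam\<^sup>2 \<le> (s + e)\<^sup>2 + t\<^sup>2" "lam\<^sup>2 \<le> (s - e)\<^sup>2 + t\<^sup>2"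
      unfolding norm_sq_unit_frame[OF f(1)] zp zq .
    moreover have "(e - S)\<^sup>2 = (s + e)\<^sup>2 \<or> (e - S)\<^sup>2 = (s - e)\<^sup>2"
      by (cases "s \<ge> 0") (auto simp: S_def power2_commute add.commute)
    ultimately show ?thesis using TS by auto
  qed
  ultimately have "lam\<^sup>2 \<le> e\<^sup>2 + (r - h)\<^sup>2" by linarith
  moreover have "(r - h)\<^sup>2 = r\<^sup>2 - 2 * r * h + h\<^sup>2" by (simp add: power2_eq_square algebra_simps)
  ultimately have "2 * r * h \<le> 2 * r\<^sup>2 - lam\<^sup>2" using h by linarith
  then have "2 * r * h / (2 * r\<^sup>2) \<le> (2 * r\<^sup>2 - lam\<^sup>2) / (2 * r\<^sup>2)" by (intro divide_right_mono) auto
  then have hr: "h / r \<le> 1 - 2 * (lam / (2 * r))\<^sup>2"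
    using r by (simp add: power2_eq_square field_simps)
  have "norm (z - p) \<le> 2 * r" using c by (intro norm_diff_le_of_ball_polytope[of "{p, q, z}"]) auto
  then have l1: "0 \<le> lam / (2 * r)" "lam / (2 * r) \<le> 1" using lam r by auto
  have e1: "norm (p - q) / (2 * r) = e / r" "0 \<le> e / r" "e / r \<le> 1" using f er r by auto
  have "cos (arcsin (e / r)) = h / r"
  proof -
    have "cos (arcsin (e / r)) = sqrt (1 - (e / r)\<^sup>2)" using e1 by (intro cos_arcsin) auto
    also have "1 - (e / r)\<^sup>2 = (h / r)\<^sup>2" using r by (simp add: power_divide h field_simps)
    finally show ?thesis using h r by simp
  qed
  moreover have "cos (2 * arcsin (lam / (2 * r))) = 1 - 2 * (lam / (2 * r))\<^sup>2"
    using l1 by (simp only: cos_double_sin) simp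
  ultimately have cc: "cos (arcsin (e / r)) \<le> cos (2 * arcsin (lam / (2 * r)))" using hr by simp
  show ?thesis
  proof (rule ccontr)
    assume "\<not> ?thesis"
    then have "arcsin (e / r) < 2 * arcsin (lam / (2 * r))" by (simp add: e1)
    moreover have "0 \<le> arcsin (e / r)" using e1 arcsin_le_arcsin[of 0 "e / r"] by simp
    moreover have "2 * arcsin (lam / (2 * r)) \<le> pi" using arcsin_ubound[of "lam / (2 * r)"] l1 by simp
    ultimately have "cos (2 * arcsin (lam / (2 * r))) < cos (arcsin (e / r))"
      by (intro cos_monotone_0_pi) auto
    with cc show False by simp
  qed
qed

text \<open>A centre without smooth direction can be dropped, and by \<open>arcsin_pair_of_inessential\<close> the two others
give \<open>4 arcsin(lam / 2r)\<close> where \<open>3 arcsin(lam / 2r)\<close> is asked for.\<close>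

lemma V1_upper_three_points:
  fixes F :: "(real ^ 2) set"
  assumes F: "card F = 3" and r: "r > 0" and ne: "ball_polytope F r \<noteq> {}"
    and lam: "0 \<le> lam" "\<And>p q. p \<in> F \<Longrightarrow> q \<in> F \<Longrightarrow> p \<noteq> q \<Longrightarrow> lam \<le> norm (p - q)"
  shows "V1 (ball_polytope F r) \<le> pi * r - 3 * r * arcsin (lam / (2 * r))"
proof -
  have fin: "finite F" using F by (simp add: card_ge_0_finite)
  show ?thesis
  proof (cases "\<forall>p\<in>F. \<exists>t. p + r *\<^sub>R dir t \<in> ball_polytope F r")
    case True
    then show ?thesis using V1_upper_separated[OF fin _ r _ lam] F by simp
  next
    case False
    then obtain z where z: "z \<in> F" "\<not> (\<exists>t. z + r *\<^sub>R dir t \<in> ball_polytope F r)" by blast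
    have "card (F - {z}) = 2" using F z by simp
    then obtain p q where pq: "F - {z} = {p, q}" "p \<noteq> q" by (meson card_2_iff)
    then have Feq: "F = {p, q, z}" and in_F: "p \<in> F" "q \<in> F" "z \<noteq> p" "z \<noteq> q" using z by auto
    obtain c where c: "c \<in> ball_polytope F r" using ne by blast
    have "2 * arcsin (lam / (2 * r)) \<le> arcsin (norm (p - q) / (2 * r))"
      using arcsin_pair_of_inessential[OF r pq(2) lam(1) lam(2)[OF z(1) in_F(1) in_F(3)] lam(2)[OF z(1) in_F(2) in_F(4)]
          c[unfolded Feq] z(2)[unfolded Feq]] .
    moreover have "0 \<le> arcsin (lam / (2 * r))"
      using lam(1) lam(2)[OF in_F(1,2) pq(2)] norm_diff_le_of_ball_polytope[OF ne in_F(1,2)] r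
        arcsin_le_arcsin[of 0 "lam / (2 * r)"] by simp
    ultimately have "3 * arcsin (lam / (2 * r)) \<le> 2 * arcsin (norm (p - q) / (2 * r))" by linarith
    then have "r * (3 * arcsin (lam / (2 * r))) \<le> r * (2 * arcsin (norm (p - q) / (2 * r)))"
      using r by (intro mult_left_mono) auto
    then show ?thesis using V1_upper_of_pair(1)[OF fin r ne in_F(1,2) pq(2)] by (simp add: algebra_simps)
  qed
qed

section \<open>Four separated centres\<close>

text \<open>A line that separates \<open>p\<close> from the other points has a normal that is smooth for \<open>p\<close> once the radius
is so large that the circle is flat enough.\<close>

lemma extreme_essential:
  fixes F :: "(real ^ 2) set"
  assumes "finite F" "p \<notin> convex hull (F - {p})"
  shows "\<forall>\<^sub>F R in at_top. \<exists>t. p + R *\<^sub>R dir t \<in> ball_polytope F R"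
proof -
  have "\<exists>t. \<forall>q\<in>F - {p}. dir t \<bullet> (q - p) > 0"
  proof (cases "F - {p} = {}")
    case False
    have "closed (convex hull (F - {p}))"
      using assms(1) by (intro compact_imp_closed finite_imp_compact_convex_hull) auto
    then obtain a b where ab: "a \<bullet> p < b" "\<And>x. x \<in> convex hull (F - {p}) \<Longrightarrow> a \<bullet> x > b"
      using separating_hyperplane_closed_point[OF convex_convex_hull _ assms(2)] by blast
    have pos: "a \<bullet> (q - p) > 0" if "q \<in> F - {p}" for q
      using ab(1) ab(2)[OF hull_inc[OF that]] by (simp add: inner_diff_right)
    then have "a \<noteq> 0" using False by fastforce
    then have "norm (inverse (norm a) *\<^sub>R a) = 1" by simp
    then obtain t where t: "inverse (norm a) *\<^sub>R a = dir t" by (rule unit_vector_eq_dir[where c = 0])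
    have "dir t \<bullet> v = inverse (norm a) * (a \<bullet> v)" for v unfolding t[symmetric] by simp
    then show ?thesis using pos \<open>a \<noteq> 0\<close> by (intro exI[of _ t]) simp
  qed auto
  then obtain t where t: "\<And>q. q \<in> F - {p} \<Longrightarrow> dir t \<bullet> (q - p) > 0" by blast
  have "\<forall>\<^sub>F R in at_top. (norm (p - q))\<^sup>2 + 2 * R * (dir t \<bullet> (p - q)) \<le> 0" if q: "q \<in> F" for q
  proof (cases "q = p")
    case False
    define g where "g = dir t \<bullet> (q - p)"
    have g: "g > 0" using t q False by (simp add: g_def)
    have eq: "dir t \<bullet> (p - q) = - g" by (simp add: g_def inner_diff_right)
    have "\<forall>\<^sub>F R in at_top. (norm (p - q))\<^sup>2 / (2 * g) \<le> R" by (rule eventually_ge_at_top)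
    then show ?thesis
    proof eventually_elim
      case (elim R)
      then have "(norm (p - q))\<^sup>2 \<le> R * (2 * g)" using g by (simp add: pos_divide_le_eq)
      then show ?case unfolding eq by (simp add: algebra_simps)
    qed
  qed simp
  then have "\<forall>\<^sub>F R in at_top. \<forall>q\<in>F. (norm (p - q))\<^sup>2 + 2 * R * (dir t \<bullet> (p - q)) \<le> 0"
    using assms(1) by (simp add: eventually_ball_finite_distrib)
  moreover have "\<forall>\<^sub>F R::real in at_top. R > 0" by (rule eventually_gt_at_top)
  ultimately show ?thesis
    by eventually_elim (use normal_dir_iff in blast)
qed

text \<open>Some two of three vectors with a nontrivial positive relation enclose at least 120 degrees, because
\<open>\<Sum> a\<^sub>i\<^sup>2 - \<Sum> a\<^sub>i a\<^sub>j\<close> is a sum of squares; the law of cosines gives the distance of their endpoints.\<close>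

lemma obtuse_pair:
  fixes w1 w2 w3 :: "'a::real_inner"
  assumes u: "u1 \<ge> 0" "u2 \<ge> 0" "u3 \<ge> 0" "u1 + u2 + u3 = 1"
    and 0: "u1 *\<^sub>R w1 + u2 *\<^sub>R w2 + u3 *\<^sub>R w3 = 0"
    and lam: "lam > 0" "lam \<le> norm w1" "lam \<le> norm w2" "lam \<le> norm w3"
  shows "sqrt 3 * lam \<le> norm (w1 - w2) \<or> sqrt 3 * lam \<le> norm (w1 - w3) \<or> sqrt 3 * lam \<le> norm (w2 - w3)"
proof (rule ccontr)
  assume contra: "\<not> ?thesis"
  have acute: "w \<bullet> w' + norm w * norm w' / 2 > 0"
    if lt: "\<not> sqrt 3 * lam \<le> norm (w - w')" and n: "lam \<le> norm w" "lam \<le> norm w'" for w w' :: 'a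
  proof (rule ccontr)
    assume neg: "\<not> ?thesis"
    have "(norm (w - w'))\<^sup>2 < (sqrt 3 * lam)\<^sup>2" using lt by (intro power_strict_mono) auto
    then have "(norm (w - w'))\<^sup>2 < 3 * lam\<^sup>2" by (simp add: power_mult_distrib)
    moreover have "(norm (w - w'))\<^sup>2 = (norm w)\<^sup>2 - 2 * (w \<bullet> w') + (norm w')\<^sup>2"
      using norm_plus_scaled_sq[of w "-1" w'] by (simp add: inner_commute)
    moreover have "lam\<^sup>2 \<le> (norm w)\<^sup>2" "lam\<^sup>2 \<le> (norm w')\<^sup>2" using n lam(1) by (auto intro!: power_mono)
    moreover have "lam\<^sup>2 \<le> norm w * norm w'"
      unfolding power2_eq_square using n lam(1) by (intro mult_mono) auto
    ultimately show False using neg by linarith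
  qed
  define g12 g13 g23 where "g12 = w1 \<bullet> w2 + norm w1 * norm w2 / 2"
    and "g13 = w1 \<bullet> w3 + norm w1 * norm w3 / 2" and "g23 = w2 \<bullet> w3 + norm w2 * norm w3 / 2"
  have g: "g12 > 0" "g13 > 0" "g23 > 0"
    unfolding g12_def g13_def g23_def using contra lam by (auto intro!: acute)
  define a1 a2 a3 where "a1 = u1 * norm w1" and "a2 = u2 * norm w2" and "a3 = u3 * norm w3"
  have "0 = (u1 *\<^sub>R w1 + u2 *\<^sub>R w2 + u3 *\<^sub>R w3) \<bullet> (u1 *\<^sub>R w1 + u2 *\<^sub>R w2 + u3 *\<^sub>R w3)"
    unfolding 0 by simp
  also have "\<dots> = u1\<^sup>2 * (w1 \<bullet> w1) + u2\<^sup>2 * (w2 \<bullet> w2) + u3\<^sup>2 * (w3 \<bullet> w3)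
      + 2 * (u1 * u2 * (w1 \<bullet> w2) + u1 * u3 * (w1 \<bullet> w3) + u2 * u3 * (w2 \<bullet> w3))"
    by (simp add: inner_add_left inner_add_right inner_commute power2_eq_square algebra_simps)
  also have "\<dots> = ((a1 - a2)\<^sup>2 + (a1 - a3)\<^sup>2 + (a2 - a3)\<^sup>2) / 2
      + 2 * (u1 * u2 * g12 + u1 * u3 * g13 + u2 * u3 * g23)"
    by (simp add: dot_square_norm a1_def a2_def a3_def g12_def g13_def g23_def power2_eq_square field_simps)
  finally have sum0: "((a1 - a2)\<^sup>2 + (a1 - a3)\<^sup>2 + (a2 - a3)\<^sup>2) / 2
      + 2 * (u1 * u2 * g12 + u1 * u3 * g13 + u2 * u3 * g23) = 0" by simp
  have nn: "0 \<le> u1 * u2 * g12" "0 \<le> u1 * u3 * g13" "0 \<le> u2 * u3 * g23" using u g by simp_all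
  have "X = 0 \<and> Y = 0 \<and> A = 0 \<and> B = 0 \<and> C = 0"
    if "(X + Y + Z) / 2 + 2 * (A + B + C) = 0" "0 \<le> X" "0 \<le> Y" "0 \<le> Z" "0 \<le> A" "0 \<le> B" "0 \<le> C"
    for X Y Z A B C :: real
    using that by (simp add: add_nonneg_eq_0_iff)
  from this[OF sum0 _ _ _ nn] have "(a1 - a2)\<^sup>2 = 0" "(a1 - a3)\<^sup>2 = 0"
    "u1 * u2 * g12 = 0" "u1 * u3 * g13 = 0" "u2 * u3 * g23 = 0" by auto
  then have "a1 = a2" "a1 = a3" "u1 = 0 \<or> u2 = 0" "u1 = 0 \<or> u3 = 0" "u2 = 0 \<or> u3 = 0" using g by auto
  moreover have "norm w1 > 0" "norm w2 > 0" "norm w3 > 0" using lam by auto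
  ultimately have "u1 = 0" "u2 = 0" "u3 = 0" unfolding a1_def a2_def a3_def by auto
  with u show False by simp
qed

lemma V1_le_of_larger_radius:
  fixes F :: "(real ^ 2) set"
  assumes "finite F" "F \<noteq> {}" "r > 0" "ball_polytope F r \<noteq> {}" "r \<le> R"
    "V1 (ball_polytope F R) \<le> pi * R - M"
  shows "V1 (ball_polytope F r) \<le> pi * r - M"
  using V1_ball_polytope_radius[OF assms(1-5)] assms(6) by (simp add: algebra_simps)

lemma sqrt3_bounds: "1.73 \<le> sqrt (3::real)" "sqrt (3::real) \<le> 1.74"
proof -
  show "1.73 \<le> sqrt (3::real)" by (rule real_le_rsqrt) (simp add: power2_eq_square)
  show "sqrt (3::real) \<le> 1.74" by (rule real_le_lsqrt) (simp_all add: power2_eq_square)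
qed

text \<open>If a vertex lies on the opposite side, this side has length at least \<open>2 lam\<close> and its endpoints suffice.
Otherwise all vertices have smooth directions for a large radius \<open>R\<close>, and the arcs are widened by
\<open>(\<surd>3/2) lam / R\<close> at the ends of the long side and by the remaining \<open>(1 - \<surd>3/2) lam / R\<close> at \<open>z\<close>.
Since \<open>arcsin x \<ge> x\<close>, lengths may replace angles.\<close>

lemma V1_upper_wide_triangle:
  fixes x y z :: "real ^ 2"
  assumes dist: "x \<noteq> y" "x \<noteq> z" "y \<noteq> z" and r: "r > 0" and ne: "ball_polytope {x, y, z} r \<noteq> {}"
    and lam: "lam > 0" "sqrt 3 * lam \<le> norm (x - y)" "lam \<le> norm (x - z)" "lam \<le> norm (y - z)"
  shows "V1 (ball_polytope {x, y, z} r) \<le> pi * r - (1 + sqrt 3 / 2) * lam"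
proof (cases "x \<in> convex hull {y, z} \<or> y \<in> convex hull {x, z} \<or> z \<in> convex hull {x, y}")
  case True
  have lxy: "lam \<le> norm (x - y)"
  proof -
    have "1 * lam \<le> sqrt 3 * lam" using lam(1) sqrt3_bounds by (intro mult_right_mono) auto
    then show ?thesis using lam(2) by simp
  qed
  have between: "2 * lam \<le> norm (b - c)"
    if "a \<in> convex hull {b, c}" "lam \<le> norm (a - b)" "lam \<le> norm (a - c)" for a b c :: "real ^ 2"
  proof -
    have "between (b, c) a" using that(1) by (simp add: between_mem_convex_hull)
    then have "dist b c = dist b a + dist a c" by (simp add: between)
    then show ?thesis using that by (simp add: dist_norm norm_minus_commute)
  qed
  obtain p q where pq: "p \<in> {x, y, z}" "q \<in> {x, y, z}" "p \<noteq> q" "2 * lam \<le> norm (p - q)"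
  proof -
    from True consider "2 * lam \<le> norm (y - z)" | "2 * lam \<le> norm (x - z)" | "2 * lam \<le> norm (x - y)"
      using between[of x y z] between[of y x z] between[of z x y] lxy lam
      by (metis norm_minus_commute)
    then show ?thesis using that dist by cases auto
  qed
  have "V1 (ball_polytope {x, y, z} r) \<le> pi * r - norm (p - q)"
    using pq r ne by (intro V1_upper_of_pair(2)) auto
  moreover have "(1 + sqrt 3 / 2) * lam \<le> 2 * lam" using lam(1) sqrt3_bounds by (intro mult_right_mono) auto
  ultimately show ?thesis using pq by linarith
next
  case False
  let ?F = "{x, y, z}"
  have diff: "?F - {x} = {y, z}" "?F - {y} = {x, z}" "?F - {z} = {x, y}" using dist by auto
  have "\<forall>\<^sub>F R in at_top. \<exists>t. x + R *\<^sub>R dir t \<in> ball_polytope ?F R"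
    "\<forall>\<^sub>F R in at_top. \<exists>t. y + R *\<^sub>R dir t \<in> ball_polytope ?F R"
    "\<forall>\<^sub>F R in at_top. \<exists>t. z + R *\<^sub>R dir t \<in> ball_polytope ?F R"
    using False by (intro extreme_essential; simp add: diff)+
  moreover have "\<forall>\<^sub>F R in at_top. r \<le> R" "\<forall>\<^sub>F R in at_top. lam \<le> R" by (rule eventually_ge_at_top)+
  ultimately have "\<forall>\<^sub>F R in at_top. (\<forall>p\<in>?F. \<exists>t. p + R *\<^sub>R dir t \<in> ball_polytope ?F R) \<and> r \<le> R \<and> lam \<le> R"
    by eventually_elim simp
  then obtain R where ess: "\<And>p. p \<in> ?F \<Longrightarrow> \<exists>t. p + R *\<^sub>R dir t \<in> ball_polytope ?F R" and R: "r \<le> R" "lam \<le> R"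
    using eventually_happens[of _ at_top] by fastforce
  have R0: "R > 0" using R r by simp
  have neR: "ball_polytope ?F R \<noteq> {}" using ess[of x] by blast
  define \<rho> where "\<rho> p = (if p = z then (1 - sqrt 3 / 2) * lam / R else sqrt 3 / 2 * lam / R)" for p
  have \<rho>: "\<rho> x = sqrt 3 / 2 * lam / R" "\<rho> y = sqrt 3 / 2 * lam / R" "\<rho> z = (1 - sqrt 3 / 2) * lam / R"
    using dist by (auto simp: \<rho>_def)
  have lR: "0 < lam / R" "lam / R \<le> 1" using lam R R0 by auto
  have arc: "norm (p - q) / R \<le> 2 * arcsin (norm (p - q) / (2 * R))" if "p \<in> ?F" "q \<in> ?F" for p q
    using arcsin_ge_self[of "norm (p - q) / (2 * R)"] norm_diff_le_of_ball_polytope[OF neR that] R0 by simp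
  have sum_le: "\<rho> x + \<rho> y \<le> norm (x - y) / R" "\<rho> x + \<rho> z \<le> norm (x - z) / R" "\<rho> y + \<rho> z \<le> norm (y - z) / R"
    unfolding \<rho> add_divide_distrib[symmetric] using lam R0 by (auto intro!: divide_right_mono simp: algebra_simps)
  have range: "0 \<le> \<rho> p \<and> \<rho> p \<le> pi / 2" for p
  proof -
    have "0 \<le> c * (lam / R) \<and> c * (lam / R) \<le> 1" if "0 \<le> c" "c \<le> 1" for c
    proof
      show "0 \<le> c * (lam / R)" using that lR by (intro mult_nonneg_nonneg) auto
      have "c * (lam / R) \<le> 1 * 1" using that lR by (intro mult_mono) auto
      then show "c * (lam / R) \<le> 1" by simp
    qed
    from this[of "sqrt 3 / 2"] this[of "1 - sqrt 3 / 2"] have "0 \<le> \<rho> p \<and> \<rho> p \<le> 1"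
      using sqrt3_bounds by (auto simp: \<rho>_def)
    then show ?thesis using pi_gt3 by simp
  qed
  have "V1 (ball_polytope ?F R) \<le> pi * R - R * (\<Sum>p\<in>?F. \<rho> p)"
  proof (rule V1_upper_bound)
    show "\<rho> p + \<rho> q \<le> 2 * arcsin (norm (p - q) / (2 * R))" if "p \<in> ?F" "q \<in> ?F" "p \<noteq> q" for p q
    proof -
      have "\<rho> p + \<rho> q \<le> norm (p - q) / R" using that sum_le by (auto simp: norm_minus_commute add.commute)
      then show ?thesis using arc[OF that(1,2)] by linarith
    qed
  qed (use dist R0 ess range in auto)
  also have "R * (\<Sum>p\<in>?F. \<rho> p) = (1 + sqrt 3 / 2) * lam"
    using dist R0 by (simp add: \<rho> field_simps)
  finally show ?thesis using r ne R by (intro V1_le_of_larger_radius[OF _ _ r ne R(1)]) auto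
qed

lemma V1_upper_four_points:
  fixes F :: "(real ^ 2) set"
  assumes F: "card F = 4" and r: "r > 0" and ne: "ball_polytope F r \<noteq> {}"
    and lam: "lam > 0" "\<And>p q. p \<in> F \<Longrightarrow> q \<in> F \<Longrightarrow> p \<noteq> q \<Longrightarrow> lam \<le> norm (p - q)"
  shows "V1 (ball_polytope F r) \<le> pi * r - (1 + sqrt 3 / 2) * lam"
proof -
  have fin: "finite F" using F by (simp add: card_ge_0_finite)
  have neF: "F \<noteq> {}" using F by auto
  show ?thesis
  proof (cases "\<exists>v\<in>F. v \<in> convex hull (F - {v})")
    case True
    then obtain v where v: "v \<in> F" "v \<in> convex hull (F - {v})" by blast
    have "card (F - {v}) = 3" using F v by simp
    then obtain x y z where xyz: "F - {v} = {x, y, z}" "x \<noteq> y" "x \<noteq> z" "y \<noteq> z" by (auto simp: card_3_iff)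
    then have inF: "x \<in> F" "y \<in> F" "z \<in> F" "v \<noteq> x" "v \<noteq> y" "v \<noteq> z" by auto
    obtain u1 u2 u3 where u: "0 \<le> u1" "0 \<le> u2" "0 \<le> u3" "u1 + u2 + u3 = 1"
      "v = u1 *\<^sub>R x + u2 *\<^sub>R y + u3 *\<^sub>R z"
      using v(2) unfolding xyz(1) convex_hull_3 by blast
    have "u1 *\<^sub>R (x - v) + u2 *\<^sub>R (y - v) + u3 *\<^sub>R (z - v)
        = (u1 *\<^sub>R x + u2 *\<^sub>R y + u3 *\<^sub>R z) - (u1 + u2 + u3) *\<^sub>R v"
      by (simp add: algebra_simps)
    also have "\<dots> = 0" using u(4,5) by simp
    finally have "u1 *\<^sub>R (x - v) + u2 *\<^sub>R (y - v) + u3 *\<^sub>R (z - v) = 0" .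
    from obtuse_pair[OF u(1-4) this lam(1)] have "sqrt 3 * lam \<le> norm (x - y)
        \<or> sqrt 3 * lam \<le> norm (x - z) \<or> sqrt 3 * lam \<le> norm (y - z)"
      using lam(2)[OF inF(1) v(1)] lam(2)[OF inF(2) v(1)] lam(2)[OF inF(3) v(1)] inF(4-6) by auto
    moreover have ne3: "ball_polytope {x, y, z} r \<noteq> {}"
      using ne ball_polytope_antimono[of "{x, y, z}" F r] inF by blast
    moreover have perm: "{x, z, y} = {x, y, z}" "{y, z, x} = {x, y, z}" by auto
    moreover have far: "lam \<le> norm (x - y)" "lam \<le> norm (x - z)" "lam \<le> norm (y - z)"
      "lam \<le> norm (z - y)" "lam \<le> norm (y - x)" "lam \<le> norm (z - x)"
      using lam(2) inF xyz(2-4) by auto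
    ultimately have "V1 (ball_polytope {x, y, z} r) \<le> pi * r - (1 + sqrt 3 / 2) * lam"
      using V1_upper_wide_triangle[of x y z r lam] V1_upper_wide_triangle[of x z y r lam] V1_upper_wide_triangle[of y z x r lam]
        xyz(2-4) r lam(1) by (elim disjE) simp_all
    moreover have "V1 (ball_polytope F r) \<le> V1 (ball_polytope {x, y, z} r)"
      using fin inF r ne by (intro V1_ball_polytope_antimono) auto
    ultimately show ?thesis by linarith
  next
    case False
    then have "\<forall>\<^sub>F R in at_top. \<forall>p\<in>F. \<exists>t. p + R *\<^sub>R dir t \<in> ball_polytope F R"
      using fin by (simp add: eventually_ball_finite_distrib extreme_essential)
    moreover have "\<forall>\<^sub>F R in at_top. r \<le> R" by (rule eventually_ge_at_top)
    ultimately have "\<forall>\<^sub>F R in at_top. (\<forall>p\<in>F. \<exists>t. p + R *\<^sub>R dir t \<in> ball_polytope F R) \<and> r \<le> R"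
      by eventually_elim simp
    then obtain R where ess: "\<And>p. p \<in> F \<Longrightarrow> \<exists>t. p + R *\<^sub>R dir t \<in> ball_polytope F R" and R: "r \<le> R"
      using eventually_happens[of _ at_top] by fastforce
    have R0: "R > 0" using R r by simp
    have "\<not> card F \<le> Suc 0" using F by simp
    then obtain p q where pq: "p \<in> F" "q \<in> F" "p \<noteq> q"
      unfolding card_le_Suc0_iff_eq[OF fin] by blast
    have "ball_polytope F R \<noteq> {}" using ess[OF pq(1)] by blast
    then have "lam \<le> 2 * R" using lam(2)[OF pq] norm_diff_le_of_ball_polytope[OF _ pq(1,2)] by fastforce
    then have "lam / (2 * R) \<le> arcsin (lam / (2 * R))" using lam(1) R0 by (intro arcsin_ge_self) auto
    then have "R * (4 * (lam / (2 * R))) \<le> R * (4 * arcsin (lam / (2 * R)))"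
      using R0 by (intro mult_left_mono) auto
    moreover have "V1 (ball_polytope F R) \<le> pi * R - R * (real (card F) * arcsin (lam / (2 * R)))"
      using F lam by (intro V1_upper_separated fin R0 ess) auto
    ultimately have "V1 (ball_polytope F R) \<le> pi * R - 2 * lam" using R0 F by simp
    moreover have "(1 + sqrt 3 / 2) * lam \<le> 2 * lam" using lam(1) sqrt3_bounds by (intro mult_right_mono) auto
    ultimately have "V1 (ball_polytope F R) \<le> pi * R - (1 + sqrt 3 / 2) * lam" by linarith
    then show ?thesis by (rule V1_le_of_larger_radius[OF fin neF r ne R])
  qed
qed

section \<open>Uniform contractions\<close>

lemma cball_subset_ball_polytope:
  fixes F :: "(real ^ 2) set"
  assumes "\<And>p. p \<in> F \<Longrightarrow> norm (p - c) \<le> J"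
  shows "cball c (r - J) \<subseteq> ball_polytope F r"
proof
  fix x assume x: "x \<in> cball c (r - J)"
  show "x \<in> ball_polytope F r" unfolding mem_ball_polytope
  proof
    fix p assume "p \<in> F"
    then have "norm (p - c) \<le> J" by (rule assms)
    moreover have "norm (x - c) \<le> r - J" using x by (simp add: dist_norm norm_minus_commute)
    ultimately show "norm (x - p) \<le> r" using norm_triangle_ineq4[of "x - c" "p - c"] by simp
  qed
qed

lemma V1_lower_bound_card_le:
  fixes F :: "(real ^ 2) set"
  assumes F: "finite F" "F \<noteq> {}" "card F \<le> N" and r: "r > 0"
    and lam: "0 \<le> lam" "lam \<le> 2 * r" "\<And>p q. p \<in> F \<Longrightarrow> q \<in> F \<Longrightarrow> norm (p - q) \<le> lam"
    and J: "\<And>p. p \<in> F \<Longrightarrow> norm (p - c) \<le> J" "J < r"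
  shows "pi * r - r * (real N * arcsin (lam / (2 * r))) \<le> V1 (ball_polytope F r)"
proof -
  have a0: "0 \<le> arcsin (lam / (2 * r))" using lam r arcsin_le_arcsin[of 0 "lam / (2 * r)"] by simp
  have sub: "cball c (r - J) \<subseteq> ball_polytope F r" by (rule cball_subset_ball_polytope[OF J(1)])
  show ?thesis
  proof (cases "card F \<le> 1")
    case True
    then obtain p where p: "F = {p}" using F by (metis One_nat_def card_le_Suc0_iff_eq is_singletonI' is_singleton_the_elem)
    show ?thesis unfolding p V1_ball[OF r] using a0 r by simp
  next
    case False
    have "c \<in> cball c (r - J)" "c + (r - J) *\<^sub>R dir 0 \<in> cball c (r - J)" using J(2) by (auto simp: dist_norm)
    moreover have "c \<noteq> c + (r - J) *\<^sub>R dir 0" using J(2) by simp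
    ultimately have "pi * r - r * real (card F) * arcsin (lam / (2 * r)) \<le> V1 (ball_polytope F r)"
      using False sub by (intro V1_lower_bound[OF F(1) _ r _ _ _ lam, of c "c + (r - J) *\<^sub>R dir 0"]) auto
    moreover have "r * real (card F) * arcsin (lam / (2 * r)) \<le> r * real N * arcsin (lam / (2 * r))"
      using F r a0 by (intro mult_right_mono mult_left_mono) auto
    ultimately show ?thesis by (simp add: mult.assoc)
  qed
qed

text \<open>The upper bound for \<open>P\<close> and the lower bound for \<open>Q\<close> coincide. The lower bound needs that \<open>r\<close> exceeds
the radius \<open>J\<close> of a disc that contains \<open>Q\<close>. If it does not, \<open>J = lam/2\<close> or \<open>J = lam/\<surd>3\<close>
makes \<open>N arcsin(lam / 2r)\<close> at least \<open>\<pi>\<close>, so that the bound for \<open>P\<close> is not positive.\<close>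

lemma V1_uniform_contraction_two_three:
  fixes P Q :: "(real ^ 2) set"
  assumes P: "finite P" "card P = N" "N = 2 \<or> N = 3"
    and Q: "finite Q" "Q \<noteq> {}" "card Q \<le> N" and r: "r > 0" and ne: "ball_polytope P r \<noteq> {}"
    and lam: "0 < lam" "\<And>p q. p \<in> P \<Longrightarrow> q \<in> P \<Longrightarrow> p \<noteq> q \<Longrightarrow> lam \<le> norm (p - q)"
      "\<And>p q. p \<in> Q \<Longrightarrow> q \<in> Q \<Longrightarrow> norm (p - q) \<le> lam"
  shows "V1 (ball_polytope P r) \<le> V1 (ball_polytope Q r)"
proof -
  define a where "a = arcsin (lam / (2 * r))"
  have "\<not> card P \<le> Suc 0" using P by auto
  then obtain p0 q0 where pq: "p0 \<in> P" "q0 \<in> P" "p0 \<noteq> q0"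
    unfolding card_le_Suc0_iff_eq[OF P(1)] by blast
  have l2r: "lam \<le> 2 * r"
    using lam(2)[OF pq] norm_diff_le_of_ball_polytope[OF ne pq(1,2)] by linarith
  have l1: "0 \<le> lam / (2 * r)" "lam / (2 * r) \<le> 1" using l2r lam(1) r by auto
  obtain J c where J: "\<And>p. p \<in> Q \<Longrightarrow> norm (p - c) \<le> J"
    and upper: "V1 (ball_polytope P r) \<le> pi * r - r * (real N * a)"
    and small: "r \<le> J \<Longrightarrow> pi \<le> real N * a"
  proof (cases "N = 2")
    case True
    then obtain p q where PP: "P = {p, q}" "p \<noteq> q" using P(2) by (meson card_2_iff)
    have lpq: "lam \<le> norm (p - q)" using lam(2)[of p q] PP by auto
    have d2r: "norm (p - q) \<le> 2 * r" using norm_diff_le_of_ball_polytope[OF ne, of p q] PP by auto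
    have "a \<le> arcsin (norm (p - q) / (2 * r))"
      unfolding a_def using l1 lpq d2r r by (intro arcsin_le_arcsin divide_right_mono) auto
    then have "2 * r * a \<le> 2 * r * arcsin (norm (p - q) / (2 * r))" using r by (intro mult_left_mono) auto
    then have up: "V1 (ball_polytope P r) \<le> pi * r - r * (real N * a)"
      using V1_upper_pair[OF PP(2) r d2r] True unfolding PP(1) by simp
    obtain x y where xy: "Q = {x, y}"
    proof -
      have "card Q \<noteq> 0" using Q by simp
      then consider "card Q = 1" | "card Q = 2" using Q(3) True by linarith
      then show ?thesis using that by cases (auto simp: card_1_singleton_iff card_2_iff)
    qed
    have "norm (x - y) \<le> lam" using lam(3) xy by auto
    then have "norm (p - (1/2) *\<^sub>R (x + y)) \<le> lam / 2" if "p \<in> Q" for p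
    proof -
      have "x - (1/2) *\<^sub>R (x + y) = (1/2) *\<^sub>R (x - y)" "y - (1/2) *\<^sub>R (x + y) = - ((1/2) *\<^sub>R (x - y))"
        by (simp_all add: vec_eq_iff field_simps)
      then have "norm (x - (1/2) *\<^sub>R (x + y)) = norm (x - y) / 2" "norm (y - (1/2) *\<^sub>R (x + y)) = norm (x - y) / 2"
        by simp_all
      then show ?thesis using that \<open>norm (x - y) \<le> lam\<close> unfolding xy by auto
    qed
    moreover have "pi \<le> real N * a" if "r \<le> lam / 2"
    proof -
      have "lam / (2 * r) = 1" using that l2r r by simp
      then show ?thesis using True by (simp add: a_def)
    qed
    ultimately show ?thesis using up by (intro that[of "(1/2) *\<^sub>R (x + y)" "lam / 2"])
  next
    case False
    then have N: "N = 3" using P(3) by simp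
    have up: "V1 (ball_polytope P r) \<le> pi * r - r * (real N * a)"
      using V1_upper_three_points[of P r lam] P N r ne lam by (simp add: a_def mult.commute mult.left_commute)
    obtain c where c: "\<And>p. p \<in> Q \<Longrightarrow> norm (p - c) \<le> lam / sqrt 3"
      using Jung_plane[OF Q(1,2) lam(3)] by blast
    moreover have "pi \<le> real N * a" if le: "r \<le> lam / sqrt 3"
    proof -
      have "r * sqrt 3 \<le> lam" using le by (simp add: pos_le_divide_eq)
      then have "sqrt 3 / 2 \<le> lam / (2 * r)" using r by (simp add: field_simps)
      then have "arcsin (sin (pi / 3)) \<le> a" unfolding a_def sin_60
        using l1 sqrt3_bounds(1) by (intro arcsin_le_arcsin) auto
      moreover have "arcsin (sin (pi / 3)) = pi / 3" by (rule arcsin_sin) (use pi_gt_zero in linarith)+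
      ultimately show ?thesis using N by simp
    qed
    ultimately show ?thesis using up by (intro that[of c "lam / sqrt 3"])
  qed
  show ?thesis
  proof (cases "r \<le> J")
    case True
    have "r * pi \<le> r * (real N * a)" using small[OF True] r by (intro mult_left_mono) auto
    then have "V1 (ball_polytope P r) \<le> 0" using upper by (simp add: mult.commute)
    also have "\<dots> \<le> V1 (ball_polytope Q r)" by (rule V1_nonneg[OF Q(1,2) r])
    finally show ?thesis .
  next
    case False
    then have "pi * r - r * (real N * a) \<le> V1 (ball_polytope Q r)"
      unfolding a_def using lam J l2r by (intro V1_lower_bound_card_le[OF Q r _ _ _ J]) auto
    with upper show ?thesis by linarith
  qed
qed

text \<open>Compared with \<open>\<pi>r\<close>, four points of \<open>P\<close> lose at least \<open>(1 + \<surd>3/2) lam\<close>, whereas the disc of radius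
\<open>r - lam/\<surd>3\<close> that Jung's theorem places in the intersection for \<open>Q\<close> loses \<open>(\<pi>/\<surd>3) lam\<close>, which is less.\<close>

lemma V1_uniform_contraction_ge_four:
  fixes P Q :: "(real ^ 2) set"
  assumes P: "finite P" "card P \<ge> 4"
    and Q: "finite Q" "Q \<noteq> {}" and r: "r > 0" and ne: "ball_polytope P r \<noteq> {}"
    and lam: "0 < lam" "\<And>p q. p \<in> P \<Longrightarrow> q \<in> P \<Longrightarrow> p \<noteq> q \<Longrightarrow> lam \<le> norm (p - q)"
      "\<And>p q. p \<in> Q \<Longrightarrow> q \<in> Q \<Longrightarrow> norm (p - q) \<le> lam"
  shows "V1 (ball_polytope P r) \<le> V1 (ball_polytope Q r)"
proof -
  obtain F where F: "F \<subseteq> P" "card F = 4" using obtain_subset_with_card_n[OF P(2)] by metis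
  then have neF: "ball_polytope F r \<noteq> {}" "F \<noteq> {}" using ne ball_polytope_antimono[OF F(1), of r] by auto
  have "V1 (ball_polytope P r) \<le> V1 (ball_polytope F r)"
    using P F(1) neF r ne by (intro V1_ball_polytope_antimono) auto
  also have "\<dots> \<le> pi * r - (1 + sqrt 3 / 2) * lam"
    using F lam by (intro V1_upper_four_points r neF) blast+
  finally have upper: "V1 (ball_polytope P r) \<le> pi * r - (1 + sqrt 3 / 2) * lam" .
  have const: "pi * (lam / sqrt 3) \<le> (1 + sqrt 3 / 2) * lam"
  proof -
    have "pi \<le> (1 + sqrt 3 / 2) * sqrt 3"
      using pi_approx(2) sqrt3_bounds(1) by (simp add: algebra_simps)
    then have "pi / sqrt 3 \<le> 1 + sqrt 3 / 2" by (simp add: pos_divide_le_eq)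
    then have "pi / sqrt 3 * lam \<le> (1 + sqrt 3 / 2) * lam" using lam(1) by (intro mult_right_mono) auto
    then show ?thesis by simp
  qed
  obtain c where c: "\<And>p. p \<in> Q \<Longrightarrow> norm (p - c) \<le> lam / sqrt 3"
    using Jung_plane[OF Q lam(3)] by blast
  show ?thesis
  proof (cases "r \<le> lam / sqrt 3")
    case True
    then have "pi * r \<le> pi * (lam / sqrt 3)" by (intro mult_left_mono) auto
    then have "V1 (ball_polytope P r) \<le> 0" using upper const by linarith
    also have "\<dots> \<le> V1 (ball_polytope Q r)" by (rule V1_nonneg[OF Q r])
    finally show ?thesis .
  next
    case False
    then have "pi * (r - lam / sqrt 3) \<le> V1 (ball_polytope Q r)"
      using cball_subset_ball_polytope[OF c] by (intro V1_ge_inball[OF Q r]) auto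
    then show ?thesis using upper const by (simp add: right_diff_distrib)
  qed
qed

theorem corollary5:
  fixes N :: nat and p q :: "nat \<Rightarrow> real ^ 2" and r :: real
  assumes "N > 1"
    and "uniform_contraction N q p"
    and "r > 0"
  shows "V1 (ball_polytope (p ` {1..N}) r) \<le> V1 (ball_polytope (q ` {1..N}) r)"
proof -
  let ?P = "p ` {1..N}" and ?Q = "q ` {1..N}"
  obtain lam where lam: "lam > 0"
    and contr: "\<And>i j. 1 \<le> i \<Longrightarrow> i < j \<Longrightarrow> j \<le> N \<Longrightarrow> dist (q i) (q j) \<le> lam \<and> lam \<le> dist (p i) (p j)"
    using assms(2) unfolding uniform_contraction_def by blast
  have idx: "dist (q i) (q j) \<le> lam \<and> lam \<le> dist (p i) (p j)" if "i \<in> {1..N}" "j \<in> {1..N}" "i \<noteq> j" for i j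
    using that contr[of i j] contr[of j i] by (cases i j rule: linorder_cases) (auto simp: dist_commute)
  have "inj_on p {1..N}"
  proof (rule inj_onI, rule ccontr)
    fix i j assume "i \<in> {1..N}" "j \<in> {1..N}" "p i = p j" "i \<noteq> j"
    then show False using idx[of i j] lam by simp
  qed
  then have cardP: "card ?P = N" by (simp add: card_image)
  have cardQ: "card ?Q \<le> N" using card_image_le[of "{1..N}" q] by simp
  have fin: "finite ?P" "finite ?Q" "?Q \<noteq> {}" using assms(1) by auto
  have sepP: "lam \<le> norm (x - y)" if "x \<in> ?P" "y \<in> ?P" "x \<noteq> y" for x y
  proof -
    obtain i j where "i \<in> {1..N}" "j \<in> {1..N}" "x = p i" "y = p j" using \<open>x \<in> ?P\<close> \<open>y \<in> ?P\<close> by blast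
    then show ?thesis using idx[of i j] \<open>x \<noteq> y\<close> by (cases "i = j") (auto simp: dist_norm)
  qed
  have diamQ: "norm (x - y) \<le> lam" if xy: "x \<in> ?Q" "y \<in> ?Q" for x y
  proof -
    obtain i j where "i \<in> {1..N}" "j \<in> {1..N}" "x = q i" "y = q j" using xy by blast
    then show ?thesis using idx[of i j] lam by (cases "i = j") (auto simp: dist_norm)
  qed
  show ?thesis
  proof (cases "ball_polytope ?P r = {}")
    case True
    then show ?thesis using V1_nonneg[OF fin(2,3) assms(3)] by (simp add: V1_def)
  next
    case False
    consider "N = 2 \<or> N = 3" | "N \<ge> 4" using assms(1) by linarith
    then show ?thesis
    proof cases
      case 1
      show ?thesis
        by (rule V1_uniform_contraction_two_three[OF fin(1) cardP 1 fin(2,3) cardQ assms(3) False lam sepP diamQ])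
    next
      case 2
      then have "card ?P \<ge> 4" by (simp only: cardP)
      then show ?thesis
        by (rule V1_uniform_contraction_ge_four[OF fin(1) _ fin(2,3) assms(3) False lam sepP diamQ])
    qed
  qed
qed

end
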